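(* Let $n\ge 2$ be an integer, let $\Gamma=\mathbb{R}\times\{0,1,2,\dots,n-1\}$, and let $\Lambda\subset\mathbb{R}^2$ be a closed set which is 2-periodic with respect to the second variable. If $(\Gamma,\Lambda)$ is a Heisenberg uniqueness pair, then $$\widetilde{\Pi_{ne}(\Lambda)}= \Pi^n(\Lambda)\cup\left(\Pi^1(\Lambda)\setminus \Pi^{1*}(\Lambda)\right)\cup \left(\Pi^{n-1}(\Lambda)\setminus \Pi^{(n-1)*}(\Lambda)\right)\cup\bigcup_{j=2}^{n-2}\left(\Pi^j(\Lambda)\setminus \Pi_{ne}^{j*}(\Lambda)\right)$$ is dense in $\mathbb{R}$. Conversely, if $$\widetilde{\Pi_{su}(\Lambda)}= \Pi^n(\Lambda)\cup\left(\Pi^1(\Lambda)\setminus \Pi^{1*}(\Lambda)\right)\cup \left(\Pi^{n-1}(\Lambda)\setminus \Pi^{(n-1)*}(\Lambda)\right)\cup\bigcup_{j=2}^{n-2}\left(\Pi^j(\Lambda)\setminus \Pi_{su}^{j*}(\Lambda)\right)$$ is dense in $\mathbb{R}$, then $(\Gamma,\Lambda)$ is a Heisenberg uniqueness pair.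
   Context: Fourier transforms: for a finite complex Borel measure $\mu$ on $\mathbb{R}^2$, $\hat\mu(\xi,\eta)=\int_{\mathbb{R}^2}e^{\pi i(x\xi+y\eta)}\,d\mu(x,y)$; for $f\in L^1(\mathbb{R})$ (complex-valued), $\hat f(\xi)=\int_{\mathbb{R}}e^{\pi i x\xi}f(x)\,dx$. Heisenberg uniqueness pair (HUP): $(\Gamma,\Lambda)$ is a HUP if for every finite complex measure $\mu$ on $\mathbb{R}^2$ that is supported on $\Gamma$ and absolutely continuous with respect to arc length on $\Gamma$, $\hat\mu|_\Lambda=0$ implies $\mu=0$. For $\Gamma=\mathbb{R}\times\{0,\dots,n-1\}$ such measures are those for which $\hat\mu(\xi,\eta)=\sum_{m=0}^{n-1}e^{m\pi i\eta}\hat f_m(\xi)$ with $f_0,\dots,f_{n-1}\in L^1(\mathbb{R})$. 2-periodic with respect to the second variable: $(\xi,\eta)\in\Lambda$ iff $(\xi,\eta+2)\in\Lambda$. An interval around $\xi$ is an open interval containing $\xi$. For $E\subset\mathbb{R}$, $\xi\in E$ and $2\le l\le n$, $P^{E,\xi}_l$ is the set of functions $\psi:E\to\mathbb{C}$ for which there are an interval $I_\xi$ around $\xi$ and $\varphi_1,\dots,\varphi_{l-1}\in L^1(\mathbb{R})$ with $\hat\varphi_1+\hat\varphi_2\psi+\cdots+\hat\varphi_{l-1}\psi^{l-2}+\psi^{l-1}=0$ on $I_\xi\cap E$. Let $\Pi(\Lambda)=\{\xi\in\mathbb{R}:(\xi,\eta)\in\Lambda\text{ for some }\eta\in\mathbb{R}\}$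 and $Img(\xi)=\{\eta\in\mathbb{R}:(\xi,\eta)\in\Lambda,\ 0\le\eta<2\}$. For $1\le k<n$, $\Pi^k(\Lambda)$ is the set of $\xi\in\Pi(\Lambda)$ such that $Img(\xi)$ has exactly $k$ distinct points, written $\eta_1<\dots<\eta_k$ (depending on $\xi$). $\Pi^n(\Lambda)$ is the set of $\xi\in\Pi(\Lambda)$ such that $Img(\xi)$ has at least $n$ distinct points. Define the following sets. - $\Pi^{1*}(\Lambda)=\{\xi\in\Pi^1(\Lambda):\chi\in P^{\Pi^1(\Lambda),\xi}_n\}$, where $\chi:\Pi^1(\Lambda)\to\mathbb{C}$, $\chi(\xi)=e^{\pi i\eta}$ with $\eta$ the unique point of $Img(\xi)$. - For $1<k<n-1$, $\Pi^{k*}_{su}(\Lambda)$ is the set of $\xi_0\in\Pi^k(\Lambda)$ for which there exist an interval $I$ around $\xi_0$ and $\varphi_1,\dots,\varphi_{n-1}\in L^1(\mathbb{R})$ such that for all $\xi\in I\cap\Pi^k(\Lambda)$ and $j=1,\dots,k$ (with $Img(\xi)=\{\eta_1,\dots,\eta_k\}$), $$\hat\varphi_1(\xi)+e^{\pi i\eta_j}\hat\varphi_2(\xi)+\cdots+e^{(n-2)\pi i\eta_j}\hat\varphi_{n-1}(\xi)=-e^{(n-1)\pi i\eta_j}.$$ - For $1<k<n-1$, $\Pi^{k*}_{ne}(\Lambda)$ is the set of $\xi_0\in\Pi^k(\Lambda)$ for which there exist an interval $I$ around $\xi_0$ and $\varphi_1,\dots,\varphi_k\in L^1(\mathbb{R})$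 such that for all $\xi\in I\cap\Pi^k(\Lambda)$ and $j=1,\dots,k$, $$\hat\varphi_1(\xi)+e^{\pi i\eta_j}\hat\varphi_2(\xi)+\cdots+e^{(k-1)\pi i\eta_j}\hat\varphi_k(\xi)=-e^{k\pi i\eta_j}.$$ - $\Pi^{(n-1)*}(\Lambda)$ is the set of $\xi_0\in\Pi^{n-1}(\Lambda)$ for which there exist an interval $I$ around $\xi_0$ and $\varphi_1,\dots,\varphi_{n-1}\in L^1(\mathbb{R})$ such that for all $\xi\in I\cap\Pi^{n-1}(\Lambda)$ and $j=1,\dots,n-1$, $$\hat\varphi_1(\xi)+e^{\pi i\eta_j}\hat\varphi_2(\xi)+\cdots+e^{(n-2)\pi i\eta_j}\hat\varphi_{n-1}(\xi)=-e^{(n-1)\pi i\eta_j}.$$ Unions over empty index ranges are empty. *)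

theory Defs
  imports "HOL-Analysis.Analysis"
begin

text \<open>
  The plane is \<^typ>\<open>real \<times> real\<close>, whose library metric is the Euclidean one.
  Elements of \<open>L\<^sup>1(\<real>)\<close> are given by Borel representatives.
\<close>

definition fourier :: "(real \<Rightarrow> complex) \<Rightarrow> real \<Rightarrow> complex" where
  "fourier f \<xi> = (LINT x|lborel. cis (pi * (x * \<xi>)) * f x)"


text \<open>
  A finite complex Borel measure is a countably additive complex set function on the Borel
  sets; its values on other sets are irrelevant. (Countable additivity forces the value on the
  empty set to be zero, and convergence of the series is automatically absolute.)
\<close>

definition complex_measure :: "('a::topological_space set \<Rightarrow> complex) \<Rightarrow> bool" where
  "complex_measure \<mu> \<longleftrightarrow>
     (\<forall>A :: nat \<Rightarrow> 'a set. range A \<subseteq> sets borel \<longrightarrow> disjoint_family A \<longrightarrow>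
        (\<lambda>i. \<mu> (A i)) sums \<mu> (\<Union>i. A i))"

text \<open>
  Positive part in the Jordan decomposition of a finite signed measure \<open>\<rho>\<close>. The negative part
  is the positive part of \<open>- \<rho>\<close>. Negative reals are sent to \<open>0\<close> by \<^const>\<open>ennreal\<close>, which does
  not affect the supremum, as the empty set contributes \<open>0\<close>.
\<close>

definition positive_variation :: "('a::topological_space set \<Rightarrow> real) \<Rightarrow> 'a measure" where
  "positive_variation \<rho> =
     measure_of UNIV (sets borel) (\<lambda>A. SUP B \<in> {B \<in> sets borel. B \<subseteq> A}. ennreal (\<rho> B))"

definition signed_integral ::
    "('a::topological_space set \<Rightarrow> real) \<Rightarrow> ('a \<Rightarrow> complex) \<Rightarrow> complex" where
  "signed_integral \<rho> g =
     (LINT z|positive_variation \<rho>. g z) - (LINT z|positive_variation (\<lambda>A. - \<rho> A). g z)"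

definition complex_integral ::
    "('a::topological_space set \<Rightarrow> complex) \<Rightarrow> ('a \<Rightarrow> complex) \<Rightarrow> complex" where
  "complex_integral \<mu> g =
     signed_integral (\<lambda>A. Re (\<mu> A)) g + \<i> * signed_integral (\<lambda>A. Im (\<mu> A)) g"

definition fourier_measure :: "((real \<times> real) set \<Rightarrow> complex) \<Rightarrow> real \<times> real \<Rightarrow> complex" where
  "fourier_measure \<mu> = (\<lambda>(\<xi>, \<eta>). complex_integral \<mu> (\<lambda>(x, y). cis (pi * (x * \<xi> + y * \<eta>))))"


text \<open>
  Arc length on a curve \<open>\<Gamma>\<close> is the one-dimensional Hausdorff measure restricted to \<open>\<Gamma>\<close>,
  normalised so that it agrees with length on line segments. Boundedness is required of the
  covering sets because \<^const>\<open>diameter\<close> is unspecified on unbounded sets.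
\<close>

definition hausdorff_measure_1 :: "'a::metric_space set \<Rightarrow> ennreal" where
  "hausdorff_measure_1 A =
     (SUP \<delta> \<in> {0<..}.
        INF U \<in> {U :: nat \<Rightarrow> 'a set.
                   A \<subseteq> (\<Union>i. U i) \<and> (\<forall>i. bounded (U i) \<and> diameter (U i) \<le> \<delta>)}.
          (\<Sum>i. ennreal (diameter (U i))))"

definition arc_length_on :: "'a::metric_space set \<Rightarrow> 'a set \<Rightarrow> ennreal" where
  "arc_length_on \<Gamma> A = hausdorff_measure_1 (A \<inter> \<Gamma>)"

definition supported_on :: "('a::topological_space set \<Rightarrow> complex) \<Rightarrow> 'a set \<Rightarrow> bool" where
  "supported_on \<mu> \<Gamma> \<longleftrightarrow> (\<forall>A \<in> sets borel. A \<inter> \<Gamma> = {} \<longrightarrow> \<mu> A = 0)"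

definition abs_continuous_arc_length ::
    "('a::metric_space set \<Rightarrow> complex) \<Rightarrow> 'a set \<Rightarrow> bool" where
  "abs_continuous_arc_length \<mu> \<Gamma> \<longleftrightarrow>
     (\<forall>A \<in> sets borel. arc_length_on \<Gamma> A = 0 \<longrightarrow> \<mu> A = 0)"

definition heisenberg_uniqueness_pair ::
    "(real \<times> real) set \<Rightarrow> (real \<times> real) set \<Rightarrow> bool" where
  "heisenberg_uniqueness_pair \<Gamma> \<Lambda> \<longleftrightarrow>
     (\<forall>\<mu>. complex_measure \<mu> \<longrightarrow> supported_on \<mu> \<Gamma> \<longrightarrow> abs_continuous_arc_length \<mu> \<Gamma> \<longrightarrow>
        (\<forall>p \<in> \<Lambda>. fourier_measure \<mu> p = 0) \<longrightarrow> (\<forall>A \<in> sets borel. \<mu> A = 0))"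


definition interval_around :: "real \<Rightarrow> real set \<Rightarrow> bool" where
  "interval_around \<xi> I \<longleftrightarrow> open I \<and> is_interval I \<and> \<xi> \<in> I"

text \<open>
  The set \<open>P\<^bsub>l\<^esub>\<^bsup>E,\<xi>\<^esup>\<close>. Functions on \<open>E\<close> are represented by functions on \<open>\<real>\<close>
  of which only the values on \<open>E\<close> matter.
\<close>

definition P_class :: "nat \<Rightarrow> real set \<Rightarrow> real \<Rightarrow> (real \<Rightarrow> complex) set" where
  "P_class l E \<xi> =
     {\<psi>. \<exists>I (\<phi> :: nat \<Rightarrow> real \<Rightarrow> complex).
           interval_around \<xi> I \<and> (\<forall>i \<in> {1..l-1}. integrable lborel (\<phi> i)) \<and>
           (\<forall>x \<in> I \<inter> E. (\<Sum>i=1..l-1. fourier (\<phi> i) x * \<psi> x ^ (i - 1)) + \<psi> x ^ (l - 1) = 0)}"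

definition Pi_proj :: "(real \<times> real) set \<Rightarrow> real set" where
  "Pi_proj \<Lambda> = {\<xi>. \<exists>\<eta>. (\<xi>, \<eta>) \<in> \<Lambda>}"

definition Img :: "(real \<times> real) set \<Rightarrow> real \<Rightarrow> real set" where
  "Img \<Lambda> \<xi> = {\<eta>. (\<xi>, \<eta>) \<in> \<Lambda> \<and> 0 \<le> \<eta> \<and> \<eta> < 2}"

text \<open>
  \<open>Pi_exactly \<Lambda> k\<close> is \<open>\<Pi>\<^sup>k(\<Lambda>)\<close> for \<open>1 \<le> k < n\<close>, and \<open>Pi_at_least \<Lambda> n\<close> is \<open>\<Pi>\<^sup>n(\<Lambda>)\<close>.
\<close>

definition Pi_exactly :: "(real \<times> real) set \<Rightarrow> nat \<Rightarrow> real set" where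
  "Pi_exactly \<Lambda> k = {\<xi> \<in> Pi_proj \<Lambda>. finite (Img \<Lambda> \<xi>) \<and> card (Img \<Lambda> \<xi>) = k}"

definition Pi_at_least :: "(real \<times> real) set \<Rightarrow> nat \<Rightarrow> real set" where
  "Pi_at_least \<Lambda> n = {\<xi> \<in> Pi_proj \<Lambda>. infinite (Img \<Lambda> \<xi>) \<or> n \<le> card (Img \<Lambda> \<xi>)}"

definition chi :: "(real \<times> real) set \<Rightarrow> real \<Rightarrow> complex" where
  "chi \<Lambda> \<xi> = cis (pi * (THE \<eta>. \<eta> \<in> Img \<Lambda> \<xi>))"

definition Pi_one_star :: "nat \<Rightarrow> (real \<times> real) set \<Rightarrow> real set" where
  "Pi_one_star n \<Lambda> =
     {\<xi> \<in> Pi_exactly \<Lambda> 1. chi \<Lambda> \<in> P_class n (Pi_exactly \<Lambda> 1) \<xi>}"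

text \<open>
  The three remaining starred sets are all of this form: near \<open>\<xi>\<^sub>0\<close>, the numbers \<open>e\<^bsup>\<pi>i\<eta>\<^esup>\<close>
  with \<open>\<eta> \<in> Img(\<xi>)\<close> are roots of one monic polynomial of degree \<open>d\<close> whose other coefficients
  are Fourier transforms of integrable functions, for all \<open>\<xi> \<in> \<Pi>\<^sup>k(\<Lambda>)\<close> simultaneously.
\<close>

definition Pi_star_deg :: "(real \<times> real) set \<Rightarrow> nat \<Rightarrow> nat \<Rightarrow> real set" where
  "Pi_star_deg \<Lambda> k d =
     {\<xi>\<^sub>0 \<in> Pi_exactly \<Lambda> k.
        \<exists>I (\<phi> :: nat \<Rightarrow> real \<Rightarrow> complex).
          interval_around \<xi>\<^sub>0 I \<and> (\<forall>i \<in> {1..d}. integrable lborel (\<phi> i)) \<and>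
          (\<forall>\<xi> \<in> I \<inter> Pi_exactly \<Lambda> k. \<forall>\<eta> \<in> Img \<Lambda> \<xi>.
             (\<Sum>i=1..d. cis (real (i - 1) * pi * \<eta>) * fourier (\<phi> i) \<xi>)
               = - cis (real d * pi * \<eta>))}"

definition Pi_star_su :: "nat \<Rightarrow> (real \<times> real) set \<Rightarrow> nat \<Rightarrow> real set" where
  "Pi_star_su n \<Lambda> k = Pi_star_deg \<Lambda> k (n - 1)"

definition Pi_star_ne :: "(real \<times> real) set \<Rightarrow> nat \<Rightarrow> real set" where
  "Pi_star_ne \<Lambda> k = Pi_star_deg \<Lambda> k k"

definition Pi_pred_star :: "nat \<Rightarrow> (real \<times> real) set \<Rightarrow> real set" where
  "Pi_pred_star n \<Lambda> = Pi_star_deg \<Lambda> (n - 1) (n - 1)"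

definition Pi_tilde_ne :: "nat \<Rightarrow> (real \<times> real) set \<Rightarrow> real set" where
  "Pi_tilde_ne n \<Lambda> =
     Pi_at_least \<Lambda> n
     \<union> (Pi_exactly \<Lambda> 1 - Pi_one_star n \<Lambda>)
     \<union> (Pi_exactly \<Lambda> (n - 1) - Pi_pred_star n \<Lambda>)
     \<union> (\<Union>j \<in> {2..n-2}. Pi_exactly \<Lambda> j - Pi_star_ne \<Lambda> j)"

definition Pi_tilde_su :: "nat \<Rightarrow> (real \<times> real) set \<Rightarrow> real set" where
  "Pi_tilde_su n \<Lambda> =
     Pi_at_least \<Lambda> n
     \<union> (Pi_exactly \<Lambda> 1 - Pi_one_star n \<Lambda>)
     \<union> (Pi_exactly \<Lambda> (n - 1) - Pi_pred_star n \<Lambda>)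
     \<union> (\<Union>j \<in> {2..n-2}. Pi_exactly \<Lambda> j - Pi_star_su n \<Lambda> j)"

end

theory Submission
  imports Defs "HOL-Probability.Sinc_Integral" "HOL-Probability.Levy"
begin

text \<open>
  A measure on \<open>n\<close> horizontal lines that is absolutely continuous with respect to arc length is an
  \<open>n\<close>-tuple \<open>f\<^sub>0, \<dots>, f\<^sub>n\<^sub>-\<^sub>1\<close> of integrable functions. Writing \<open>F\<^sub>m\<close> for the Fourier transform of \<open>f\<^sub>m\<close>, the
  transform of the measure at \<open>(\<xi>, \<eta>)\<close> is the value of the polynomial \<open>\<Sum> F\<^sub>m(\<xi>) z\<^sup>m\<close> at the unimodular
  number \<open>z = e\<^bsup>\<pi>i\<eta>\<^esup>\<close>. So \<open>\<Lambda>\<close> enters only through the sets of such numbers above each \<open>\<xi>\<close>, called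
  phases below, and the uniqueness property says that no nonzero polynomial of degree
  less than \<open>n\<close> over the algebra of Fourier transforms vanishes on all phases
  (\<open>heisenberg_uniqueness_pair_lines_iff\<close>).

  Sufficiency. If some \<open>F\<^sub>m\<close> is nonzero, it is nonzero at a point \<open>\<xi>\<^sub>0\<close> of the dense set. At least \<open>n\<close>
  phases above \<open>\<xi>\<^sub>0\<close> are too many roots. Otherwise the polynomial must be turned, near \<open>\<xi>\<^sub>0\<close>, into a
  monic one of degree \<open>n - 1\<close> that still vanishes on the phases; this puts \<open>\<xi>\<^sub>0\<close> into a starred
  set. When \<open>F\<^sub>n\<^sub>-\<^sub>1(\<xi>\<^sub>0) \<noteq> 0\<close> this is division by the leading coefficient, which is Wiener's lemma. In
  general only a lower coefficient, of index \<open>d\<close>, is known to survive at \<open>\<xi>\<^sub>0\<close>. This is the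
  situation of the Weierstrass preparation theorem: the coefficients above \<open>d\<close> vanish at \<open>\<xi>\<^sub>0\<close>, so near
  \<open>\<xi>\<^sub>0\<close> they agree with transforms of functions of arbitrarily small norm
  (\<open>small_representative\<close>), and a contraction in a weighted norm rewrites \<open>z\<^bsup>n-1\<^esup>\<close> as a combination
  of \<open>1, \<dots>, z\<^bsup>d-1\<^esup>\<close> (\<open>wiener_weierstrass_division\<close>, \<open>local_monic_relation\<close>). Wiener's lemma is
  contained in the same contraction.

  Necessity. Suppose that the set is not dense. Over some open set every point has fewer than \<open>n\<close> phases
  and, if it has any, lies in the starred set that belongs to their number. After shrinking, the largest number \<open>k\<close>
  of phases that occurs is attained on a dense subset (\<open>exists_dense_stratum\<close>). If \<open>k \<ge> 2\<close>, then near a point \<open>\<xi>\<^sub>0\<close>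
  of this subset a monic polynomial of degree \<open>k\<close> vanishes on the phases over the subset. Its \<open>k\<close> roots at
  \<open>\<xi>\<^sub>0\<close> are simple, so they persist, and because \<open>\<Lambda>\<close> is closed they are limits of phases and hence phases,
  also over the points outside the subset. As there are at most \<open>k\<close> phases, these are
  all of them (\<open>vanishing_on_fibres_extends\<close>). For \<open>k = 1\<close> the polynomial only has degree
  \<open>n - 1\<close>, but then the remaining points have no phases at all. Multiplying the
  coefficients by a bump function yields a nonzero polynomial of degree less than \<open>n\<close> that vanishes on all
  phases.
\<close>

section \<open>Fourier transforms of integrable functions\<close>

lemma borel_measurable_cis [measurable (raw)]:
  assumes "f \<in> borel_measurable M"
  shows "(\<lambda>x. cis (f x)) \<in> borel_measurable M"
  by (rule borel_measurable_continuous_on[OF _ assms]) (intro continuous_intros)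

lemma integrable_fourier_integrand:
  assumes "integrable lborel f"
  shows "integrable lborel (\<lambda>x. cis (pi * (x * \<xi>)) * f x)"
  by (rule Bochner_Integration.integrable_bound[OF assms])
     (use borel_measurable_integrable[OF assms] in \<open>auto simp: norm_mult\<close>)

lemma norm_fourier_le: "norm (fourier f \<xi>) \<le> (LINT x|lborel. norm (f x))"
proof -
  have "norm (fourier f \<xi>) \<le> (LINT x|lborel. norm (cis (pi * (x * \<xi>)) * f x))"
    unfolding fourier_def by (rule integral_norm_bound)
  then show ?thesis by (simp add: norm_mult)
qed

lemma fourier_add:
  assumes "integrable lborel f" "integrable lborel g"
  shows "fourier (\<lambda>x. f x + g x) \<xi> = fourier f \<xi> + fourier g \<xi>"
  unfolding fourier_def
  using integrable_fourier_integrand[OF assms(1), of \<xi>] integrable_fourier_integrand[OF assms(2), of \<xi>]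
  by (simp add: distrib_left)

lemma fourier_cmult: "fourier (\<lambda>x. c * f x) \<xi> = c * fourier f \<xi>"
  unfolding fourier_def by (simp add: mult.left_commute)

lemma isCont_fourier:
  assumes f: "integrable lborel f"
  shows "isCont (fourier f) \<xi>"
  unfolding continuous_at_sequentially comp_def
proof safe
  fix u :: "nat \<Rightarrow> real" assume u: "u \<longlonglongrightarrow> \<xi>"
  have [measurable]: "f \<in> borel_measurable borel" using f by auto
  show "(\<lambda>n. fourier f (u n)) \<longlonglongrightarrow> fourier f \<xi>"
    unfolding fourier_def
  proof (rule integral_dominated_convergence[where w="\<lambda>x. norm (f x)"])
    show "AE x in lborel. (\<lambda>n. cis (pi * (x * u n)) * f x) \<longlonglongrightarrow> cis (pi * (x * \<xi>)) * f x"
      using u by (intro AE_I2 tendsto_intros) auto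
  qed (use f in \<open>auto simp: norm_mult intro!: borel_measurable_times\<close>)
qed

text \<open>
  Fubini's theorem for a superposition of the functions \<open>k (y, \<cdot>)\<close>. With \<open>k (y, x) = f y * g (x - y)\<close> it
  gives the convolution; with \<open>g (x - y) - g x\<close> in place of \<open>g (x - y)\<close> it gives the sharper norm estimate
  behind \<open>small_representative\<close>.
\<close>

lemma fourier_superposition:
  fixes k :: "real \<times> real \<Rightarrow> complex"
  assumes k: "integrable (lborel \<Otimes>\<^sub>M lborel) k"
  obtains h where "integrable lborel h"
    "\<And>\<xi>. fourier h \<xi> = (LINT y|lborel. fourier (\<lambda>x. k (y, x)) \<xi>)"
    "(LINT x|lborel. norm (h x)) \<le> (LINT y|lborel. LINT x|lborel. norm (k (y, x)))"
proof -
  have km [measurable]: "k \<in> borel_measurable (lborel \<Otimes>\<^sub>M lborel)" using k by auto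
  have kin: "integrable (lborel \<Otimes>\<^sub>M lborel) (\<lambda>(y, x). norm (k (y, x)))"
    using k by (simp add: split_def)
  define h where "h = (\<lambda>x. LINT y|lborel. k (y, x))"
  have hi: "integrable lborel h"
    unfolding h_def using lborel_pair.integrable_snd[of "\<lambda>y x. k (y, x)"] k by simp
  have "(LINT x|lborel. norm (h x)) \<le> (LINT x|lborel. LINT y|lborel. norm (k (y, x)))"
    unfolding h_def
    by (intro integral_mono integral_norm_bound)
       (use hi lborel_pair.integrable_snd[of "\<lambda>y x. norm (k (y, x))"] kin in \<open>auto simp: h_def\<close>)
  also have "\<dots> = (LINT y|lborel. LINT x|lborel. norm (k (y, x)))"
    using lborel_pair.Fubini_integral[of "\<lambda>y x. norm (k (y, x))"] kin by simp
  finally have hn: "(LINT x|lborel. norm (h x)) \<le> (LINT y|lborel. LINT x|lborel. norm (k (y, x)))" .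
  have hf: "fourier h \<xi> = (LINT y|lborel. fourier (\<lambda>x. k (y, x)) \<xi>)" for \<xi>
  proof -
    have ei: "integrable (lborel \<Otimes>\<^sub>M lborel) (\<lambda>(y, x). cis (pi * (x * \<xi>)) * k (y, x))"
      by (rule Bochner_Integration.integrable_bound[OF k]) (auto simp: norm_mult)
    have "fourier h \<xi> = (LINT x|lborel. LINT y|lborel. cis (pi * (x * \<xi>)) * k (y, x))"
      unfolding fourier_def h_def by simp
    also have "\<dots> = (LINT y|lborel. LINT x|lborel. cis (pi * (x * \<xi>)) * k (y, x))"
      using lborel_pair.Fubini_integral[of "\<lambda>y x. cis (pi * (x * \<xi>)) * k (y, x)"] ei by simp
    finally show ?thesis by (simp add: fourier_def)
  qed
  show ?thesis using that[OF hi hf hn] .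
qed

lemma integrable_translate:
  fixes g :: "real \<Rightarrow> complex"
  shows "integrable lborel g \<Longrightarrow> integrable lborel (\<lambda>x. g (x - y))"
  using lborel_integrable_real_affine[of g 1 "-y"] by simp

lemma norm_integral_translate:
  "(LINT x|lborel. norm (g (x - y) :: complex)) = (LINT x|lborel. norm (g (x::real)))"
  using lborel_integral_real_affine[of 1 "\<lambda>x. norm (g x)" "-y"] by simp

lemma fourier_translate: "fourier (\<lambda>x. g (x - y)) \<xi> = cis (pi * (y * \<xi>)) * fourier g \<xi>"
proof -
  have "cis (pi * (x * \<xi>)) * g (x - y) = cis (pi * (y * \<xi>)) * (cis (pi * ((x - y) * \<xi>)) * g (x - y))" for x
    by (simp add: mult.assoc[symmetric] cis_mult distrib_left[symmetric] distrib_right[symmetric] del: mult_cancel_right)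
  then have "fourier (\<lambda>x. g (x - y)) \<xi> =
      (LINT x|lborel. cis (pi * (y * \<xi>)) * (cis (pi * ((x - y) * \<xi>)) * g (x - y)))"
    unfolding fourier_def by (rule Bochner_Integration.integral_cong[OF refl])
  also have "\<dots> = cis (pi * (y * \<xi>)) * fourier g \<xi>"
    unfolding fourier_def
    using lborel_integral_real_affine[of 1 "\<lambda>x. cis (pi * (x * \<xi>)) * g x" "-y"] by simp
  finally show ?thesis .
qed

lemma fourier_modulate: "fourier (\<lambda>x. cis (pi * (x * a)) * g x) \<xi> = fourier g (\<xi> + a)"
  unfolding fourier_def by (simp add: mult.assoc[symmetric] cis_mult distrib_left)

lemma convolution_L1:
  fixes f g :: "real \<Rightarrow> complex"
  assumes f: "integrable lborel f" and g: "integrable lborel g"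
  obtains h where "integrable lborel h" "fourier h = (\<lambda>\<xi>. fourier f \<xi> * fourier g \<xi>)"
    "(LINT x|lborel. norm (h x)) \<le> (LINT x|lborel. norm (f x)) * (LINT x|lborel. norm (g x))"
proof -
  define k where "k = (\<lambda>(y, x). f y * g (x - y))"
  have [measurable]: "f \<in> borel_measurable borel" "g \<in> borel_measurable borel" using f g by auto
  have km [measurable]: "k \<in> borel_measurable (lborel \<Otimes>\<^sub>M lborel)"
    unfolding k_def by measurable
  have ki: "integrable (lborel \<Otimes>\<^sub>M lborel) k"
  proof (rule lborel_pair.Fubini_integrable)
    show "integrable lborel (\<lambda>x. \<integral> y. norm (k (x, y)) \<partial>lborel)"
      unfolding k_def using f by (simp add: norm_mult norm_integral_translate[of g])
    show "AE x in lborel. integrable lborel (\<lambda>y. k (x, y))"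
      unfolding k_def using integrable_translate[OF g] by auto
  qed simp
  obtain h where h: "integrable lborel h"
    "\<And>\<xi>. fourier h \<xi> = (LINT y|lborel. fourier (\<lambda>x. k (y, x)) \<xi>)"
    "(LINT x|lborel. norm (h x)) \<le> (LINT y|lborel. LINT x|lborel. norm (k (y, x)))"
    using fourier_superposition[OF ki] by blast
  have "fourier (\<lambda>x. k (y, x)) \<xi> = cis (pi * (y * \<xi>)) * f y * fourier g \<xi>" for y \<xi>
    unfolding k_def by (simp add: fourier_cmult fourier_translate[of g])
  then have "fourier h \<xi> = fourier f \<xi> * fourier g \<xi>" for \<xi>
    unfolding h(2) by (simp add: fourier_def)
  moreover have "(LINT y|lborel. LINT x|lborel. norm (k (y, x))) =
      (LINT x|lborel. norm (f x)) * (LINT x|lborel. norm (g x))"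
    unfolding k_def by (simp add: norm_mult norm_integral_translate[of g])
  ultimately show ?thesis using that h by auto
qed

text \<open>
  The positive and negative parts of \<open>h\<close> have the same Fourier transform, in particular the same mass.
  After normalisation they are densities of two probability distributions with the same
  characteristic function, which are equal by Levy's uniqueness theorem.
\<close>

lemma real_fourier_zero_imp_AE_zero:
  fixes h :: "real \<Rightarrow> real"
  assumes h: "integrable lborel h" and z: "\<And>t. (LINT x|lborel. h x *\<^sub>R cis (t * x)) = 0"
  shows "AE x in lborel. h x = 0"
proof -
  define p where "p = (\<lambda>x. max (h x) 0)"
  define q where "q = (\<lambda>x. max (- h x) 0)"
  have [measurable]: "h \<in> borel_measurable borel" using h by auto
  have pi: "integrable lborel p" and qi: "integrable lborel q" unfolding p_def q_def using h by auto
  have hpq: "h x = p x - q x" and p0: "0 \<le> p x" and q0: "0 \<le> q x" for x by (auto simp: p_def q_def)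
  have [measurable]: "p \<in> borel_measurable borel" "q \<in> borel_measurable borel" using pi qi by auto
  have wi: "integrable lborel (\<lambda>x. w x *\<^sub>R cis (t * x))" if "integrable lborel w" for w :: "real \<Rightarrow> real" and t
    using borel_measurable_integrable[OF that]
    by (intro Bochner_Integration.integrable_bound[OF that]) auto
  have eq: "(LINT x|lborel. p x *\<^sub>R cis (t * x)) = (LINT x|lborel. q x *\<^sub>R cis (t * x))" for t
    using z[of t] wi[OF pi, of t] wi[OF qi, of t] unfolding hpq by (simp add: scaleR_diff_left)
  define a where "a = (LINT x|lborel. p x)"
  have aq: "a = (LINT x|lborel. q x)"
  proof -
    have "(LINT x|lborel. complex_of_real (p x)) = (LINT x|lborel. complex_of_real (q x))"
      using eq[of 0] by (simp add: scaleR_conv_of_real)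
    then show ?thesis unfolding a_def by (simp add: integral_complex_of_real)
  qed
  show ?thesis
  proof (cases "a = 0")
    case True
    have "AE x in lborel. p x = 0" "AE x in lborel. q x = 0"
      using True integral_nonneg_eq_0_iff_AE[OF pi] integral_nonneg_eq_0_iff_AE[OF qi] p0 q0 aq
      unfolding a_def by auto
    then show ?thesis by eventually_elim (simp add: hpq)
  next
    case False
    then have a: "a > 0" using Bochner_Integration.integral_nonneg[of lborel p] p0 unfolding a_def by (simp add: order_less_le)
    define M where "M = (\<lambda>w :: real \<Rightarrow> real. density lborel (\<lambda>x. ennreal (w x / a)))"
    have dist: "real_distribution (M w)"
      if w: "integrable lborel w" "\<And>x. 0 \<le> w x" "a = (LINT x|lborel. w x)" for w
    proof -
      have [measurable]: "w \<in> borel_measurable borel" using w by auto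
      have "emeasure (M w) (space (M w)) = (\<integral>\<^sup>+x. ennreal (w x / a) \<partial>lborel)"
        unfolding M_def by (simp add: emeasure_density)
      also have "\<dots> = ennreal (LINT x|lborel. w x / a)"
        using w a by (intro nn_integral_eq_integral) auto
      also have "\<dots> = 1" using w a by simp
      finally have "prob_space (M w)" by (rule prob_spaceI)
      then show ?thesis
        unfolding real_distribution_def real_distribution_axioms_def by (simp add: M_def)
    qed
    have char: "char (M w) t = (LINT x|lborel. w x *\<^sub>R cis (t * x)) / a"
      if w: "integrable lborel w" "\<And>x. 0 \<le> w x" for w t
    proof -
      have [measurable]: "w \<in> borel_measurable borel" using w by auto
      have "char (M w) t = (LINT x|lborel. (w x / a) *\<^sub>R iexp (t * x))"
        unfolding char_def M_def using w a by (subst integral_density) auto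
      also have "\<dots> = (LINT x|lborel. (w x *\<^sub>R cis (t * x)) / a)"
        by (intro Bochner_Integration.integral_cong) (auto simp: cis_conv_exp scaleR_conv_of_real)
      finally show ?thesis by simp
    qed
    have "M p = M q"
      by (rule Levy_uniqueness)
         (use dist pi qi p0 q0 a_def aq char eq in \<open>auto simp: fun_eq_iff\<close>)
    then have "AE x in lborel. ennreal (p x / a) = ennreal (q x / a)"
      unfolding M_def by (intro sigma_finite_measure.density_unique[OF sigma_finite_lborel]) auto
    then show ?thesis by eventually_elim (use a p0 q0 in \<open>auto simp: hpq\<close>)
  qed
qed

text \<open>
  The real and imaginary parts of \<open>f\<close> are combinations of \<open>f\<close> and its conjugate, and the transform of the
  conjugate of \<open>f\<close> at \<open>\<xi>\<close> is the conjugate of the transform of \<open>f\<close> at \<open>- \<xi>\<close>.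
\<close>

lemma fourier_zero_imp_AE_zero:
  assumes f: "integrable lborel f" and z: "\<And>\<xi>. fourier f \<xi> = 0"
  shows "AE x in lborel. f x = 0"
proof -
  have fm [measurable]: "f \<in> borel_measurable borel" using f by auto
  have i: "integrable lborel (\<lambda>x. cis (t * x) * f x)" for t
    by (rule Bochner_Integration.integrable_bound[OF f]) (auto simp: norm_mult)
  have [measurable]: "(\<lambda>x. cnj (f x)) \<in> borel_measurable borel"
    using borel_measurable_integrable[of lborel "\<lambda>x. cnj (f x)"] f by simp
  have ic: "integrable lborel (\<lambda>x. cis (t * x) * cnj (f x))" for t
    by (rule Bochner_Integration.integrable_bound[OF f]) (auto simp: norm_mult)
  have 1: "(LINT x|lborel. cis (t * x) * f x) = 0" for t
    using z[of "t / pi"] unfolding fourier_def by (simp add: mult.commute)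
  have 2: "(LINT x|lborel. cis (t * x) * cnj (f x)) = 0" for t
  proof -
    have "(LINT x|lborel. cis (t * x) * cnj (f x)) = (LINT x|lborel. cnj (cis ((-t) * x) * f x))"
      by (simp add: cis_cnj)
    also have "\<dots> = cnj (LINT x|lborel. cis ((-t) * x) * f x)" by (rule Bochner_Integration.integral_cnj)
    finally show ?thesis using 1[of "-t"] by simp
  qed
  have "AE x in lborel. Re (f x) = 0"
  proof (rule real_fourier_zero_imp_AE_zero)
    fix t
    have "Re (f x) *\<^sub>R cis (t * x) = (cis (t * x) * f x + cis (t * x) * cnj (f x)) / 2" for x
      by (simp add: complex_eq_iff)
    then have "(LINT x|lborel. Re (f x) *\<^sub>R cis (t * x)) =
        (LINT x|lborel. (cis (t * x) * f x + cis (t * x) * cnj (f x)) / 2)"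
      by (rule Bochner_Integration.integral_cong[OF refl])
    then show "(LINT x|lborel. Re (f x) *\<^sub>R cis (t * x)) = 0"
      using 1[of t] 2[of t] i[of t] ic[of t] by simp
  qed (use f in auto)
  moreover have "AE x in lborel. Im (f x) = 0"
  proof (rule real_fourier_zero_imp_AE_zero)
    fix t
    have "Im (f x) *\<^sub>R cis (t * x) = (cis (t * x) * f x - cis (t * x) * cnj (f x)) / (2 * \<i>)" for x
      by (simp add: complex_eq_iff Re_divide Im_divide power2_eq_square)
    then have "(LINT x|lborel. Im (f x) *\<^sub>R cis (t * x)) =
        (LINT x|lborel. (cis (t * x) * f x - cis (t * x) * cnj (f x)) / (2 * \<i>))"
      by (rule Bochner_Integration.integral_cong[OF refl])
    then show "(LINT x|lborel. Im (f x) *\<^sub>R cis (t * x)) = 0"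
      using 1[of t] 2[of t] i[of t] ic[of t] by simp
  qed (use f in auto)
  ultimately show ?thesis by eventually_elim (simp add: complex_eq_iff)
qed

section \<open>The Wiener algebra\<close>

text \<open>
  The norm of \<open>L\<^sup>1\<close> carried over to Fourier transforms, as a relation: it allows work with pointwise
  operations on functions and spares the choice of representatives in \<open>L\<^sup>1\<close>.
\<close>

definition wiener_norm_le :: "(real \<Rightarrow> complex) \<Rightarrow> real \<Rightarrow> bool" where
  "wiener_norm_le u r \<longleftrightarrow>
     (\<exists>f. integrable lborel f \<and> (LINT x|lborel. norm (f x)) \<le> r \<and> u = fourier f)"

lemma wiener_norm_leE:
  assumes "wiener_norm_le u r"
  obtains f where "integrable lborel f" "(LINT x|lborel. norm (f x)) \<le> r" "u = fourier f"
  using assms unfolding wiener_norm_le_def by blast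

lemma wiener_norm_le_fourier:
  "integrable lborel f \<Longrightarrow> wiener_norm_le (fourier f) (LINT x|lborel. norm (f x))"
  unfolding wiener_norm_le_def by blast

lemma wiener_norm_le_mono: "wiener_norm_le u r \<Longrightarrow> r \<le> s \<Longrightarrow> wiener_norm_le u s"
  by (elim wiener_norm_leE) (force simp: wiener_norm_le_def)

lemma wiener_norm_leD: "wiener_norm_le u r \<Longrightarrow> norm (u \<xi>) \<le> r"
  by (elim wiener_norm_leE) (use norm_fourier_le order_trans in blast)

lemma wiener_norm_le_nonneg: "wiener_norm_le u r \<Longrightarrow> 0 \<le> r"
  using order_trans[OF norm_ge_zero wiener_norm_leD] .

lemma wiener_norm_le_0: "wiener_norm_le (\<lambda>_. 0) 0"
  unfolding wiener_norm_le_def by (rule exI[of _ "\<lambda>_. 0"]) (simp add: fourier_def[abs_def])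

lemma wiener_norm_le_add:
  assumes "wiener_norm_le u r" "wiener_norm_le v s"
  shows "wiener_norm_le (\<lambda>\<xi>. u \<xi> + v \<xi>) (r + s)"
proof -
  obtain f where f: "integrable lborel f" "(LINT x|lborel. norm (f x)) \<le> r" "u = fourier f"
    using assms(1) by (rule wiener_norm_leE)
  obtain g where g: "integrable lborel g" "(LINT x|lborel. norm (g x)) \<le> s" "v = fourier g"
    using assms(2) by (rule wiener_norm_leE)
  have "(LINT x|lborel. norm (f x + g x)) \<le> (LINT x|lborel. norm (f x) + norm (g x))"
    using f g by (intro integral_mono norm_triangle_ineq) auto
  also have "\<dots> \<le> r + s" using f g by simp
  finally show ?thesis unfolding wiener_norm_le_def
    using f g by (intro exI[of _ "\<lambda>x. f x + g x"]) (auto simp: fun_eq_iff fourier_add)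
qed

lemma wiener_norm_le_mult:
  assumes "wiener_norm_le u r" "wiener_norm_le v s"
  shows "wiener_norm_le (\<lambda>\<xi>. u \<xi> * v \<xi>) (r * s)"
proof -
  obtain f where f: "integrable lborel f" "(LINT x|lborel. norm (f x)) \<le> r" "u = fourier f"
    using assms(1) by (rule wiener_norm_leE)
  obtain g where g: "integrable lborel g" "(LINT x|lborel. norm (g x)) \<le> s" "v = fourier g"
    using assms(2) by (rule wiener_norm_leE)
  obtain h where h: "integrable lborel h" "fourier h = (\<lambda>\<xi>. fourier f \<xi> * fourier g \<xi>)"
    "(LINT x|lborel. norm (h x)) \<le> (LINT x|lborel. norm (f x)) * (LINT x|lborel. norm (g x))"
    using convolution_L1[OF f(1) g(1)] by blast
  have "(LINT x|lborel. norm (f x)) * (LINT x|lborel. norm (g x)) \<le> r * s"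
    using f g wiener_norm_le_nonneg[OF assms(1)] by (intro mult_mono) auto
  then show ?thesis unfolding wiener_norm_le_def using h f g by (intro exI[of _ h]) auto
qed

lemma wiener_norm_le_sum:
  assumes "finite A" "\<And>i. i \<in> A \<Longrightarrow> wiener_norm_le (u i) (r i)"
  shows "wiener_norm_le (\<lambda>\<xi>. \<Sum>i\<in>A. u i \<xi>) (\<Sum>i\<in>A. r i)"
  using assms
proof (induction A rule: finite_induct)
  case empty
  then show ?case using wiener_norm_le_0 by simp
next
  case (insert i A)
  then show ?case using wiener_norm_le_add[of "u i" "r i"] by simp
qed

text \<open>
  Completeness of the Wiener algebra: representatives with summable norms have a sum that converges
  absolutely almost everywhere and in \<open>L\<^sup>1\<close>.
\<close>

lemma wiener_norm_le_suminf:
  assumes u: "\<And>k. wiener_norm_le (u k) (r k)" and r: "summable r"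
  shows "wiener_norm_le (\<lambda>\<xi>. \<Sum>k. u k \<xi>) (\<Sum>k. r k)"
proof -
  have "\<exists>f. integrable lborel f \<and> (LINT x|lborel. norm (f x)) \<le> r k \<and> u k = fourier f" for k
    using u unfolding wiener_norm_le_def by blast
  then obtain f where f: "\<And>k. integrable lborel (f k)" "\<And>k. (LINT x|lborel. norm (f k x)) \<le> r k"
    "\<And>k. u k = fourier (f k)" by metis
  have fm[measurable]: "f k \<in> borel_measurable borel" for k using f(1)[of k] by auto
  have sn: "summable (\<lambda>k. LINT x|lborel. norm (f k x))"
    by (rule summable_comparison_test'[OF r, of 0]) (use f(2) in auto)
  have ae: "AE x in lborel. summable (\<lambda>k. norm (f k x))"
  proof -
    have "(\<integral>\<^sup>+x. (\<Sum>k. ennreal (norm (f k x))) \<partial>lborel) = (\<Sum>k. \<integral>\<^sup>+x. ennreal (norm (f k x)) \<partial>lborel)"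
      by (rule nn_integral_suminf) simp
    also have "\<dots> = (\<Sum>k. ennreal (LINT x|lborel. norm (f k x)))"
      using f(1) by (intro suminf_cong nn_integral_eq_integral) auto
    also have "\<dots> < \<infinity>" using sn by (simp add: suminf_ennreal2 less_top)
    finally have "AE x in lborel. (\<Sum>k. ennreal (norm (f k x))) \<noteq> \<infinity>"
      by (intro nn_integral_PInf_AE) auto
    then show ?thesis by eventually_elim (auto intro!: summable_suminf_not_top)
  qed
  define F where "F = (\<lambda>x. \<Sum>k. f k x)"
  have Fi: "integrable lborel F" unfolding F_def
    by (rule integrable_suminf) (use f(1) ae sn in auto)
  have "fourier F \<xi> = (\<Sum>k. u k \<xi>)" for \<xi>
  proof -
    have "(LINT x|lborel. (\<Sum>k. cis (pi * (x * \<xi>)) * f k x)) = (\<Sum>k. LINT x|lborel. cis (pi * (x * \<xi>)) * f k x)"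
      by (rule integral_suminf) (use f(1) ae sn in \<open>auto simp: norm_mult intro: integrable_fourier_integrand\<close>)
    moreover have "(LINT x|lborel. (\<Sum>k. cis (pi * (x * \<xi>)) * f k x)) = fourier F \<xi>"
      unfolding fourier_def F_def
    proof (rule integral_cong_AE)
      show "AE x in lborel. (\<Sum>k. cis (pi * (x * \<xi>)) * f k x) = cis (pi * (x * \<xi>)) * (\<Sum>k. f k x)"
        using ae by eventually_elim (auto intro!: suminf_mult summable_norm_cancel)
    qed auto
    ultimately show ?thesis unfolding f(3) fourier_def by simp
  qed
  moreover have "(LINT x|lborel. norm (F x)) \<le> (\<Sum>k. r k)"
  proof -
    have "(LINT x|lborel. norm (F x)) \<le> (LINT x|lborel. (\<Sum>k. norm (f k x)))"
    proof (rule integral_mono_AE)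
      show "integrable lborel (\<lambda>x. \<Sum>k. norm (f k x))"
        by (rule integrable_suminf) (use f(1) ae sn in auto)
      show "AE x in lborel. norm (F x) \<le> (\<Sum>k. norm (f k x))"
        using ae unfolding F_def by eventually_elim (rule summable_norm)
    qed (use Fi in auto)
    also have "\<dots> = (\<Sum>k. LINT x|lborel. norm (f k x))"
      by (rule integral_suminf) (use f(1) ae sn in auto)
    also have "\<dots> \<le> (\<Sum>k. r k)" using f(2) sn r by (intro suminf_le) auto
    finally show ?thesis .
  qed
  ultimately show ?thesis unfolding wiener_norm_le_def using Fi by (intro exI[of _ F]) auto
qed

section \<open>De la Vallee Poussin kernel and localisation\<close>

lemma integrable_cauchy_bound: "integrable lborel (\<lambda>x :: real. c / (1 + x\<^sup>2))"
proof -
  have "integrable lborel (\<lambda>x :: real. inverse (1 + x\<^sup>2))"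
    using integrable_inverse_1_plus_square
    by (simp add: set_integrable_def interval_lebesgue_integrable_def einterval_def)
  then have "integrable lborel (\<lambda>x :: real. c * inverse (1 + x\<^sup>2))" by simp
  then show ?thesis by (simp add: divide_inverse)
qed

text \<open>
  The numerator is at most \<open>2\<close> and at most \<open>x\<^sup>2 / 2\<close>.
\<close>

lemma one_minus_cos_quotient_bounds:
  "0 \<le> (1 - cos x) / x\<^sup>2" "(1 - cos x) / x\<^sup>2 \<le> 3 / (1 + x\<^sup>2 :: real)"
proof -
  show "0 \<le> (1 - cos x) / x\<^sup>2" by simp
  have "1 - cos x = 2 * (sin (x/2))\<^sup>2" using cos_double_sin[of "x/2"] by simp
  also have "\<dots> \<le> 2 * (x/2)\<^sup>2" using iffD1[OF abs_le_square_iff abs_sin_x_le_abs_x[of "x/2"]] by simp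
  finally have 1: "1 - cos x \<le> x\<^sup>2 / 2" by (simp add: power2_eq_square)
  have 2: "1 - cos x \<le> 2" using cos_ge_minus_one[of x] by linarith
  show "(1 - cos x) / x\<^sup>2 \<le> 3 / (1 + x\<^sup>2)"
  proof (cases "x = 0")
    case False
    have "(1 - cos x) * (1 + x\<^sup>2) = (1 - cos x) + (1 - cos x) * x\<^sup>2" by (simp add: algebra_simps)
    also have "\<dots> \<le> x\<^sup>2 / 2 + 2 * x\<^sup>2" using 1 2 by (intro add_mono mult_right_mono) auto
    also have "\<dots> \<le> 3 * x\<^sup>2" by simp
    finally show ?thesis using False by (simp add: divide_simps add_pos_nonneg mult_ac)
  qed simp
qed

lemma integrable_one_minus_cos_quotient: "integrable lborel (\<lambda>x :: real. (1 - cos x) / x\<^sup>2)"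
  by (rule Bochner_Integration.integrable_bound[OF integrable_cauchy_bound[of 3]])
     (use one_minus_cos_quotient_bounds in \<open>auto simp: add_nonneg_nonneg\<close>)

text \<open>
  The value is \<open>\<pi>\<close>. It serves only as a normalising constant, so that its positivity suffices.
\<close>

definition cos_quotient_integral :: real where
  "cos_quotient_integral = (LINT x|lborel. (1 - cos x) / x\<^sup>2)"

lemma cos_quotient_integral_pos: "cos_quotient_integral > 0"
proof -
  have "cos_quotient_integral \<noteq> 0"
  proof
    assume "cos_quotient_integral = 0"
    then have "AE x in lborel. (1 - cos x) / x\<^sup>2 = (0::real)"
      unfolding cos_quotient_integral_def
      using integral_nonneg_eq_0_iff_AE[OF integrable_one_minus_cos_quotient] one_minus_cos_quotient_bounds
      by auto
    then have "AE x in lborel. x \<notin> {1..2::real}"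
    proof eventually_elim
      case (elim x)
      have "x \<noteq> 0 \<Longrightarrow> cos x = 1" using elim by auto
      moreover have "cos x < 1" if "1 \<le> x" "x \<le> 2"
        using cos_monotone_0_pi[of 0 x] that pi_gt3 by auto
      ultimately show ?case by force
    qed
    then have "emeasure lborel {1..2::real} = 0"
      by (subst (asm) AE_iff_measurable[of "{1..2}"]) auto
    then show False by simp
  qed
  moreover have "0 \<le> cos_quotient_integral"
    unfolding cos_quotient_integral_def
    using one_minus_cos_quotient_bounds by (intro Bochner_Integration.integral_nonneg) auto
  ultimately show ?thesis by linarith
qed

text \<open>
  The substitution of \<open>u x\<close> for \<open>x\<close>. This formula is the source of every explicit
  Fourier transform below: it shows that \<open>\<bar>u\<bar>\<close> is a superposition of the functions \<open>1 - cos (u x)\<close>.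
\<close>

lemma has_integral_one_minus_cos_scaled:
  "has_bochner_integral lborel (\<lambda>x. (1 - cos (u * x)) / x\<^sup>2) (\<bar>u\<bar> * cos_quotient_integral)"
proof (cases "u = 0")
  case False
  have "has_bochner_integral lborel (\<lambda>x. (1 - cos (u * x)) / (u * x)\<^sup>2) (cos_quotient_integral /\<^sub>R \<bar>u\<bar>)"
    using lborel_has_bochner_integral_real_affine_iff[OF False, of "\<lambda>x. (1 - cos x) / x\<^sup>2" cos_quotient_integral 0]
      integrable_one_minus_cos_quotient
    by (simp add: has_bochner_integral_iff cos_quotient_integral_def)
  then have "has_bochner_integral lborel (\<lambda>x. u\<^sup>2 * ((1 - cos (u * x)) / (u * x)\<^sup>2))
      (u\<^sup>2 * (cos_quotient_integral /\<^sub>R \<bar>u\<bar>))"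
    by (rule has_bochner_integral_mult_right)
  moreover have "u\<^sup>2 * (cos_quotient_integral /\<^sub>R \<bar>u\<bar>) = \<bar>u\<bar> * cos_quotient_integral"
    using False by (simp add: field_simps power2_eq_square abs_mult_self_eq)
  moreover have "(\<lambda>x. u\<^sup>2 * ((1 - cos (u * x)) / (u * x)\<^sup>2)) = (\<lambda>x. (1 - cos (u * x)) / x\<^sup>2)"
    using False by (auto simp: fun_eq_iff power_mult_distrib)
  ultimately show ?thesis by (simp only:)
qed (simp add: has_bochner_integral_iff)

text \<open>
  A kernel whose Fourier transform is a trapezoid: a product of two sine quotients is, up to a factor,
  the transform of the convolution of the indicators of two intervals of different lengths.
\<close>

definition vallee_poussin :: "real \<Rightarrow> complex" where
  "vallee_poussin x = complex_of_real (sin (2 * x) * sin x / x\<^sup>2 / cos_quotient_integral)"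

lemma borel_measurable_vallee_poussin [measurable]: "vallee_poussin \<in> borel_measurable borel"
  unfolding vallee_poussin_def[abs_def] by measurable

lemma norm_vallee_poussin_le:
  "norm (vallee_poussin x) \<le> (3 / cos_quotient_integral) / (1 + x\<^sup>2)"
proof (cases "x = 0")
  case False
  have 1: "\<bar>sin (2 * x) * sin x\<bar> \<le> \<bar>2 * x\<bar> * \<bar>x\<bar>"
    unfolding abs_mult[of "sin (2 * x)"] using abs_sin_x_le_abs_x by (intro mult_mono) auto
  have 2: "\<bar>sin (2 * x) * sin x\<bar> \<le> 1 * 1"
    unfolding abs_mult[of "sin (2 * x)"] by (intro mult_mono) auto
  have "\<bar>sin (2 * x) * sin x\<bar> * (1 + x\<^sup>2) = \<bar>sin (2 * x) * sin x\<bar> + \<bar>sin (2 * x) * sin x\<bar> * x\<^sup>2"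
    by (simp add: algebra_simps)
  also have "\<dots> \<le> \<bar>2 * x\<bar> * \<bar>x\<bar> + 1 * 1 * x\<^sup>2"
    using 1 2 by (intro add_mono mult_right_mono) auto
  also have "\<dots> = 3 * x\<^sup>2" by (simp add: abs_mult power2_eq_square)
  finally have "\<bar>sin (2 * x) * sin x\<bar> / x\<^sup>2 \<le> 3 / (1 + x\<^sup>2)"
    using False by (simp add: divide_simps add_pos_nonneg mult_ac)
  then have "\<bar>sin (2 * x) * sin x\<bar> / x\<^sup>2 / cos_quotient_integral \<le> 3 / (1 + x\<^sup>2) / cos_quotient_integral"
    using cos_quotient_integral_pos by (intro divide_right_mono) auto
  then show ?thesis unfolding vallee_poussin_def norm_of_real using cos_quotient_integral_pos
    by (simp add: abs_mult mult.commute)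
qed (use cos_quotient_integral_pos in \<open>simp add: vallee_poussin_def\<close>)

lemma integrable_vallee_poussin: "integrable lborel vallee_poussin"
  by (rule Bochner_Integration.integrable_bound[OF integrable_cauchy_bound[of "3 / cos_quotient_integral"]])
     (use norm_vallee_poussin_le cos_quotient_integral_pos in \<open>auto simp: add_nonneg_nonneg\<close>)

text \<open>
  The product \<open>sin (2 x) sin x cos (t x)\<close> is a combination of four functions \<open>1 - cos (u x)\<close>, which
  turn into the four absolute values; the sine part is odd.
\<close>

lemma integral_vallee_poussin_cis:
  "(LINT x|lborel. cis (t * x) * vallee_poussin x)
     = complex_of_real ((\<bar>3 + t\<bar> + \<bar>3 - t\<bar> - \<bar>1 + t\<bar> - \<bar>1 - t\<bar>) / 4)"
proof -
  define S where "S = (\<lambda>x :: real. sin (2 * x) * sin x / x\<^sup>2)"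
  have i: "integrable lborel (\<lambda>x. cis (t * x) * vallee_poussin x)"
    by (rule Bochner_Integration.integrable_bound[OF integrable_vallee_poussin]) (auto simp: norm_mult)
  define C where "C = cos_quotient_integral"
  have C: "C > 0" using cos_quotient_integral_pos by (simp add: C_def)
  have Re: "(LINT x|lborel. cos (t * x) * S x) = C * (\<bar>3 + t\<bar> + \<bar>3 - t\<bar> - \<bar>1 + t\<bar> - \<bar>1 - t\<bar>) / 4"
  proof -
    have trig: "cos (t * x) * S x =
        ((1 - cos ((3 + t) * x)) / x\<^sup>2 + (1 - cos ((3 - t) * x)) / x\<^sup>2
        - (1 - cos ((1 + t) * x)) / x\<^sup>2 - (1 - cos ((1 - t) * x)) / x\<^sup>2) / 4" for x
    proof -
      have a: "sin (2 * x) * sin x = (cos x - cos (3 * x)) / 2"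
        using sin_times_sin[of "2*x" x] by (simp add: algebra_simps)
      have b: "cos (t * x) * cos x = (cos ((1 + t) * x) + cos ((1 - t) * x)) / 2"
        using cos_times_cos[of x "t * x"] by (simp add: algebra_simps)
      have c: "cos (t * x) * cos (3 * x) = (cos ((3 + t) * x) + cos ((3 - t) * x)) / 2"
        using cos_times_cos[of "3 * x" "t * x"] by (simp add: algebra_simps)
      have "cos (t * x) * (sin (2 * x) * sin x) = (cos (t * x) * cos x - cos (t * x) * cos (3 * x)) / 2"
        unfolding a by (simp add: algebra_simps)
      also have "\<dots> = ((1 - cos ((3 + t) * x)) + (1 - cos ((3 - t) * x))
          - (1 - cos ((1 + t) * x)) - (1 - cos ((1 - t) * x))) / 4"
        unfolding b c by (simp add: field_simps)
      finally show ?thesis unfolding S_def by (simp add: add_divide_distrib diff_divide_distrib)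
    qed
    have "has_bochner_integral lborel (\<lambda>x. cos (t * x) * S x)
        ((\<bar>3 + t\<bar> * C + \<bar>3 - t\<bar> * C - \<bar>1 + t\<bar> * C - \<bar>1 - t\<bar> * C) / 4)"
      unfolding trig C_def
      by (intro has_bochner_integral_divide has_bochner_integral_add has_bochner_integral_diff
          has_integral_one_minus_cos_scaled)
    then show ?thesis by (simp add: has_bochner_integral_integral_eq algebra_simps)
  qed
  have Im: "(LINT x|lborel. sin (t * x) * S x) = 0"
    using lborel_integral_real_affine[of "-1" "\<lambda>x. sin (t * x) * S x" 0] by (simp add: S_def)
  have "Re (LINT x|lborel. cis (t * x) * vallee_poussin x) = (LINT x|lborel. cos (t * x) * S x / C)"
    using i by (subst integral_Re[symmetric]) (auto simp: vallee_poussin_def S_def C_def)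
  moreover have "Im (LINT x|lborel. cis (t * x) * vallee_poussin x) = (LINT x|lborel. sin (t * x) * S x / C)"
    using i by (subst integral_Im[symmetric]) (auto simp: vallee_poussin_def S_def C_def)
  ultimately show ?thesis using Re Im C by (simp add: complex_eq_iff)
qed

lemma fourier_vallee_poussin:
  "\<bar>pi * \<xi>\<bar> \<le> 1 \<Longrightarrow> fourier vallee_poussin \<xi> = 1"
  "\<bar>pi * \<xi>\<bar> \<ge> 3 \<Longrightarrow> fourier vallee_poussin \<xi> = 0"
proof -
  have "fourier vallee_poussin \<xi> = (LINT x|lborel. cis ((pi * \<xi>) * x) * vallee_poussin x)"
    unfolding fourier_def by (simp add: mult_ac)
  moreover have *: "\<bar>s\<bar> \<le> 1 \<Longrightarrow> (\<bar>3 + s\<bar> + \<bar>3 - s\<bar> - \<bar>1 + s\<bar> - \<bar>1 - s\<bar>) / 4 = 1"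
    "\<bar>s\<bar> \<ge> 3 \<Longrightarrow> (\<bar>3 + s\<bar> + \<bar>3 - s\<bar> - \<bar>1 + s\<bar> - \<bar>1 - s\<bar>) / 4 = 0" for s :: real
    by (auto simp: abs_if split: if_splits)
  ultimately show "\<bar>pi * \<xi>\<bar> \<le> 1 \<Longrightarrow> fourier vallee_poussin \<xi> = 1"
    "\<bar>pi * \<xi>\<bar> \<ge> 3 \<Longrightarrow> fourier vallee_poussin \<xi> = 0"
    unfolding integral_vallee_poussin_cis by (simp_all add: *)
qed

lemma fourier_dilate:
  assumes "c > 0"
  shows "fourier (\<lambda>x. of_real c * g (c * x)) \<xi> = fourier g (\<xi> / c)"
proof -
  have "fourier g (\<xi> / c) = \<bar>c\<bar> *\<^sub>R (LINT x|lborel. cis (pi * (c * x * (\<xi> / c))) * g (c * x))"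
    unfolding fourier_def using assms
      lborel_integral_real_affine[of c "\<lambda>x. cis (pi * (x * (\<xi> / c))) * g x" 0] by simp
  also have "\<dots> = of_real c * (LINT x|lborel. cis (pi * (x * \<xi>)) * g (c * x))"
    using assms by (simp add: scaleR_conv_of_real mult_ac)
  also have "\<dots> = fourier (\<lambda>x. of_real c * g (c * x)) \<xi>"
    unfolding fourier_cmult fourier_def by simp
  finally show ?thesis by simp
qed

lemma integrable_dilate:
  fixes g :: "real \<Rightarrow> complex"
  assumes "c > 0" "integrable lborel g"
  shows "integrable lborel (\<lambda>x. of_real c * g (c * x))"
  using lborel_integrable_real_affine[OF assms(2), of c 0] assms(1) by simp

text \<open>
  Dilation and modulation of the kernel. The value \<open>1\<close> near \<open>\<xi>\<^sub>0\<close> provides a local unit of the Wiener algebra,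
  the bounded support provides bump functions.
\<close>

lemma exists_plateau:
  assumes "\<delta> > 0"
  obtains g where "integrable lborel g"
    "\<And>\<xi>. \<bar>\<xi> - \<xi>\<^sub>0\<bar> \<le> \<delta> / 3 \<Longrightarrow> fourier g \<xi> = 1" "\<And>\<xi>. \<bar>\<xi> - \<xi>\<^sub>0\<bar> \<ge> \<delta> \<Longrightarrow> fourier g \<xi> = 0"
proof -
  \<comment> \<open>The transform of the kernel is \<open>1\<close> up to \<open>1 / \<pi>\<close> and \<open>0\<close> from \<open>3 / \<pi>\<close> on.\<close>
  define c where "c = pi * \<delta> / 3"
  have l: "c > 0" using assms by (simp add: c_def)
  define g where "g = (\<lambda>x. cis (pi * (x * - \<xi>\<^sub>0)) * (of_real c * vallee_poussin (c * x)))"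
  have "integrable lborel g"
    unfolding g_def by (intro integrable_fourier_integrand integrable_dilate l integrable_vallee_poussin)
  moreover have fg: "fourier g \<xi> = fourier vallee_poussin ((\<xi> - \<xi>\<^sub>0) / c)" for \<xi>
    unfolding g_def fourier_modulate fourier_dilate[OF l] by simp
  have ab: "\<bar>pi * ((\<xi> - \<xi>\<^sub>0) / c)\<bar> = 3 * \<bar>\<xi> - \<xi>\<^sub>0\<bar> / \<delta>" for \<xi>
  proof -
    have "pi * ((\<xi> - \<xi>\<^sub>0) / c) = 3 / \<delta> * (\<xi> - \<xi>\<^sub>0)" by (simp add: c_def)
    then show ?thesis using assms by (simp only: abs_mult) simp
  qed
  have "fourier g \<xi> = 1" if "\<bar>\<xi> - \<xi>\<^sub>0\<bar> \<le> \<delta> / 3" for \<xi>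
    unfolding fg by (rule fourier_vallee_poussin) (use assms that in \<open>simp only: ab, simp add: field_simps\<close>)
  moreover have "fourier g \<xi> = 0" if "\<bar>\<xi> - \<xi>\<^sub>0\<bar> \<ge> \<delta>" for \<xi>
    unfolding fg by (rule fourier_vallee_poussin) (use assms that in \<open>simp only: ab, simp add: field_simps\<close>)
  ultimately show ?thesis using that by blast
qed

definition translation_modulus :: "real \<Rightarrow> real" where
  "translation_modulus h = (LINT x|lborel. norm (vallee_poussin (x - h) - vallee_poussin x))"

lemma borel_measurable_translation_modulus [measurable]: "translation_modulus \<in> borel_measurable borel"
  unfolding translation_modulus_def[abs_def] by measurable

lemma translation_modulus_bounds:
  "0 \<le> translation_modulus h" "translation_modulus h \<le> 2 * (LINT x|lborel. norm (vallee_poussin x))"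
proof -
  show "0 \<le> translation_modulus h"
    unfolding translation_modulus_def by (intro Bochner_Integration.integral_nonneg) auto
  have "translation_modulus h \<le> (LINT x|lborel. norm (vallee_poussin (x - h)) + norm (vallee_poussin x))"
    unfolding translation_modulus_def
    using integrable_translate[OF integrable_vallee_poussin] integrable_vallee_poussin
    by (intro integral_mono norm_triangle_ineq4) auto
  also have "\<dots> = 2 * (LINT x|lborel. norm (vallee_poussin x))"
    using integrable_translate[OF integrable_vallee_poussin, of h] integrable_vallee_poussin
      norm_integral_translate[of vallee_poussin h] by simp
  finally show "translation_modulus h \<le> 2 * (LINT x|lborel. norm (vallee_poussin x))" .
qed

text \<open>
  Continuity of translation in \<open>L\<^sup>1\<close>, for the kernel only. Translates of \<open>1 / (1 + x\<^sup>2)\<close> by bounded amounts are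
  dominated by a multiple of the same function, so dominated convergence applies.
\<close>

lemma translation_modulus_tendsto_0:
  "(\<lambda>k. translation_modulus (y / real (Suc k))) \<longlonglongrightarrow> 0"
proof -
  define C where "C = 3 / cos_quotient_integral"
  have C: "C > 0" using cos_quotient_integral_pos by (simp add: C_def)
  have vb: "norm (vallee_poussin x) \<le> C / (1 + x\<^sup>2)" for x
    using norm_vallee_poussin_le[of x] by (simp add: C_def)
  have vs: "norm (vallee_poussin (x - h)) \<le> (C * (2 + 2 * y\<^sup>2)) / (1 + x\<^sup>2)" if "\<bar>h\<bar> \<le> \<bar>y\<bar>" for x h
  proof -
    have "h\<^sup>2 \<le> y\<^sup>2" using that by (simp add: abs_le_square_iff)
    moreover have "0 \<le> (x - 2 * h)\<^sup>2" "0 \<le> y\<^sup>2 * (x - h)\<^sup>2" by auto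
    ultimately have "1 + x\<^sup>2 \<le> (2 + 2 * y\<^sup>2) * (1 + (x - h)\<^sup>2)"
      by (auto simp: power2_eq_square algebra_simps)
    then have "C * (1 + x\<^sup>2) \<le> C * ((2 + 2 * y\<^sup>2) * (1 + (x - h)\<^sup>2))"
      using C by (intro mult_left_mono) auto
    then have "C / (1 + (x - h)\<^sup>2) \<le> (C * (2 + 2 * y\<^sup>2)) / (1 + x\<^sup>2)"
      by (simp add: divide_simps add_pos_nonneg mult_ac)
    then show ?thesis using vb[of "x - h"] by linarith
  qed
  have lim: "(\<lambda>k. y / real (Suc k)) \<longlonglongrightarrow> 0"
    using tendsto_mult[OF tendsto_const LIMSEQ_inverse_real_of_nat, of y] by (simp add: divide_inverse)
  have "(\<lambda>k. LINT x|lborel. norm (vallee_poussin (x - y / real (Suc k)) - vallee_poussin x))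
      \<longlonglongrightarrow> integral\<^sup>L lborel (\<lambda>x :: real. 0 :: real)"
  proof (rule integral_dominated_convergence
      [where w="\<lambda>x :: real. (C * (2 + 2 * y\<^sup>2)) / (1 + x\<^sup>2) + C / (1 + x\<^sup>2)"])
    have "AE x in lborel. x \<noteq> (0::real)" by (rule AE_lborel_singleton)
    then show "AE x in lborel. (\<lambda>k. norm (vallee_poussin (x - y / real (Suc k)) - vallee_poussin x)) \<longlonglongrightarrow> 0"
    proof eventually_elim
      case (elim x)
      have "isCont vallee_poussin x"
        unfolding vallee_poussin_def[abs_def] using elim cos_quotient_integral_pos
        by (intro continuous_intros) auto
      moreover have "(\<lambda>k. x - y / real (Suc k)) \<longlonglongrightarrow> x" using tendsto_diff[OF tendsto_const lim, of x] by simp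
      ultimately have "(\<lambda>k. vallee_poussin (x - y / real (Suc k))) \<longlonglongrightarrow> vallee_poussin x"
        by (rule isCont_tendsto_compose)
      then have "(\<lambda>k. vallee_poussin (x - y / real (Suc k)) - vallee_poussin x) \<longlonglongrightarrow> 0"
        by (simp add: LIM_zero_iff)
      then show ?case by (rule tendsto_norm_zero)
    qed
    fix k
    have h: "\<bar>y / real (Suc k)\<bar> \<le> \<bar>y\<bar>" using divide_left_mono[of 1 "real (Suc k)" "\<bar>y\<bar>"] by (simp add: abs_divide)
    show "AE x in lborel. norm (norm (vallee_poussin (x - y / real (Suc k)) - vallee_poussin x))
        \<le> (C * (2 + 2 * y\<^sup>2)) / (1 + x\<^sup>2) + C / (1 + x\<^sup>2)"
      using add_mono[OF vs[OF h] vb] norm_triangle_ineq4 order_trans by (intro AE_I2) fastforce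
  qed (auto intro!: Bochner_Integration.integrable_add integrable_cauchy_bound)
  then show ?thesis by (simp add: translation_modulus_def)
qed

text \<open>
  Convolve \<open>f\<close> with the kernel \<open>G\<close> dilated so that its transform equals \<open>1\<close> only very
  close to \<open>0\<close>. Since \<open>f\<close> has integral \<open>0\<close>, the convolution is \<open>\<integral> f y * (G (x - y) - G x) dy\<close>, and its norm is at most
  \<open>\<integral> \<bar>f y\<bar> * translation_modulus (c * y) dy\<close>, which tends to \<open>0\<close> with the dilation parameter \<open>c\<close>.
\<close>

lemma small_representative_at_0:
  assumes f: "integrable lborel f" and z: "fourier f 0 = 0" and e: "\<epsilon> > 0"
  obtains v \<delta> where "wiener_norm_le v \<epsilon>" "\<delta> > 0" "\<And>\<xi>. \<bar>\<xi>\<bar> < \<delta> \<Longrightarrow> v \<xi> = fourier f \<xi>"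
proof -
  have fm [measurable]: "f \<in> borel_measurable borel" using f by auto
  have f0: "(LINT x|lborel. f x) = 0" using z by (simp add: fourier_def)
  define W where "W = 2 * (LINT x|lborel. norm (vallee_poussin x))"
  have W0: "0 \<le> W" unfolding W_def by (simp add: Bochner_Integration.integral_nonneg)
  have "(\<lambda>k. LINT y|lborel. norm (f y) * translation_modulus (y / real (Suc k))) \<longlonglongrightarrow> integral\<^sup>L lborel (\<lambda>y :: real. 0 :: real)"
  proof (rule integral_dominated_convergence[where w="\<lambda>y. norm (f y) * W"])
    show "AE y in lborel. (\<lambda>k. norm (f y) * translation_modulus (y / real (Suc k))) \<longlonglongrightarrow> 0"
      using tendsto_mult[OF tendsto_const translation_modulus_tendsto_0] by (intro AE_I2) fastforce
    show "AE y in lborel. norm (norm (f y) * translation_modulus (y / real (Suc k))) \<le> norm (f y) * W" for k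
      using translation_modulus_bounds by (intro AE_I2) (auto simp: W_def abs_mult intro!: mult_left_mono)
  qed (use f in auto)
  then have "(\<lambda>k. LINT y|lborel. norm (f y) * translation_modulus (y / real (Suc k))) \<longlonglongrightarrow> 0" by simp
  then have "\<forall>\<^sub>F k in sequentially. (LINT y|lborel. norm (f y) * translation_modulus (y / real (Suc k))) < \<epsilon>"
    using e by (rule order_tendstoD)
  then obtain k where k: "(LINT y|lborel. norm (f y) * translation_modulus (y / real (Suc k))) < \<epsilon>"
    by (auto simp: eventually_sequentially)
  define c where "c = 1 / real (Suc k)"
  have l: "c > 0" by (simp add: c_def)
  define G where "G = (\<lambda>x. of_real c * vallee_poussin (c * x))"
  have Gm [measurable]: "G \<in> borel_measurable borel" unfolding G_def by measurable
  have Gi: "integrable lborel G" unfolding G_def by (intro integrable_dilate l integrable_vallee_poussin)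
  have Gt: "(LINT x|lborel. norm (G (x - y) - G x)) = translation_modulus (c * y)" for y
  proof -
    have "translation_modulus (c * y) =
        \<bar>c\<bar> *\<^sub>R (LINT x|lborel. norm (vallee_poussin (c * x - c * y) - vallee_poussin (c * x)))"
      unfolding translation_modulus_def using l
        lborel_integral_real_affine[of c "\<lambda>x. norm (vallee_poussin (x - c * y) - vallee_poussin x)" 0] by simp
    also have "\<dots> = (LINT x|lborel. c * norm (vallee_poussin (c * x - c * y) - vallee_poussin (c * x)))"
      using l by simp
    also have "\<dots> = (LINT x|lborel. norm (G (x - y) - G x))"
      unfolding G_def using l
      by (intro Bochner_Integration.integral_cong) (auto simp: norm_mult right_diff_distrib simp flip: right_diff_distrib)
    finally show ?thesis by simp
  qed
  define K where "K = (\<lambda>(y, x). f y * (G (x - y) - G x))"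
  have Km [measurable]: "K \<in> borel_measurable (lborel \<Otimes>\<^sub>M lborel)" unfolding K_def by measurable
  have Gd: "integrable lborel (\<lambda>x. G (x - y) - G x)" for y
    using integrable_translate[OF Gi] Gi by auto
  have mi: "integrable lborel (\<lambda>y. norm (f y) * translation_modulus (c * y))"
  proof (rule Bochner_Integration.integrable_bound[where f="\<lambda>y. norm (f y) * W"])
    show "AE y in lborel. norm (norm (f y) * translation_modulus (c * y)) \<le> norm (norm (f y) * W)"
      using translation_modulus_bounds W0 by (intro AE_I2) (auto simp: W_def abs_mult intro!: mult_left_mono)
  qed (use f in auto)
  have Ki: "integrable (lborel \<Otimes>\<^sub>M lborel) K"
  proof (rule lborel_pair.Fubini_integrable)
    show "integrable lborel (\<lambda>y. \<integral> x. norm (K (y, x)) \<partial>lborel)"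
      unfolding K_def by (simp add: norm_mult Gt mi)
    show "AE y in lborel. integrable lborel (\<lambda>x. K (y, x))"
      unfolding K_def using Gd by auto
  qed simp
  obtain h where h: "integrable lborel h"
    "\<And>\<xi>. fourier h \<xi> = (LINT y|lborel. fourier (\<lambda>x. K (y, x)) \<xi>)"
    "(LINT x|lborel. norm (h x)) \<le> (LINT y|lborel. LINT x|lborel. norm (K (y, x)))"
    using fourier_superposition[OF Ki] by blast
  have "(LINT y|lborel. LINT x|lborel. norm (K (y, x))) = (LINT y|lborel. norm (f y) * translation_modulus (c * y))"
    unfolding K_def by (simp add: norm_mult Gt)
  then have hn: "(LINT x|lborel. norm (h x)) \<le> \<epsilon>" using h(3) k by (simp add: c_def)
  have hf: "fourier h \<xi> = fourier f \<xi> * fourier G \<xi>" for \<xi>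
  proof -
    have d: "fourier (\<lambda>x. G (x - y) - G x) \<xi> = cis (pi * (y * \<xi>)) * fourier G \<xi> - fourier G \<xi>" for y
      using fourier_add[OF integrable_translate[OF Gi, of y], of "\<lambda>x. (-1) * G x" \<xi>] Gi
        fourier_cmult[of "-1" G \<xi>] fourier_translate[of G y \<xi>] by simp
    have "fourier (\<lambda>x. K (y, x)) \<xi> = cis (pi * (y * \<xi>)) * f y * fourier G \<xi> - f y * fourier G \<xi>" for y
      unfolding K_def by (simp only: prod.case fourier_cmult d) (simp add: algebra_simps)
    then have "fourier h \<xi> = (LINT y|lborel. cis (pi * (y * \<xi>)) * f y * fourier G \<xi>) - (LINT y|lborel. f y * fourier G \<xi>)"
      unfolding h(2) using integrable_fourier_integrand[OF f, of \<xi>] f by simp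
    then show ?thesis using f0 by (simp add: fourier_def)
  qed
  have "fourier h \<xi> = fourier f \<xi>" if "\<bar>\<xi>\<bar> < c / pi" for \<xi>
  proof -
    have "\<bar>pi * (\<xi> / c)\<bar> \<le> 1" using that l by (simp add: abs_mult field_simps)
    then show ?thesis unfolding hf G_def fourier_dilate[OF l] by (simp add: fourier_vallee_poussin)
  qed
  moreover have "wiener_norm_le (fourier h) \<epsilon>" unfolding wiener_norm_le_def using h(1) hn by blast
  moreover have "c / pi > 0" using l by simp
  ultimately show ?thesis using that by blast
qed

text \<open>
  A function in the Wiener algebra that vanishes at a point has arbitrarily small norm near that
  point. This is the analytic core of Wiener's lemma.
\<close>

lemma small_representative:
  assumes f: "integrable lborel f" and z: "fourier f \<xi>\<^sub>0 = 0" and e: "\<epsilon> > 0"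
  obtains v \<delta> where "wiener_norm_le v \<epsilon>" "\<delta> > 0" "\<And>\<xi>. \<bar>\<xi> - \<xi>\<^sub>0\<bar> < \<delta> \<Longrightarrow> v \<xi> = fourier f \<xi>"
proof -
  define f0 where "f0 = (\<lambda>x. cis (pi * (x * \<xi>\<^sub>0)) * f x)"
  have "integrable lborel f0" "fourier f0 0 = 0"
    using f z by (auto simp: f0_def fourier_modulate intro: integrable_fourier_integrand)
  then obtain v \<delta> where v: "wiener_norm_le v \<epsilon>" "\<delta> > 0" "\<And>\<xi>. \<bar>\<xi>\<bar> < \<delta> \<Longrightarrow> v \<xi> = fourier f0 \<xi>"
    using small_representative_at_0[OF _ _ e, of f0] by metis
  obtain g where g: "integrable lborel g" "(LINT x|lborel. norm (g x)) \<le> \<epsilon>" "v = fourier g"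
    using v(1) by (rule wiener_norm_leE)
  define g' where "g' = (\<lambda>x. cis (pi * (x * - \<xi>\<^sub>0)) * g x)"
  have "wiener_norm_le (fourier g') \<epsilon>"
    unfolding wiener_norm_le_def using g integrable_fourier_integrand[OF g(1), of "- \<xi>\<^sub>0"]
    by (intro exI[of _ g']) (simp add: g'_def norm_mult)
  moreover have "fourier g' \<xi> = fourier f \<xi>" if "\<bar>\<xi> - \<xi>\<^sub>0\<bar> < \<delta>" for \<xi>
    using v(3)[OF that] unfolding g'_def fourier_modulate g(3) f0_def by simp
  ultimately show ?thesis using that v(2) by blast
qed

section \<open>Weierstrass division over the Wiener algebra\<close>

text \<open>
  The real polynomial \<open>Q\<close> bounds the norms of the coefficients of the polynomial \<open>P\<close> over the Wiener
  algebra. Its value \<open>poly Q R\<close> is then a bound for the norm with weights \<open>R\<^sup>j\<close>, and sums,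
  products and shifts of \<open>P\<close> are controlled by those of \<open>Q\<close>.
\<close>

definition wiener_dominated :: "(real \<Rightarrow> complex poly) \<Rightarrow> real poly \<Rightarrow> bool" where
  "wiener_dominated P Q \<longleftrightarrow> (\<forall>j. wiener_norm_le (\<lambda>\<xi>. coeff (P \<xi>) j) (coeff Q j))"

lemma wiener_dominated_coeff_nonneg: "wiener_dominated P Q \<Longrightarrow> 0 \<le> coeff Q j"
  unfolding wiener_dominated_def using wiener_norm_le_nonneg by blast

lemma wiener_dominated_mult:
  assumes "wiener_dominated P1 Q1" "wiener_dominated P2 Q2"
  shows "wiener_dominated (\<lambda>\<xi>. P1 \<xi> * P2 \<xi>) (Q1 * Q2)"
  using assms unfolding wiener_dominated_def coeff_mult
  by (intro allI wiener_norm_le_sum wiener_norm_le_mult) auto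

lemma wiener_dominated_poly_shift:
  "wiener_dominated P Q \<Longrightarrow> wiener_dominated (\<lambda>\<xi>. poly_shift d (P \<xi>)) (poly_shift d Q)"
  unfolding wiener_dominated_def by (simp add: coeff_poly_shift)

lemma poly_eq_cutoff_plus_shift:
  fixes p :: "'a::comm_ring_1 poly"
  shows "p = poly_cutoff d p + monom 1 d * poly_shift d p"
  by (rule poly_eqI) (auto simp: coeff_poly_cutoff coeff_monom_mult coeff_poly_shift)

lemma poly_eq_sum_of_degree_le:
  fixes z :: "'a::comm_ring_1"
  assumes "degree p \<le> n"
  shows "poly p z = (\<Sum>j\<le>n. coeff p j * z ^ j)"
  unfolding poly_altdef using assms by (intro sum.mono_neutral_left) (auto simp: coeff_eq_0)

lemma poly_cutoff_altdef: "poly (poly_cutoff d p) z = (\<Sum>j<d. coeff p j * (z::'a::comm_ring_1) ^ j)"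
proof -
  have "poly (poly_cutoff d p) z = (\<Sum>j\<le>max d (degree p). coeff (poly_cutoff d p) j * z ^ j)"
    by (rule poly_eq_sum_of_degree_le) (auto simp: coeff_poly_cutoff coeff_eq_0 intro!: degree_le)
  also have "\<dots> = (\<Sum>j<d. coeff p j * z ^ j)"
    by (rule sum.mono_neutral_cong_right) (auto simp: coeff_poly_cutoff)
  finally show ?thesis .
qed

lemma coeff_mult_power_le_poly:
  fixes Q :: "real poly"
  assumes "\<And>j. 0 \<le> coeff Q j" "0 \<le> R"
  shows "coeff Q j * R ^ j \<le> poly Q R"
proof (cases "j \<le> degree Q")
  case True
  have "(\<Sum>i\<in>{j}. coeff Q i * R ^ i) \<le> (\<Sum>i\<le>degree Q. coeff Q i * R ^ i)"
    using assms True by (intro sum_mono2) auto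
  then show ?thesis by (simp add: poly_altdef)
next
  case False
  then show ?thesis using assms by (auto simp: coeff_eq_0 poly_altdef intro!: sum_nonneg)
qed

lemma poly_shift_le:
  fixes Q :: "real poly"
  assumes "\<And>j. 0 \<le> coeff Q j" "0 \<le> R"
  shows "R ^ d * poly (poly_shift d Q) R \<le> poly Q R"
proof -
  have "poly Q R = poly (poly_cutoff d Q + monom 1 d * poly_shift d Q) R"
    using poly_eq_cutoff_plus_shift[of Q d] by metis
  also have "\<dots> = poly (poly_cutoff d Q) R + R ^ d * poly (poly_shift d Q) R"
    by (simp add: poly_monom)
  finally have "poly Q R = poly (poly_cutoff d Q) R + R ^ d * poly (poly_shift d Q) R" .
  moreover have "0 \<le> poly (poly_cutoff d Q) R"
    using assms by (auto simp: poly_cutoff_altdef intro!: sum_nonneg)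
  ultimately show ?thesis by simp
qed

lemma norm_poly_le_of_wiener_dominated:
  assumes dom: "wiener_dominated P Q" and "norm z \<le> R"
  shows "norm (poly (P \<xi>) z) \<le> poly Q R"
proof -
  have le: "norm (coeff (P \<xi>) j) \<le> coeff Q j" for j
    using dom wiener_norm_leD unfolding wiener_dominated_def by blast
  have "degree (P \<xi>) \<le> degree Q"
    by (rule degree_le) (use le in \<open>metis coeff_eq_0 norm_le_zero_iff\<close>)
  then have "poly (P \<xi>) z = (\<Sum>j\<le>degree Q. coeff (P \<xi>) j * z ^ j)"
    by (rule poly_eq_sum_of_degree_le)
  also have "norm \<dots> \<le> (\<Sum>j\<le>degree Q. norm (coeff (P \<xi>) j * z ^ j))" by (rule norm_sum)
  also have "\<dots> \<le> (\<Sum>j\<le>degree Q. coeff Q j * R ^ j)"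
    using le assms(2) wiener_dominated_coeff_nonneg[OF dom]
    by (intro sum_mono) (auto simp: norm_mult norm_power intro!: mult_mono power_mono)
  finally show ?thesis by (simp add: poly_altdef)
qed

text \<open>
  Weierstrass division. Modulo the relation \<open>z\<^sup>d = P z\<close>, a polynomial \<open>h\<close> may be replaced by its part
  below degree \<open>d\<close> plus \<open>P\<close> times its remaining part divided by \<open>z\<^sup>d\<close>. In the norm with
  weights \<open>R\<^sup>j\<close> each replacement halves the part that is left over. Hence, starting from \<open>z\<^sup>N\<close>, the
  leftover tends to \<open>0\<close>, and the parts below degree \<open>d\<close> sum up to the desired combination.
\<close>

lemma wiener_weierstrass_division:
  fixes P :: "real \<Rightarrow> complex poly"
  assumes dom: "wiener_dominated P Q" and R: "R \<ge> 1" and small: "poly Q R \<le> R ^ d / 2"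
    and N: "d \<le> N"
  obtains \<phi> where "\<And>j. j < d \<Longrightarrow> integrable lborel (\<phi> j)"
    "\<And>\<xi> z. norm z \<le> R \<Longrightarrow> z ^ d = poly (P \<xi>) z \<Longrightarrow> z ^ N = (\<Sum>j<d. fourier (\<phi> j) \<xi> * z ^ j)"
proof -
  define H where "H = (\<lambda>\<xi>. rec_nat (P \<xi> * monom 1 (N - d)) (\<lambda>_ h. P \<xi> * poly_shift d h))"
  define B where "B = rec_nat (Q * monom 1 (N - d)) (\<lambda>_ h. Q * poly_shift d h)"
  have H0: "H \<xi> 0 = P \<xi> * monom 1 (N - d)" and HS: "H \<xi> (Suc k) = P \<xi> * poly_shift d (H \<xi> k)" for \<xi> k
    by (auto simp: H_def)
  have B0: "B 0 = Q * monom 1 (N - d)" and BS: "B (Suc k) = Q * poly_shift d (B k)" for k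
    by (auto simp: B_def)
  have hd: "wiener_dominated (\<lambda>\<xi>. H \<xi> k) (B k)" for k
  proof (induction k)
    case 0
    have "coeff (P \<xi> * monom 1 (N - d)) j = (if j < N - d then 0 else coeff (P \<xi>) (j - (N - d)))" for \<xi> j
      by (subst mult.commute) (auto simp: coeff_monom_mult)
    moreover have "coeff (Q * monom 1 (N - d)) j = (if j < N - d then 0 else coeff Q (j - (N - d)))" for j
      by (subst mult.commute) (auto simp: coeff_monom_mult)
    ultimately show ?case
      using dom wiener_norm_le_0 unfolding wiener_dominated_def H0 B0 by auto
  next
    case (Suc k)
    show ?case unfolding HS BS
      by (intro wiener_dominated_mult wiener_dominated_poly_shift dom Suc)
  qed
  note Bnn = wiener_dominated_coeff_nonneg[OF hd]
  have Qnn: "0 \<le> poly Q R"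
    using coeff_mult_power_le_poly[of Q R 0] wiener_dominated_coeff_nonneg[OF dom] R
    by (metis mult_nonneg_nonneg order_trans zero_le_one zero_le_power)
  define C where "C = poly (B 0) R"
  have Bb: "poly (B k) R \<le> C * (1/2) ^ k" for k
  proof (induction k)
    case 0
    show ?case by (simp add: C_def)
  next
    case (Suc k)
    have s0: "0 \<le> poly (poly_shift d (B k)) R"
      using Bnn R by (auto simp: poly_altdef coeff_poly_shift intro!: sum_nonneg)
    have "poly (B (Suc k)) R \<le> R ^ d / 2 * poly (poly_shift d (B k)) R"
      unfolding BS poly_mult by (rule mult_right_mono[OF small s0])
    also have "\<dots> \<le> poly (B k) R / 2"
      using poly_shift_le[of "B k" R d] Bnn R by simp
    finally show ?case using Suc by simp
  qed
  have cB: "coeff (B k) j \<le> C * (1/2) ^ k" for k j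
  proof -
    have "coeff (B k) j * 1 \<le> coeff (B k) j * R ^ j"
      using Bnn R by (intro mult_left_mono) auto
    also have "\<dots> \<le> poly (B k) R" using coeff_mult_power_le_poly[of "B k" R j] Bnn R by simp
    finally show ?thesis using Bb[of k] by simp
  qed
  have geo: "summable (\<lambda>k. C * (1/2 :: real) ^ k)" by (intro summable_mult summable_geometric) simp
  have "wiener_norm_le (\<lambda>\<xi>. \<Sum>k. coeff (H \<xi> k) j) (\<Sum>k. C * (1/2) ^ k)" for j
    using hd cB geo unfolding wiener_dominated_def
    by (intro wiener_norm_le_suminf[OF _ geo] wiener_norm_le_mono[OF _ cB]) auto
  then have "\<exists>f. integrable lborel f \<and> (\<lambda>\<xi>. \<Sum>k. coeff (H \<xi> k) j) = fourier f" for j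
    unfolding wiener_norm_le_def by blast
  then obtain \<phi> where \<phi>: "\<And>j. integrable lborel (\<phi> j)"
    "\<And>j. (\<lambda>\<xi>. \<Sum>k. coeff (H \<xi> k) j) = fourier (\<phi> j)" by metis
  have sumc: "(\<lambda>k. coeff (H \<xi> k) j) sums fourier (\<phi> j) \<xi>" for j \<xi>
  proof -
    have "norm (coeff (H \<xi> k) j) \<le> C * (1/2) ^ k" for k
      using wiener_norm_leD[of "\<lambda>\<xi>. coeff (H \<xi> k) j" "coeff (B k) j" \<xi>] hd[of k] cB[of k j]
      unfolding wiener_dominated_def by (meson order_trans)
    then have "summable (\<lambda>k. coeff (H \<xi> k) j)" by (intro summable_comparison_test'[OF geo]) auto
    then show ?thesis using \<phi>(2)[of j] by (metis summable_sums)
  qed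
  have "z ^ N = (\<Sum>j<d. fourier (\<phi> j) \<xi> * z ^ j)" if z: "norm z \<le> R" "z ^ d = poly (P \<xi>) z" for \<xi> z
  proof -
    have step: "poly (H \<xi> k) z = poly (poly_cutoff d (H \<xi> k)) z + poly (H \<xi> (Suc k)) z" for k
    proof -
      have "poly (H \<xi> k) z = poly (poly_cutoff d (H \<xi> k) + monom 1 d * poly_shift d (H \<xi> k)) z"
        using poly_eq_cutoff_plus_shift[of "H \<xi> k" d] by metis
      then show ?thesis using z by (simp add: HS poly_monom)
    qed
    have "z ^ N = z ^ d * z ^ (N - d)" using N by (simp flip: power_add)
    then have "z ^ N = poly (H \<xi> 0) z" using z(2) by (simp add: H0 poly_monom)
    then have eq: "z ^ N = (\<Sum>k<K. poly (poly_cutoff d (H \<xi> k)) z) + poly (H \<xi> K) z" for K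
    proof (induction K)
      case (Suc K)
      then show ?case using step[of K] by simp
    qed simp
    have "norm (poly (H \<xi> k) z) \<le> C * (1/2) ^ k" for k
      using norm_poly_le_of_wiener_dominated[OF hd z(1)] Bb order_trans by blast
    then have lim: "(\<lambda>k. poly (H \<xi> k) z) \<longlonglongrightarrow> 0"
      by (rule Lim_null_comparison[OF always_eventually, rule_format])
         (use summable_LIMSEQ_zero[OF geo] in auto)
    have psum: "(\<Sum>k<K. poly (poly_cutoff d (H \<xi> k)) z) = z ^ N - poly (H \<xi> K) z" for K
      using eq[of K] by (simp add: algebra_simps)
    have "(\<lambda>K. \<Sum>k<K. poly (poly_cutoff d (H \<xi> k)) z) \<longlonglongrightarrow> z ^ N - 0"
      using tendsto_diff[OF tendsto_const lim, of "z ^ N"] by (simp add: psum)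
    moreover have "(\<lambda>k. poly (poly_cutoff d (H \<xi> k)) z) sums (\<Sum>j<d. fourier (\<phi> j) \<xi> * z ^ j)"
      unfolding poly_cutoff_altdef by (intro sums_sum sums_mult2 sumc)
    ultimately show ?thesis unfolding sums_def using LIMSEQ_unique by fastforce
  qed
  then show ?thesis using that \<phi>(1) by blast
qed

text \<open>
  Let \<open>d\<close> be the largest index of a coefficient that does not vanish at \<open>\<xi>\<^sub>0\<close>, and \<open>c\<close> its value there. Solving
  the equation for \<open>c z\<^sup>d\<close> gives \<open>z\<^sup>d = P z\<close>, where \<open>P\<close> has arbitrary coefficients below degree \<open>d\<close> and
  coefficients that vanish at \<open>\<xi>\<^sub>0\<close> from degree \<open>d\<close> on. A large weight \<open>R\<close> makes the lower part
  small compared with \<open>R\<^sup>d\<close>, and the upper part is made small by passing to a neighbourhood of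
  \<open>\<xi>\<^sub>0\<close>.
\<close>

lemma local_monic_relation:
  fixes f :: "nat \<Rightarrow> real \<Rightarrow> complex"
  assumes f: "\<And>m. m \<le> N \<Longrightarrow> integrable lborel (f m)"
    and m0: "m0 \<le> N" "fourier (f m0) \<xi>\<^sub>0 \<noteq> 0"
  obtains \<phi> \<delta> where "\<And>j. j < N \<Longrightarrow> integrable lborel (\<phi> j)" "\<delta> > 0"
    "\<And>\<xi> z. \<bar>\<xi> - \<xi>\<^sub>0\<bar> < \<delta> \<Longrightarrow> norm z = 1 \<Longrightarrow> (\<Sum>m\<le>N. fourier (f m) \<xi> * z ^ m) = 0
       \<Longrightarrow> z ^ N = (\<Sum>j<N. fourier (\<phi> j) \<xi> * z ^ j)"
proof -
  define d where "d = Max {m. m \<le> N \<and> fourier (f m) \<xi>\<^sub>0 \<noteq> 0}"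
  have dm: "d \<in> {m. m \<le> N \<and> fourier (f m) \<xi>\<^sub>0 \<noteq> 0}"
    unfolding d_def using m0 by (intro Max_in) auto
  then have dN: "d \<le> N" and c0: "fourier (f d) \<xi>\<^sub>0 \<noteq> 0" by auto
  have above: "fourier (f m) \<xi>\<^sub>0 = 0" if "d < m" "m \<le> N" for m
  proof (rule ccontr)
    assume "fourier (f m) \<xi>\<^sub>0 \<noteq> 0"
    then have "m \<le> d" unfolding d_def using that by (intro Max_ge) auto
    then show False using that by simp
  qed
  define c where "c = fourier (f d) \<xi>\<^sub>0"
  have c: "c \<noteq> 0" using c0 by (simp add: c_def)
  obtain g where g: "integrable lborel g" "\<And>\<xi>. \<bar>\<xi> - \<xi>\<^sub>0\<bar> \<le> 1 / 3 \<Longrightarrow> fourier g \<xi> = 1"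
    using exists_plateau[OF zero_less_one] by metis
  \<comment> \<open>At index \<open>d\<close> the local unit \<open>g\<close> removes the value of the coefficient at \<open>\<xi>\<^sub>0\<close>.\<close>
  define b where "b = (\<lambda>m x. (- 1 / c) * f m x + (if m = d then 1 else 0) * g x)"
  have bi: "integrable lborel (b m)" if "m \<le> N" for m
    unfolding b_def using f[OF that] g(1) by auto
  have bf: "fourier (b m) \<xi> = - fourier (f m) \<xi> / c + (if m = d then 1 else 0) * fourier g \<xi>"
    if "m \<le> N" for m \<xi>
  proof -
    have "integrable lborel (\<lambda>x. (- 1 / c) * f m x)" "integrable lborel (\<lambda>x. (if m = d then 1 else 0) * g x)"
      using f[OF that] g(1) by auto
    from fourier_add[OF this] show ?thesis unfolding b_def by (simp only: fourier_cmult) simp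
  qed
  define r where "r = (\<lambda>m. LINT x|lborel. norm (b m x))"
  have r0: "0 \<le> r m" for m unfolding r_def by (simp add: Bochner_Integration.integral_nonneg)
  \<comment> \<open>The weight makes the part below degree \<open>d\<close> at most \<open>R\<^sup>d / 4\<close>; the choice of \<open>\<epsilon>\<close> does the same for the rest.\<close>
  define R where "R = 1 + 4 * (\<Sum>m<d. r m)"
  have R1: "1 \<le> R" unfolding R_def using r0 by (simp add: sum_nonneg)
  define T where "T = (\<Sum>m\<in>{d..N}. R ^ m)"
  have T: "T > 0" unfolding T_def using R1 dN by (intro sum_pos) auto
  define \<epsilon> where "\<epsilon> = R ^ d / (4 * T)"
  have e: "\<epsilon> > 0" unfolding \<epsilon>_def using T R1 by simp
  have "\<exists>v \<delta>. wiener_norm_le v \<epsilon> \<and> \<delta> > 0 \<and> (\<forall>\<xi>. \<bar>\<xi> - \<xi>\<^sub>0\<bar> < \<delta> \<longrightarrow> v \<xi> = fourier (b m) \<xi>)"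
    if "m \<in> {d..N}" for m
  proof -
    have "fourier (b m) \<xi>\<^sub>0 = 0"
      using that above[of m] c g(2)[of \<xi>\<^sub>0] by (cases "m = d") (auto simp: bf c_def)
    then show ?thesis using small_representative[OF bi _ e, of m \<xi>\<^sub>0] that by (metis atLeastAtMost_iff)
  qed
  then obtain v \<delta>v where v: "\<And>m. m \<in> {d..N} \<Longrightarrow> wiener_norm_le (v m) \<epsilon>"
    "\<And>m. m \<in> {d..N} \<Longrightarrow> \<delta>v m > 0"
    "\<And>m \<xi>. m \<in> {d..N} \<Longrightarrow> \<bar>\<xi> - \<xi>\<^sub>0\<bar> < \<delta>v m \<Longrightarrow> v m \<xi> = fourier (b m) \<xi>" by metis
  define \<delta> where "\<delta> = min (1/3) (Min (\<delta>v ` {d..N}))"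
  have d0: "\<delta> > 0" unfolding \<delta>_def using v(2) dN by (subst min_less_iff_conj, subst Min_gr_iff) auto
  have dle: "\<delta> \<le> \<delta>v m" if "m \<in> {d..N}" for m
    unfolding \<delta>_def using that by (intro min.coboundedI2 Min_le) auto
  define w where "w = (\<lambda>m. if m < d then fourier (b m) else v m)"
  define q where "q = (\<lambda>m. if m < d then r m else \<epsilon>)"
  have wq: "wiener_norm_le (w m) (q m)" if "m \<le> N" for m
    unfolding w_def q_def r_def using wiener_norm_le_fourier[OF bi[OF that]] v(1)[of m] that by auto
  define P where "P = (\<lambda>\<xi>. \<Sum>m\<le>N. monom (w m \<xi>) m)"
  define Q where "Q = (\<Sum>m\<le>N. monom (q m) m)"
  have dom: "wiener_dominated P Q"
    unfolding wiener_dominated_def P_def Q_def using wq wiener_norm_le_0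
    by (auto simp: coeff_sum coeff_monom if_distrib sum.delta cong: if_cong)
  have small: "poly Q R \<le> R ^ d / 2"
  proof -
    have "poly Q R = (\<Sum>m\<le>N. q m * R ^ m)" unfolding Q_def by (simp add: poly_sum poly_monom)
    also have "{..N} = {..<d} \<union> {d..N}" using dN by auto
    also have "(\<Sum>m\<in>{..<d} \<union> {d..N}. q m * R ^ m) = (\<Sum>m<d. q m * R ^ m) + (\<Sum>m\<in>{d..N}. q m * R ^ m)"
      by (rule sum.union_disjoint) auto
    also have "(\<Sum>m\<in>{d..N}. q m * R ^ m) = \<epsilon> * T"
      unfolding T_def sum_distrib_left by (rule sum.cong) (auto simp: q_def)
    also have "\<epsilon> * T = R ^ d / 4" using T by (simp add: \<epsilon>_def)
    also have "(\<Sum>m<d. q m * R ^ m) \<le> (\<Sum>m<d. r m * R ^ (d - 1))"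
      using r0 R1 by (intro sum_mono) (auto simp: q_def intro!: mult_left_mono power_increasing)
    also have "\<dots> \<le> R ^ d / 4"
    proof (cases d)
      case (Suc k)
      have "(\<Sum>m<d. r m * R ^ (d - 1)) = (\<Sum>m<d. r m) * R ^ k" by (simp only: Suc diff_Suc_1 sum_distrib_right)
      also have "\<dots> \<le> (R / 4) * R ^ k" using R1 by (intro mult_right_mono) (auto simp: R_def)
      finally show ?thesis by (simp add: Suc)
    qed simp
    finally show ?thesis by simp
  qed
  obtain \<phi> where \<phi>: "\<And>j. j < d \<Longrightarrow> integrable lborel (\<phi> j)"
    "\<And>\<xi> z. norm z \<le> R \<Longrightarrow> z ^ d = poly (P \<xi>) z \<Longrightarrow> z ^ N = (\<Sum>j<d. fourier (\<phi> j) \<xi> * z ^ j)"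
    using wiener_weierstrass_division[OF dom R1 small dN] by blast
  define \<psi> where "\<psi> = (\<lambda>j. if j < d then \<phi> j else (\<lambda>_. 0))"
  have "z ^ N = (\<Sum>j<N. fourier (\<psi> j) \<xi> * z ^ j)"
    if \<xi>: "\<bar>\<xi> - \<xi>\<^sub>0\<bar> < \<delta>" and z: "norm z = 1" and eq: "(\<Sum>m\<le>N. fourier (f m) \<xi> * z ^ m) = 0" for \<xi> z
  proof -
    have g1: "fourier g \<xi> = 1" using g(2) \<xi> by (simp add: \<delta>_def)
    have w1: "w m \<xi> = - fourier (f m) \<xi> / c + (if m = d then 1 else 0)" if "m \<le> N" for m
      using v(3)[of m \<xi>] dle[of m] \<xi> that by (auto simp: w_def bf g1)
    have "poly (P \<xi>) z = (\<Sum>m\<le>N. w m \<xi> * z ^ m)" unfolding P_def by (simp add: poly_sum poly_monom)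
    also have "\<dots> = (\<Sum>m\<le>N. (- 1 / c) * (fourier (f m) \<xi> * z ^ m) + (if m = d then z ^ d else 0))"
      by (rule sum.cong) (auto simp: w1 algebra_simps)
    also have "\<dots> = (- 1 / c) * (\<Sum>m\<le>N. fourier (f m) \<xi> * z ^ m) + z ^ d"
      unfolding sum.distrib sum_distrib_left[symmetric] using dN by simp
    finally have "z ^ d = poly (P \<xi>) z" using eq by simp
    then have "z ^ N = (\<Sum>j<d. fourier (\<phi> j) \<xi> * z ^ j)" using \<phi>(2)[of z \<xi>] z R1 by simp
    also have "\<dots> = (\<Sum>j<N. fourier (\<psi> j) \<xi> * z ^ j)"
      using dN by (intro sum.mono_neutral_cong_left) (auto simp: \<psi>_def fourier_def)
    finally show ?thesis .
  qed
  moreover have "integrable lborel (\<psi> j)" for j using \<phi>(1) by (simp add: \<psi>_def)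
  ultimately show ?thesis using that d0 by blast
qed

section \<open>Signed and complex measures with densities\<close>

definition signed_measure :: "('a::topological_space set \<Rightarrow> real) \<Rightarrow> bool" where
  "signed_measure \<rho> \<longleftrightarrow>
     (\<forall>A :: nat \<Rightarrow> 'a set. range A \<subseteq> sets borel \<longrightarrow> disjoint_family A \<longrightarrow>
        (\<lambda>i. \<rho> (A i)) sums \<rho> (\<Union>i. A i))"

lemma signed_measureD:
  "signed_measure \<rho> \<Longrightarrow> range A \<subseteq> sets borel \<Longrightarrow> disjoint_family A \<Longrightarrow> (\<lambda>i. \<rho> (A i)) sums \<rho> (\<Union>i. A i)"
  unfolding signed_measure_def by blast

lemma signed_measure_Re: "complex_measure \<mu> \<Longrightarrow> signed_measure (\<lambda>A. Re (\<mu> A))"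
  unfolding complex_measure_def signed_measure_def using sums_Re by blast

lemma signed_measure_Im: "complex_measure \<mu> \<Longrightarrow> signed_measure (\<lambda>A. Im (\<mu> A))"
  unfolding complex_measure_def signed_measure_def using sums_Im by blast

lemma signed_measure_uminus: "signed_measure \<rho> \<Longrightarrow> signed_measure (\<lambda>A. - \<rho> A)"
  unfolding signed_measure_def using sums_minus by blast

lemma signed_measure_empty:
  fixes \<rho> :: "'a::topological_space set \<Rightarrow> real"
  assumes "signed_measure \<rho>" shows "\<rho> {} = 0"
proof -
  have "(\<lambda>i::nat. \<rho> {}) sums \<rho> (\<Union>i::nat. {})"
    by (rule signed_measureD[OF assms]) (auto simp: disjoint_family_on_def)
  then have "summable (\<lambda>i::nat. \<rho> {})" by (rule sums_summable)
  then have "(\<lambda>i::nat. \<rho> {}) \<longlonglongrightarrow> 0" by (rule summable_LIMSEQ_zero)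
  then show ?thesis by (simp add: LIMSEQ_const_iff)
qed

lemma signed_measure_Un:
  fixes \<rho> :: "'a::topological_space set \<Rightarrow> real"
  assumes \<rho>: "signed_measure \<rho>" and A: "A \<in> sets borel" "B \<in> sets borel" "A \<inter> B = {}"
  shows "\<rho> (A \<union> B) = \<rho> A + \<rho> B"
proof -
  have "(\<lambda>i. \<rho> (binaryset A B i)) sums \<rho> (\<Union>i. binaryset A B i)"
    by (rule signed_measureD[OF \<rho>]) (use A in \<open>auto simp: binaryset_def disjoint_family_on_def\<close>)
  moreover have "(\<lambda>i. \<rho> (binaryset A B i)) sums (\<rho> A + \<rho> B)"
    by (rule binaryset_sums[of \<rho>]) (rule signed_measure_empty[OF \<rho>])
  ultimately show ?thesis using sums_unique2 by (metis UN_binaryset_eq)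
qed

lemma signed_measure_Diff:
  fixes \<rho> :: "'a::topological_space set \<Rightarrow> real"
  assumes "signed_measure \<rho>" "A \<in> sets borel" "B \<in> sets borel" "B \<subseteq> A"
  shows "\<rho> (A - B) = \<rho> A - \<rho> B"
proof -
  have "\<rho> (B \<union> (A - B)) = \<rho> B + \<rho> (A - B)" using assms by (intro signed_measure_Un) auto
  moreover have "B \<union> (A - B) = A" using assms by auto
  ultimately show ?thesis by simp
qed

text \<open>
  If \<open>\<rho>\<close> is unbounded on the subsets of \<open>A\<close>, then \<open>A\<close> splits into two sets on which \<open>\<bar>\<rho>\<bar>\<close> is at least \<open>1\<close>, and \<open>\<rho>\<close>
  is unbounded on the subsets of one of them. Iteration yields infinitely many disjoint sets with
  \<open>\<bar>\<rho>\<bar> \<ge> 1\<close>, contradicting countable additivity.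
\<close>

lemma signed_measure_bounded:
  fixes \<rho> :: "'a::topological_space set \<Rightarrow> real"
  assumes \<rho>: "signed_measure \<rho>"
  obtains K where "\<And>B. B \<in> sets borel \<Longrightarrow> \<bar>\<rho> B\<bar> \<le> K"
proof (rule ccontr)
  assume no: "\<not> thesis"
  define unb where "unb = (\<lambda>A :: 'a set. A \<in> sets borel \<and> (\<forall>K. \<exists>B \<in> sets borel. B \<subseteq> A \<and> \<bar>\<rho> B\<bar> > K))"
  have "unb UNIV" unfolding unb_def using that no by (metis linorder_not_le sets.top space_borel subset_UNIV)
  have step: "\<exists>B. B \<subseteq> A \<and> unb B \<and> \<bar>\<rho> (A - B)\<bar> \<ge> 1" if A: "unb A" for A
  proof -
    obtain B where B: "B \<in> sets borel" "B \<subseteq> A" "\<bar>\<rho> B\<bar> > \<bar>\<rho> A\<bar> + 1" using A unfolding unb_def by blast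
    have Ab: "A \<in> sets borel" using A unfolding unb_def by blast
    have d: "\<rho> (A - B) = \<rho> A - \<rho> B" using \<rho> Ab B by (intro signed_measure_Diff)
    have AAB: "A - (A - B) = B" using B by auto
    show ?thesis
    proof (cases "unb B")
      case True
      then show ?thesis using B d by (intro exI[of _ B]) auto
    next
      case False
      have "unb (A - B)"
        unfolding unb_def
      proof (intro conjI allI)
        fix K
        obtain K' where K': "\<And>C. C \<in> sets borel \<Longrightarrow> C \<subseteq> B \<Longrightarrow> \<bar>\<rho> C\<bar> \<le> K'"
          using False B unfolding unb_def by (meson linorder_not_le)
        obtain C where C: "C \<in> sets borel" "C \<subseteq> A" "\<bar>\<rho> C\<bar> > K + K'" using A unfolding unb_def by blast
        have "\<rho> (C - C \<inter> B) = \<rho> C - \<rho> (C \<inter> B)" using \<rho> C B by (intro signed_measure_Diff) auto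
        moreover have "\<bar>\<rho> (C \<inter> B)\<bar> \<le> K'" using C B by (intro K') auto
        ultimately have "\<bar>\<rho> (C - C \<inter> B)\<bar> > K" using C by linarith
        then show "\<exists>D \<in> sets borel. D \<subseteq> A - B \<and> \<bar>\<rho> D\<bar> > K"
          using C B by (intro bexI[of _ "C - C \<inter> B"]) auto
      qed (use Ab B in auto)
      then show ?thesis using B by (intro exI[of _ "A - B"]) (auto simp: AAB)
    qed
  qed
  obtain nxt where nxt: "\<And>A. unb A \<Longrightarrow> nxt A \<subseteq> A \<and> unb (nxt A) \<and> \<bar>\<rho> (A - nxt A)\<bar> \<ge> 1"
    using step by metis
  define S where "S = rec_nat (UNIV :: 'a set) (\<lambda>_ A. nxt A)"
  have S0: "S 0 = UNIV" and SS: "S (Suc k) = nxt (S k)" for k by (auto simp: S_def)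
  have Su: "unb (S k)" for k by (induction k) (auto simp: S0 SS \<open>unb UNIV\<close> nxt)
  have dec: "decseq S" by (rule decseq_SucI) (use nxt Su SS in auto)
  have Sm: "S k \<in> sets borel" for k using Su unfolding unb_def by blast
  define D where "D = (\<lambda>k. S k - S (Suc k))"
  have dis: "disjoint_family D"
    unfolding disjoint_family_on_def
  proof (intro ballI impI)
    fix i j :: nat assume "i \<noteq> j"
    then show "D i \<inter> D j = {}"
    proof (induction i j rule: linorder_wlog)
      case (le i j)
      then have "S j \<subseteq> S (Suc i)" using dec by (auto simp: decseq_def)
      then show ?case by (auto simp: D_def)
    next
      case (sym i j)
      then show ?case by auto
    qed
  qed
  have "(\<lambda>k. \<rho> (D k)) sums \<rho> (\<Union>k. D k)"
    by (rule signed_measureD[OF \<rho> _ dis]) (use Sm in \<open>auto simp: D_def\<close>)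
  then have "(\<lambda>k. \<rho> (D k)) \<longlonglongrightarrow> 0" using sums_summable summable_LIMSEQ_zero by blast
  then have "\<forall>\<^sub>F k in sequentially. \<bar>\<rho> (D k)\<bar> < 1"
    using order_tendstoD(2)[OF tendsto_rabs_zero, of "\<lambda>k. \<rho> (D k)" sequentially 1] by simp
  moreover have "\<bar>\<rho> (D k)\<bar> \<ge> 1" for k unfolding D_def SS using nxt Su by blast
  ultimately show False by (auto simp: eventually_sequentially not_less[symmetric])
qed

lemma ennreal_sum_le: "ennreal (\<Sum>i\<in>I. x i) \<le> (\<Sum>i\<in>I. ennreal (x i))"
proof (cases "finite I")
  case True
  then show ?thesis
  proof (induction I rule: finite_induct)
    case (insert i I)
    have "ennreal (x i + sum x I) \<le> ennreal (x i) + ennreal (sum x I)"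
    proof (cases "0 \<le> x i")
      case True
      show ?thesis
      proof (cases "0 \<le> sum x I")
        case False
        then show ?thesis by (auto simp: ennreal_neg intro!: ennreal_leI)
      qed (use True in \<open>simp add: ennreal_plus\<close>)
    next
      case False
      then show ?thesis by (auto simp: ennreal_neg intro!: ennreal_leI)
    qed
    then show ?case using insert by (auto intro: order_trans add_left_mono)
  qed simp
qed simp

context
  fixes \<rho> :: "'a::topological_space set \<Rightarrow> real" and v :: "'a set \<Rightarrow> ennreal"
  assumes \<rho>: "signed_measure \<rho>"
  defines "v \<equiv> (\<lambda>A. SUP B \<in> {B \<in> sets borel. B \<subseteq> A}. ennreal (\<rho> B))"
begin

lemma upper_variation_ge: "B \<in> sets borel \<Longrightarrow> B \<subseteq> A \<Longrightarrow> ennreal (\<rho> B) \<le> v A"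
  unfolding v_def by (rule SUP_upper) auto

lemma upper_variation_le: "(\<And>B. B \<in> sets borel \<Longrightarrow> B \<subseteq> A \<Longrightarrow> ennreal (\<rho> B) \<le> c) \<Longrightarrow> v A \<le> c"
  unfolding v_def by (rule SUP_least) auto

lemma upper_variation_add_le:
  assumes A: "A1 \<in> sets borel" "A2 \<in> sets borel" "A1 \<inter> A2 = {}"
  shows "v A1 + v A2 \<le> v (A1 \<union> A2)"
proof -
  have ne: "{B \<in> sets borel. B \<subseteq> A} \<noteq> {}" for A :: "'a set" by auto
  have *: "ennreal (\<rho> B1) + ennreal (\<rho> B2) \<le> v (A1 \<union> A2)"
    if B: "B1 \<in> sets borel" "B1 \<subseteq> A1" "B2 \<in> sets borel" "B2 \<subseteq> A2" for B1 B2
  proof (cases "\<rho> B1 \<ge> 0 \<and> \<rho> B2 \<ge> 0")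
    case True
    have "B1 \<inter> B2 = {}" using A B by auto
    then have "ennreal (\<rho> B1) + ennreal (\<rho> B2) = ennreal (\<rho> (B1 \<union> B2))"
      using True B by (subst signed_measure_Un[OF \<rho>]) (auto simp: ennreal_plus)
    also have "\<dots> \<le> v (A1 \<union> A2)" using B by (intro upper_variation_ge) auto
    finally show ?thesis .
  next
    case False
    then have "ennreal (\<rho> B1) = 0 \<or> ennreal (\<rho> B2) = 0" by (auto simp: ennreal_neg)
    then show ?thesis
      using upper_variation_ge[OF B(1) le_supI1[OF B(2)], of A2]
        upper_variation_ge[OF B(3) le_supI2[OF B(4)], of A1] by auto
  qed
  have "v A1 + v A2 = (SUP B1 \<in> {B \<in> sets borel. B \<subseteq> A1}. ennreal (\<rho> B1) + v A2)"
    unfolding v_def by (rule ennreal_SUP_add_left[symmetric]) (use ne in auto)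
  also have "\<dots> \<le> v (A1 \<union> A2)"
  proof (rule SUP_least)
    fix B1 assume B1: "B1 \<in> {B \<in> sets borel. B \<subseteq> A1}"
    have "ennreal (\<rho> B1) + v A2 = (SUP B2 \<in> {B \<in> sets borel. B \<subseteq> A2}. ennreal (\<rho> B1) + ennreal (\<rho> B2))"
      unfolding v_def by (rule ennreal_SUP_add_right) (use ne in auto)
    also have "\<dots> \<le> v (A1 \<union> A2)" using B1 * by (intro SUP_least) auto
    finally show "ennreal (\<rho> B1) + v A2 \<le> v (A1 \<union> A2)" .
  qed
  finally show ?thesis .
qed

lemma upper_variation_countably_additive: "countably_additive (sets borel) v"
proof (rule countably_additiveI)
  fix A :: "nat \<Rightarrow> 'a set"
  assume A: "range A \<subseteq> sets borel" and dis: "disjoint_family A" and UA: "(\<Union>i. A i) \<in> sets borel"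
  have Ai: "A i \<in> sets borel" for i using A by auto
  show "(\<Sum>i. v (A i)) = v (\<Union>i. A i)"
  proof (rule antisym)
    have part: "(\<Sum>i<k. v (A i)) \<le> v (\<Union>i<k. A i)" for k
    proof (induction k)
      case (Suc k)
      have "(\<Sum>i<Suc k. v (A i)) \<le> v (\<Union>i<k. A i) + v (A k)" using Suc by (simp add: add_right_mono)
      also have "\<dots> \<le> v ((\<Union>i<k. A i) \<union> A k)"
      proof (rule upper_variation_add_le)
        have "A i \<inter> A k = {}" if "i < k" for i
          using disjoint_family_onD[OF dis, of i k] that by simp
        then show "(\<Union>i<k. A i) \<inter> A k = {}" by auto
      qed (use Ai in auto)
      finally show ?case by (simp add: lessThan_Suc Un_commute)
    qed simp
    also have "v (\<Union>i<k. A i) \<le> v (\<Union>i. A i)" for k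
      by (rule upper_variation_le) (auto intro!: upper_variation_ge)
    finally show "(\<Sum>i. v (A i)) \<le> v (\<Union>i. A i)"
      by (rule suminf_le_const[OF summableI])
  next
    show "v (\<Union>i. A i) \<le> (\<Sum>i. v (A i))"
    proof (rule upper_variation_le)
      fix B assume B: "B \<in> sets borel" "B \<subseteq> (\<Union>i. A i)"
      have "(\<lambda>i. \<rho> (B \<inter> A i)) sums \<rho> (\<Union>i. B \<inter> A i)"
        by (rule signed_measureD[OF \<rho>])
           (use B Ai in \<open>auto intro!: disjoint_family_on_bisimulation[OF dis]\<close>)
      also have "(\<Union>i. B \<inter> A i) = B" using B by auto
      finally have "(\<lambda>k. ennreal (\<Sum>i<k. \<rho> (B \<inter> A i))) \<longlonglongrightarrow> ennreal (\<rho> B)"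
        unfolding sums_def by (rule tendsto_ennrealI)
      moreover have "ennreal (\<Sum>i<k. \<rho> (B \<inter> A i)) \<le> (\<Sum>i. v (A i))" for k
      proof -
        have "ennreal (\<Sum>i<k. \<rho> (B \<inter> A i)) \<le> (\<Sum>i<k. ennreal (\<rho> (B \<inter> A i)))" by (rule ennreal_sum_le)
        also have "\<dots> \<le> (\<Sum>i<k. v (A i))"
          using B Ai by (intro sum_mono upper_variation_ge) auto
        also have "\<dots> \<le> (\<Sum>i. v (A i))" by (rule sum_le_suminf) auto
        finally show ?thesis .
      qed
      ultimately show "ennreal (\<rho> B) \<le> (\<Sum>i. v (A i))" by (intro LIMSEQ_le_const2) auto
    qed
  qed
qed

lemma emeasure_positive_variation: "A \<in> sets borel \<Longrightarrow> emeasure (positive_variation \<rho>) A = v A"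
proof -
  assume A: "A \<in> sets borel"
  have "v {} = 0" unfolding v_def using signed_measure_empty[OF \<rho>] by (auto simp: SUP_eq_const[of "{B. B = {}}"])
  then have "positive (sets borel) v" by (simp add: positive_def)
  moreover have "sigma_algebra UNIV (sets (borel :: 'a measure))"
    using sets.sigma_algebra_axioms[of "borel :: 'a measure"] by simp
  ultimately show ?thesis
    unfolding positive_variation_def v_def[symmetric]
    using A upper_variation_countably_additive
    by (intro emeasure_measure_of_sigma) (auto simp: v_def)
qed

lemma finite_measure_positive_variation: "finite_measure (positive_variation \<rho>)"
proof (rule finite_measureI)
  obtain K where K: "\<And>B. B \<in> sets borel \<Longrightarrow> \<bar>\<rho> B\<bar> \<le> K" using signed_measure_bounded[OF \<rho>] by blast
  have "v UNIV \<le> ennreal K"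
    by (rule upper_variation_le) (use K in \<open>auto intro!: ennreal_leI dest: abs_le_D1\<close>)
  then have "v UNIV \<noteq> \<infinity>" by (metis ennreal_neq_top infinity_ennreal_def top.extremum_uniqueI)
  moreover have "space (positive_variation \<rho>) = UNIV" by (simp add: positive_variation_def)
  ultimately show "emeasure (positive_variation \<rho>) (space (positive_variation \<rho>)) \<noteq> \<infinity>"
    by (simp add: emeasure_positive_variation)
qed

end

lemma sets_positive_variation [simp]: "sets (positive_variation \<rho>) = sets borel"
  unfolding positive_variation_def
  using sets.sigma_sets_eq[of borel] by (subst sets_measure_of) (auto)

lemma space_positive_variation [simp]: "space (positive_variation \<rho>) = UNIV"
  by (simp add: positive_variation_def)

text \<open>
  The Jordan decomposition. Passing from \<open>B\<close> to \<open>A - B\<close> shows that the supremum of \<open>- \<rho> B\<close> over \<open>B \<subseteq> A\<close> is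
  the supremum of \<open>\<rho> B\<close> minus \<open>\<rho> A\<close>.
\<close>

lemma signed_measure_eq_variation_diff:
  fixes \<rho> :: "'a::topological_space set \<Rightarrow> real"
  assumes \<rho>: "signed_measure \<rho>" and A: "A \<in> sets borel"
  shows "\<rho> A = measure (positive_variation \<rho>) A - measure (positive_variation (\<lambda>A. - \<rho> A)) A"
proof -
  define p where "p = measure (positive_variation \<rho>) A"
  define q where "q = measure (positive_variation (\<lambda>A. - \<rho> A)) A"
  note m = signed_measure_uminus[OF \<rho>]
  have p: "ennreal p = (SUP B \<in> {B \<in> sets borel. B \<subseteq> A}. ennreal (\<rho> B))" and p0: "0 \<le> p"
    using emeasure_positive_variation[OF \<rho> A]
      finite_measure.emeasure_eq_measure[OF finite_measure_positive_variation[OF \<rho>], of A]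
    by (auto simp: p_def)
  have q: "ennreal q = (SUP B \<in> {B \<in> sets borel. B \<subseteq> A}. ennreal (- \<rho> B))" and q0: "0 \<le> q"
    using emeasure_positive_variation[OF m A]
      finite_measure.emeasure_eq_measure[OF finite_measure_positive_variation[OF m], of A]
    by (auto simp: q_def)
  have pu: "\<rho> B \<le> p" if "B \<in> sets borel" "B \<subseteq> A" for B
  proof -
    have "ennreal (\<rho> B) \<le> ennreal p" unfolding p using that by (intro SUP_upper) auto
    then show ?thesis using p0 by (simp add: ennreal_le_iff2) linarith
  qed
  have qu: "- \<rho> B \<le> q" if "B \<in> sets borel" "B \<subseteq> A" for B
  proof -
    have "ennreal (- \<rho> B) \<le> ennreal q" unfolding q using that by (intro SUP_upper) auto
    then show ?thesis using q0 by (simp add: ennreal_le_iff2) linarith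
  qed
  have "0 \<le> p - \<rho> A" "0 \<le> q + \<rho> A" using pu[OF A] qu[OF A] by auto
  have "ennreal q \<le> ennreal (p - \<rho> A)"
    unfolding q
  proof (rule SUP_least, rule ennreal_leI)
    fix B assume B: "B \<in> {B \<in> sets borel. B \<subseteq> A}"
    then have "\<rho> (A - B) = \<rho> A - \<rho> B" using A by (intro signed_measure_Diff[OF \<rho>]) auto
    moreover have "\<rho> (A - B) \<le> p" using A B by (intro pu) auto
    ultimately show "- \<rho> B \<le> p - \<rho> A" by linarith
  qed
  moreover have "ennreal p \<le> ennreal (q + \<rho> A)"
    unfolding p
  proof (rule SUP_least, rule ennreal_leI)
    fix B assume B: "B \<in> {B \<in> sets borel. B \<subseteq> A}"
    then have "\<rho> (A - B) = \<rho> A - \<rho> B" using A by (intro signed_measure_Diff[OF \<rho>]) auto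
    moreover have "- \<rho> (A - B) \<le> q" using A B by (intro qu) auto
    ultimately show "\<rho> B \<le> q + \<rho> A" by linarith
  qed
  ultimately show ?thesis
    using \<open>0 \<le> p - \<rho> A\<close> \<open>0 \<le> q + \<rho> A\<close> by (simp add: p_def[symmetric] q_def[symmetric])
qed

text \<open>
  The supremum over the subsets of \<open>A\<close> is attained at the part of \<open>A\<close> where \<open>h\<close> is positive.
\<close>

lemma positive_variation_density:
  fixes \<rho> :: "'a::topological_space set \<Rightarrow> real" and \<nu> :: "'a measure"
  assumes \<nu>: "sets \<nu> = sets borel" and h: "integrable \<nu> h"
    and \<rho>: "\<And>A. A \<in> sets borel \<Longrightarrow> \<rho> A = set_lebesgue_integral \<nu> A h"
  shows "positive_variation \<rho> = density \<nu> (\<lambda>x. ennreal (max (h x) 0))"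
proof -
  have sp: "space \<nu> = UNIV" using \<nu> sets_eq_imp_space_eq by fastforce
  have hm [measurable]: "h \<in> borel_measurable \<nu>" using h by auto
  define p where "p = (\<lambda>x. max (h x) 0)"
  have pm [measurable]: "p \<in> borel_measurable \<nu>" unfolding p_def by measurable
  have pi: "integrable \<nu> p" unfolding p_def using h by auto
  define D where "D = density \<nu> (\<lambda>x. ennreal (p x))"
  have ind: "integrable \<nu> (\<lambda>x. indicator A x *\<^sub>R g x)" if "integrable \<nu> g" "A \<in> sets borel" for g :: "'a \<Rightarrow> real" and A
    using that \<nu> by (intro integrable_mult_indicator) auto
  have emD: "emeasure D A = ennreal (set_lebesgue_integral \<nu> A p)" if A: "A \<in> sets borel" for A
  proof -
    have "emeasure D A = (\<integral>\<^sup>+x. ennreal (p x) * indicator A x \<partial>\<nu>)"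
      unfolding D_def using A \<nu> by (intro emeasure_density) auto
    also have "\<dots> = (\<integral>\<^sup>+x. ennreal (indicator A x *\<^sub>R p x) \<partial>\<nu>)"
      by (intro nn_integral_cong) (auto simp: indicator_def)
    also have "\<dots> = ennreal (set_lebesgue_integral \<nu> A p)"
      unfolding set_lebesgue_integral_def using ind[OF pi A] by (intro nn_integral_eq_integral) (auto simp: p_def)
    finally show ?thesis .
  qed
  have "(SUP B \<in> {B \<in> sets borel. B \<subseteq> A}. ennreal (\<rho> B)) = emeasure D A" if A: "A \<in> sets borel" for A
  proof (rule antisym)
    show "(SUP B \<in> {B \<in> sets borel. B \<subseteq> A}. ennreal (\<rho> B)) \<le> emeasure D A"
    proof (rule SUP_least)
      fix B assume B: "B \<in> {B \<in> sets borel. B \<subseteq> A}"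
      have "\<rho> B \<le> set_lebesgue_integral \<nu> A p"
        unfolding \<rho>[of B, OF B[THEN CollectD, THEN conjunct1]] set_lebesgue_integral_def
        using B A ind[OF h] ind[OF pi] by (intro integral_mono) (auto simp: p_def indicator_def)
      then show "ennreal (\<rho> B) \<le> emeasure D A" unfolding emD[OF A] by (rule ennreal_leI)
    qed
    define B where "B = A \<inter> {x. h x > 0}"
    have "{x \<in> space \<nu>. h x > 0} \<in> sets \<nu>" by measurable
    then have B: "B \<in> sets borel" unfolding B_def using A sp \<nu> by auto
    have "set_lebesgue_integral \<nu> A p = set_lebesgue_integral \<nu> B h"
      unfolding set_lebesgue_integral_def
      by (intro Bochner_Integration.integral_cong) (auto simp: B_def p_def indicator_def)
    then have "emeasure D A = ennreal (\<rho> B)" using emD[OF A] \<rho>[OF B] by simp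
    also have "\<dots> \<le> (SUP B \<in> {B \<in> sets borel. B \<subseteq> A}. ennreal (\<rho> B))"
      using B by (intro SUP_upper) (auto simp: B_def)
    finally show "emeasure D A \<le> (SUP B \<in> {B \<in> sets borel. B \<subseteq> A}. ennreal (\<rho> B))" .
  qed
  then have "positive_variation \<rho> = measure_of UNIV (sets borel) (emeasure D)"
    unfolding positive_variation_def
    using sets.sigma_sets_eq[of "borel :: 'a measure"] by (intro measure_of_eq) auto
  also have "\<dots> = D"
    using measure_of_of_measure[of D] \<nu> sp by (simp add: D_def)
  finally show ?thesis by (simp add: D_def p_def)
qed

lemma signed_integral_density:
  fixes \<rho> :: "'a::topological_space set \<Rightarrow> real" and \<nu> :: "'a measure"
  assumes \<nu>: "sets \<nu> = sets borel" and h: "integrable \<nu> h"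
    and \<rho>: "\<And>A. A \<in> sets borel \<Longrightarrow> \<rho> A = set_lebesgue_integral \<nu> A h"
    and g: "g \<in> borel_measurable borel" "\<And>x. norm (g x) \<le> 1"
  shows "signed_integral \<rho> g = (LINT x|\<nu>. of_real (h x) * g x)"
proof -
  have gm [measurable]: "g \<in> borel_measurable \<nu>" using g(1) \<nu> measurable_cong_sets by blast
  have hm [measurable]: "h \<in> borel_measurable \<nu>" using h by auto
  have 1: "positive_variation \<rho> = density \<nu> (\<lambda>x. ennreal (max (h x) 0))"
    by (rule positive_variation_density[OF \<nu> h \<rho>])
  have 2: "positive_variation (\<lambda>A. - \<rho> A) = density \<nu> (\<lambda>x. ennreal (max (- h x) 0))"
    by (rule positive_variation_density[OF \<nu>]) (use h \<rho> in \<open>auto simp: set_lebesgue_integral_def\<close>)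
  have bound: "integrable \<nu> (\<lambda>x. w x *\<^sub>R g x)" if "integrable \<nu> w" for w :: "'a \<Rightarrow> real"
  proof (rule Bochner_Integration.integrable_bound[OF that])
    show "(\<lambda>x. w x *\<^sub>R g x) \<in> borel_measurable \<nu>" using borel_measurable_integrable[OF that] by simp
    show "AE x in \<nu>. norm (w x *\<^sub>R g x) \<le> norm (w x)"
      using g(2) by (intro AE_I2) (simp add: mult_left_le)
  qed
  have "signed_integral \<rho> g = (LINT x|\<nu>. max (h x) 0 *\<^sub>R g x) - (LINT x|\<nu>. max (- h x) 0 *\<^sub>R g x)"
    unfolding signed_integral_def 1 2 by (subst (1 2) integral_density) auto
  also have "\<dots> = (LINT x|\<nu>. max (h x) 0 *\<^sub>R g x - max (- h x) 0 *\<^sub>R g x)"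
    using h by (intro Bochner_Integration.integral_diff[symmetric] bound) auto
  also have "\<dots> = (LINT x|\<nu>. of_real (h x) * g x)"
    by (intro Bochner_Integration.integral_cong) (auto simp: max_def scaleR_conv_of_real)
  finally show ?thesis .
qed

text \<open>
  On absolutely continuous measures, integration by means of the Jordan decomposition is integration against the
  density.
\<close>

lemma complex_integral_density:
  fixes \<mu> :: "'a::topological_space set \<Rightarrow> complex" and \<nu> :: "'a measure"
  assumes \<nu>: "sets \<nu> = sets borel" and h: "integrable \<nu> h"
    and \<mu>: "\<And>A. A \<in> sets borel \<Longrightarrow> \<mu> A = set_lebesgue_integral \<nu> A h"
    and g: "g \<in> borel_measurable borel" "\<And>x. norm (g x) \<le> 1"
  shows "complex_integral \<mu> g = (LINT x|\<nu>. h x * g x)"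
proof -
  have gm [measurable]: "g \<in> borel_measurable \<nu>" using g(1) \<nu> measurable_cong_sets by blast
  have ih: "integrable \<nu> (\<lambda>x. indicator A x *\<^sub>R h x)" if "A \<in> sets borel" for A
    using that h \<nu> by (intro integrable_mult_indicator) auto
  have hg: "integrable \<nu> (\<lambda>x. of_real (w x) * g x)" if "integrable \<nu> w" for w :: "'a \<Rightarrow> real"
  proof (rule Bochner_Integration.integrable_bound[OF that])
    show "(\<lambda>x. of_real (w x) * g x) \<in> borel_measurable \<nu>" using borel_measurable_integrable[OF that] by simp
    show "AE x in \<nu>. norm (of_real (w x) * g x) \<le> norm (w x)"
      using g(2) by (intro AE_I2) (simp add: mult_left_le norm_mult)
  qed
  have "signed_integral (\<lambda>A. Re (\<mu> A)) g = (LINT x|\<nu>. of_real (Re (h x)) * g x)"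
  proof (rule signed_integral_density[OF \<nu>])
    show "Re (\<mu> A) = set_lebesgue_integral \<nu> A (\<lambda>x. Re (h x))" if "A \<in> sets borel" for A
      using integral_Re[OF ih[OF that]] \<mu>[OF that] by (simp add: set_lebesgue_integral_def)
  qed (use h g in auto)
  moreover have "signed_integral (\<lambda>A. Im (\<mu> A)) g = (LINT x|\<nu>. of_real (Im (h x)) * g x)"
  proof (rule signed_integral_density[OF \<nu>])
    show "Im (\<mu> A) = set_lebesgue_integral \<nu> A (\<lambda>x. Im (h x))" if "A \<in> sets borel" for A
      using integral_Im[OF ih[OF that]] \<mu>[OF that] by (simp add: set_lebesgue_integral_def)
  qed (use h g in auto)
  moreover have "(LINT x|\<nu>. h x * g x) =
      (LINT x|\<nu>. of_real (Re (h x)) * g x + \<i> * (of_real (Im (h x)) * g x))"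
    by (intro Bochner_Integration.integral_cong) (auto simp: complex_eq_iff algebra_simps)
  moreover have "\<dots> = (LINT x|\<nu>. of_real (Re (h x)) * g x) + \<i> * (LINT x|\<nu>. of_real (Im (h x)) * g x)"
    using hg[of "\<lambda>x. Re (h x)"] hg[of "\<lambda>x. Im (h x)"] h by simp
  ultimately show ?thesis unfolding complex_integral_def by simp
qed

text \<open>
  Both variations of \<open>\<rho>\<close> are finite measures and inherit absolute continuity from \<open>\<rho>\<close>, since they are suprema of
  \<open>\<plusminus> \<rho>\<close> over subsets.
\<close>

lemma signed_measure_Radon_Nikodym:
  fixes \<rho> :: "'a::topological_space set \<Rightarrow> real" and \<nu> :: "'a measure"
  assumes \<nu>: "sets \<nu> = sets borel" and sf: "sigma_finite_measure \<nu>" and \<rho>: "signed_measure \<rho>"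
    and ac: "\<And>A. A \<in> sets borel \<Longrightarrow> emeasure \<nu> A = 0 \<Longrightarrow> \<rho> A = 0"
  obtains h where "integrable \<nu> h" "\<And>A. A \<in> sets borel \<Longrightarrow> \<rho> A = set_lebesgue_integral \<nu> A h"
proof -
  have sp: "space \<nu> = UNIV" using \<nu> sets_eq_imp_space_eq by fastforce
  have dens: "\<exists>p. integrable \<nu> p \<and> (\<forall>A \<in> sets borel. measure (positive_variation \<sigma>) A = set_lebesgue_integral \<nu> A p)"
    if \<sigma>: "signed_measure \<sigma>" and acs: "\<And>A. A \<in> sets borel \<Longrightarrow> emeasure \<nu> A = 0 \<Longrightarrow> \<sigma> A = 0" for \<sigma>
  proof -
    define V where "V = positive_variation \<sigma>"
    interpret V: finite_measure V unfolding V_def by (rule finite_measure_positive_variation[OF \<sigma>])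
    have "absolutely_continuous \<nu> V"
      unfolding absolutely_continuous_def
    proof
      fix A assume A: "A \<in> null_sets \<nu>"
      then have Ab: "A \<in> sets borel" using \<nu> by auto
      have "\<sigma> B = 0" if "B \<in> sets borel" "B \<subseteq> A" for B
      proof (rule acs[OF that(1)])
        show "emeasure \<nu> B = 0" using emeasure_mono[of B A \<nu>] A that \<nu> by (auto simp: null_sets_def)
      qed
      then have "emeasure V A = 0"
        unfolding V_def emeasure_positive_variation[OF \<sigma> Ab] by (auto intro!: antisym SUP_least)
      then show "A \<in> null_sets V" using Ab by (auto simp: V_def null_sets_def)
    qed
    then obtain f where f: "f \<in> borel_measurable \<nu>" "density \<nu> f = V"
      using sigma_finite_measure.Radon_Nikodym[OF sf, of V] \<nu> by (auto simp: V_def)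
    note fm [measurable] = f(1)
    have fi: "(\<integral>\<^sup>+x. f x \<partial>\<nu>) \<noteq> \<infinity>"
    proof -
      have "emeasure V UNIV = (\<integral>\<^sup>+x. f x * indicator UNIV x \<partial>\<nu>)"
        unfolding f(2)[symmetric] using sp by (intro emeasure_density f(1)) (metis sets.top)
      then show ?thesis using V.emeasure_finite[of UNIV] by simp
    qed
    then have fin: "AE x in \<nu>. f x \<noteq> \<infinity>" by (intro nn_integral_PInf_AE f(1))
    define p where "p = (\<lambda>x. enn2real (f x))"
    have pm [measurable]: "p \<in> borel_measurable \<nu>" unfolding p_def by measurable
    have pf: "AE x in \<nu>. ennreal (p x) = f x" using fin unfolding p_def by eventually_elim (simp add: less_top)
    have "(\<integral>\<^sup>+x. ennreal (p x) \<partial>\<nu>) = (\<integral>\<^sup>+x. f x \<partial>\<nu>)" using pf by (rule nn_integral_cong_AE)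
    then have pi: "integrable \<nu> p"
      using fi by (intro integrableI_nonneg) (auto simp: p_def less_top)
    have "measure V A = set_lebesgue_integral \<nu> A p" if A: "A \<in> sets borel" for A
    proof -
      have ip: "integrable \<nu> (\<lambda>x. indicator A x *\<^sub>R p x)" using A \<nu> pi by (intro integrable_mult_indicator) auto
      have "emeasure V A = (\<integral>\<^sup>+x. f x * indicator A x \<partial>\<nu>)"
        unfolding f(2)[symmetric] using A \<nu> by (intro emeasure_density f(1)) auto
      also have "\<dots> = (\<integral>\<^sup>+x. ennreal (indicator A x *\<^sub>R p x) \<partial>\<nu>)"
        using pf by (intro nn_integral_cong_AE) (auto simp: indicator_def elim!: eventually_mono)
      also have "\<dots> = ennreal (set_lebesgue_integral \<nu> A p)"
        unfolding set_lebesgue_integral_def using ip by (intro nn_integral_eq_integral) (auto simp: p_def)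
      finally show ?thesis
        unfolding measure_def set_lebesgue_integral_def
        by (simp add: Bochner_Integration.integral_nonneg p_def)
    qed
    then show ?thesis using pi unfolding V_def by blast
  qed
  obtain p where p: "integrable \<nu> p"
    "\<And>A. A \<in> sets borel \<Longrightarrow> measure (positive_variation \<rho>) A = set_lebesgue_integral \<nu> A p"
    using dens[OF \<rho> ac] by blast
  obtain q where q: "integrable \<nu> q"
    "\<And>A. A \<in> sets borel \<Longrightarrow> measure (positive_variation (\<lambda>A. - \<rho> A)) A = set_lebesgue_integral \<nu> A q"
    using dens[OF signed_measure_uminus[OF \<rho>]] ac by auto
  have "\<rho> A = set_lebesgue_integral \<nu> A (\<lambda>x. p x - q x)" if A: "A \<in> sets borel" for A
    unfolding signed_measure_eq_variation_diff[OF \<rho> A] p(2)[OF A] q(2)[OF A]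
    unfolding set_integrable_def using p(1) q(1) A \<nu>
    by (intro set_integral_diff(2)[symmetric]) (auto simp only: set_integrable_def intro!: integrable_mult_indicator)
  then show ?thesis using that[of "\<lambda>x. p x - q x"] p(1) q(1) by auto
qed

lemma complex_measure_Radon_Nikodym:
  fixes \<mu> :: "'a::topological_space set \<Rightarrow> complex" and \<nu> :: "'a measure"
  assumes \<nu>: "sets \<nu> = sets borel" and sf: "sigma_finite_measure \<nu>" and \<mu>: "complex_measure \<mu>"
    and ac: "\<And>A. A \<in> sets borel \<Longrightarrow> emeasure \<nu> A = 0 \<Longrightarrow> \<mu> A = 0"
  obtains h where "integrable \<nu> h" "\<And>A. A \<in> sets borel \<Longrightarrow> \<mu> A = set_lebesgue_integral \<nu> A h"
proof -
  obtain a where a: "integrable \<nu> a" "\<And>A. A \<in> sets borel \<Longrightarrow> Re (\<mu> A) = set_lebesgue_integral \<nu> A a"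
    by (rule signed_measure_Radon_Nikodym[OF \<nu> sf signed_measure_Re[OF \<mu>]]) (auto simp: ac)
  obtain b where b: "integrable \<nu> b" "\<And>A. A \<in> sets borel \<Longrightarrow> Im (\<mu> A) = set_lebesgue_integral \<nu> A b"
    by (rule signed_measure_Radon_Nikodym[OF \<nu> sf signed_measure_Im[OF \<mu>]]) (auto simp: ac)
  define h where "h = (\<lambda>x. complex_of_real (a x) + \<i> * complex_of_real (b x))"
  have hi: "integrable \<nu> h" unfolding h_def using a(1) b(1) by auto
  have "\<mu> A = set_lebesgue_integral \<nu> A h" if A: "A \<in> sets borel" for A
  proof -
    have i: "integrable \<nu> (\<lambda>x. indicator A x *\<^sub>R h x)"
      using A \<nu> hi by (intro integrable_mult_indicator) auto
    show ?thesis
      using integral_Re[OF i] integral_Im[OF i] a(2)[OF A] b(2)[OF A]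
      by (simp add: set_lebesgue_integral_def complex_eq_iff h_def)
  qed
  then show ?thesis using that hi by blast
qed

text \<open>
  Countable additivity is dominated convergence along the increasing finite unions.
\<close>

lemma complex_measure_density:
  fixes \<nu> :: "'a::topological_space measure" and h :: "'a \<Rightarrow> complex"
  assumes \<nu>: "sets \<nu> = sets borel" and h: "integrable \<nu> h"
  shows "complex_measure (\<lambda>A. set_lebesgue_integral \<nu> A h)"
  unfolding complex_measure_def
proof (intro allI impI)
  fix A :: "nat \<Rightarrow> 'a set" assume A: "range A \<subseteq> sets borel" and dis: "disjoint_family A"
  have Ai: "A i \<in> sets \<nu>" for i using A \<nu> by auto
  have si: "set_integrable \<nu> B h" if "B \<in> sets \<nu>" for B
    using that h unfolding set_integrable_def by (intro integrable_mult_indicator) auto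
  have "(\<lambda>k. set_lebesgue_integral \<nu> (\<Union>i<k. A i) h) \<longlonglongrightarrow> set_lebesgue_integral \<nu> (\<Union>k. \<Union>i<k. A i) h"
    using Ai by (intro set_integral_cont_up si) (auto simp: incseq_def intro: order.strict_trans2)
  moreover have "(\<Union>k. \<Union>i<k. A i) = (\<Union>i. A i)" by auto
  moreover have "set_lebesgue_integral \<nu> (\<Union>i<k. A i) h = (\<Sum>i<k. set_lebesgue_integral \<nu> (A i) h)" for k
    using Ai dis by (intro set_integral_finite_Union si) (auto simp: disjoint_family_on_def)
  ultimately show "(\<lambda>i. set_lebesgue_integral \<nu> (A i) h) sums set_lebesgue_integral \<nu> (\<Union>i. A i) h"
    unfolding sums_def by simp
qed

section \<open>Sets of length zero\<close>

text \<open>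
  One-dimensional Hausdorff measure zero, without a bound on the individual diameters: a small sum of
  diameters bounds each of them.
\<close>

definition length_null :: "'a::metric_space set \<Rightarrow> bool" where
  "length_null N \<longleftrightarrow> (\<forall>\<epsilon>>0. \<exists>U :: nat \<Rightarrow> 'a set. N \<subseteq> (\<Union>i. U i) \<and> (\<forall>i. bounded (U i)) \<and>
     (\<Sum>i. ennreal (diameter (U i))) \<le> ennreal \<epsilon>)"

lemma length_null_subset: "length_null N \<Longrightarrow> M \<subseteq> N \<Longrightarrow> length_null M"
  unfolding length_null_def by (elim all_forward imp_forward ex_forward) auto

lemma length_null_UN:
  fixes N :: "nat \<Rightarrow> 'a::metric_space set"
  assumes "\<And>j. length_null (N j)"
  shows "length_null (\<Union>j. N j)"
  unfolding length_null_def
proof (intro allI impI)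
  fix \<epsilon> :: real assume e: "\<epsilon> > 0"
  have "\<exists>U :: nat \<Rightarrow> 'a set. N j \<subseteq> (\<Union>i. U i) \<and> (\<forall>i. bounded (U i)) \<and>
      (\<Sum>i. ennreal (diameter (U i))) \<le> ennreal (\<epsilon> * (1/2) ^ Suc j)" for j
    using assms[of j] e unfolding length_null_def by simp
  then obtain U where U: "\<And>j. N j \<subseteq> (\<Union>i. U j i)" "\<And>j i. bounded (U j i :: 'a set)"
    "\<And>j. (\<Sum>i. ennreal (diameter (U j i))) \<le> ennreal (\<epsilon> * (1/2) ^ Suc j)"
    by metis
  define V where "V = (\<lambda>k. case prod_decode k of (j, i) \<Rightarrow> U j i)"
  have "(\<Sum>k. ennreal (diameter (V k))) = (\<Sum>k. (\<lambda>(j, i). ennreal (diameter (U j i))) (prod_decode k))"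
    by (simp add: V_def split_def)
  also have "\<dots> = (\<Sum>j. \<Sum>i. ennreal (diameter (U j i)))"
    by (rule suminf_ennreal_2dimen) simp
  also have "\<dots> \<le> (\<Sum>j. ennreal (\<epsilon> * (1/2) ^ Suc j))" by (intro suminf_le U(3)) auto
  also have "\<dots> = ennreal \<epsilon>"
  proof (rule suminf_ennreal_eq)
    show "(\<lambda>j. \<epsilon> * (1/2) ^ Suc j) sums \<epsilon>" using sums_mult[OF power_half_series, of \<epsilon>] by (simp only: mult_1_right)
  qed (use e in simp)
  finally have "(\<Sum>k. ennreal (diameter (V k))) \<le> ennreal \<epsilon>" .
  moreover have "(\<Union>j. N j) \<subseteq> (\<Union>k. V k)"
  proof
    fix x assume "x \<in> (\<Union>j. N j)"
    then obtain j i where "x \<in> U j i" using U(1) by blast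
    then have "x \<in> V (prod_encode (j, i))" by (simp add: V_def)
    then show "x \<in> (\<Union>k. V k)" by blast
  qed
  moreover have "bounded (V k)" for k using U(2) by (simp add: V_def split_def)
  ultimately show "\<exists>U :: nat \<Rightarrow> 'a set. (\<Union>j. N j) \<subseteq> (\<Union>i. U i) \<and> (\<forall>i. bounded (U i)) \<and>
      (\<Sum>i. ennreal (diameter (U i))) \<le> ennreal \<epsilon>" by blast
qed

lemma hausdorff_measure_1_eq_0_iff_length_null: "hausdorff_measure_1 N = 0 \<longleftrightarrow> length_null N"
proof
  assume "length_null N"
  have "(INF U \<in> {U :: nat \<Rightarrow> 'a set. N \<subseteq> (\<Union>i. U i) \<and> (\<forall>i. bounded (U i) \<and> diameter (U i) \<le> \<delta>)}.
          (\<Sum>i. ennreal (diameter (U i)))) \<le> ennreal \<epsilon>" if d: "\<delta> > 0" and e: "\<epsilon> > 0" for \<delta> \<epsilon> :: real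
  proof -
    obtain U :: "nat \<Rightarrow> 'a set" where U: "N \<subseteq> (\<Union>i. U i)" "\<And>i. bounded (U i)"
      "(\<Sum>i. ennreal (diameter (U i))) \<le> ennreal (min \<delta> \<epsilon>)"
      using \<open>length_null N\<close>[unfolded length_null_def, rule_format, of "min \<delta> \<epsilon>"] d e by auto
    have "diameter (U i) \<le> \<delta>" for i
    proof -
      have "ennreal (diameter (U i)) \<le> (\<Sum>i. ennreal (diameter (U i)))"
        using sum_le_suminf[of "\<lambda>i. ennreal (diameter (U i))" "{i}"] by simp
      then have "ennreal (diameter (U i)) \<le> ennreal (min \<delta> \<epsilon>)" using U(3) by order
      then have "diameter (U i) \<le> min \<delta> \<epsilon>" using d e by (subst (asm) ennreal_le_iff) auto
      then show ?thesis by simp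
    qed
    then show ?thesis
      using U by (intro INF_lower2[of U] order_trans[OF U(3)] ennreal_leI) auto
  qed
  note le = this
  have "(INF U \<in> {U :: nat \<Rightarrow> 'a set. N \<subseteq> (\<Union>i. U i) \<and> (\<forall>i. bounded (U i) \<and> diameter (U i) \<le> \<delta>)}.
          (\<Sum>i. ennreal (diameter (U i)))) \<le> 0" if d: "\<delta> > 0" for \<delta> :: real
    by (rule ennreal_le_epsilon) (simp only: add_0 le[OF d])
  then have "hausdorff_measure_1 N \<le> 0"
    unfolding hausdorff_measure_1_def by (intro SUP_least) auto
  then show "hausdorff_measure_1 N = 0" by simp
next
  assume z: "hausdorff_measure_1 N = 0"
  show "length_null N"
    unfolding length_null_def
  proof (intro allI impI)
    fix \<epsilon> :: real assume e: "\<epsilon> > 0"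
    have "(INF U \<in> {U :: nat \<Rightarrow> 'a set. N \<subseteq> (\<Union>i. U i) \<and> (\<forall>i. bounded (U i) \<and> diameter (U i) \<le> 1)}.
          (\<Sum>i. ennreal (diameter (U i)))) \<le> hausdorff_measure_1 N"
      unfolding hausdorff_measure_1_def by (rule SUP_upper) simp
    also have "\<dots> < ennreal \<epsilon>" using z e by simp
    finally show "\<exists>U :: nat \<Rightarrow> 'a set. N \<subseteq> (\<Union>i. U i) \<and> (\<forall>i. bounded (U i)) \<and>
      (\<Sum>i. ennreal (diameter (U i))) \<le> ennreal \<epsilon>"
      by (auto simp: INF_less_iff intro: less_imp_le)
  qed
qed

lemma length_null_isometric_image:
  fixes f :: "'a::metric_space \<Rightarrow> 'b::real_normed_vector"
  assumes f: "\<And>x y. dist (f x) (f y) = dist x y" and N: "length_null N"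
  shows "length_null (f ` N)"
  unfolding length_null_def
proof (intro allI impI)
  fix \<epsilon> :: real assume "\<epsilon> > 0"
  then obtain U :: "nat \<Rightarrow> 'a set" where U: "N \<subseteq> (\<Union>i. U i)" "\<And>i. bounded (U i)"
    "(\<Sum>i. ennreal (diameter (U i))) \<le> ennreal \<epsilon>"
    using N unfolding length_null_def by blast
  have "diameter (f ` U i) \<le> diameter (U i)" for i
    by (rule diameter_le)
       (use U(2) f diameter_bounded_bound[OF U(2)] diameter_ge_0[OF U(2)] in \<open>auto simp flip: dist_norm\<close>)
  then have "(\<Sum>i. ennreal (diameter (f ` U i))) \<le> (\<Sum>i. ennreal (diameter (U i)))"
    by (intro suminf_le ennreal_leI) auto
  then have "(\<Sum>i. ennreal (diameter (f ` U i))) \<le> ennreal \<epsilon>" using U(3) by (rule order_trans)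
  moreover have "f ` N \<subseteq> (\<Union>i. f ` U i)" using U(1) by blast
  moreover have "bounded (f ` U i)" for i
  proof -
    obtain x e where "\<forall>y \<in> U i. dist x y \<le> e" using U(2)[of i] unfolding bounded_def by blast
    then show ?thesis unfolding bounded_def by (intro exI[of _ "f x"] exI[of _ e]) (auto simp: f)
  qed
  ultimately show "\<exists>V :: nat \<Rightarrow> 'b set. f ` N \<subseteq> (\<Union>i. V i) \<and> (\<forall>i. bounded (V i)) \<and>
      (\<Sum>i. ennreal (diameter (V i))) \<le> ennreal \<epsilon>"
    by blast
qed

text \<open>
  A null set on the line is covered by non-overlapping intervals of small total length. The family of
  intervals may be finite, so it is enumerated with empty sets in the gaps; the interiors are disjoint,
  which bounds the sum of the diameters by the measure of the union.
\<close>

lemma length_null_bounded_null_set: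
  fixes N :: "real set"
  assumes N: "N \<in> null_sets lebesgue" and ab: "N \<subseteq> {a..b}"
  shows "length_null N"
  unfolding length_null_def
proof (intro allI impI)
  fix \<epsilon> :: real assume e: "\<epsilon> > 0"
  have lm: "N \<in> lmeasurable" using N by (simp add: negligible_iff_null_sets negligible_imp_measurable)
  have "N \<subseteq> cbox a b" using ab by simp
  then obtain \<D> where D: "countable \<D>"
        "\<And>K. K \<in> \<D> \<Longrightarrow> K \<subseteq> cbox a b \<and> K \<noteq> {} \<and> (\<exists>c d. K = cbox c d)"
        "pairwise (\<lambda>A B. interior A \<inter> interior B = {}) \<D>"
        "N \<subseteq> \<Union>\<D>" "\<Union>\<D> \<in> lmeasurable" "measure lebesgue (\<Union>\<D>) \<le> measure lebesgue N + \<epsilon>"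
    using measurable_outer_intervals_bounded[OF lm _ e] by metis
  have m0: "measure lebesgue N = 0" using N by (simp add: measure_def null_setsD1)
  define U where "U = (\<lambda>i. if i \<in> to_nat_on \<D> ` \<D> then from_nat_into \<D> i else {})"
  have UD: "U i \<in> \<D> \<or> U i = {}" for i
    unfolding U_def by (metis emptyE equals0I from_nat_into image_is_empty)
  have cov: "(\<Union>i. U i) = \<Union>\<D>"
  proof
    show "(\<Union>i. U i) \<subseteq> \<Union>\<D>" using UD by blast
    show "\<Union>\<D> \<subseteq> (\<Union>i. U i)"
    proof
      fix x assume "x \<in> \<Union>\<D>"
      then obtain K where K: "K \<in> \<D>" "x \<in> K" by blast
      then have "U (to_nat_on \<D> K) = K" using D(1) by (simp add: U_def)
      then show "x \<in> (\<Union>i. U i)" using K by blast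
    qed
  qed
  have inj: "U i \<noteq> U j" if "i \<noteq> j" "U i \<noteq> {}" for i j
  proof
    assume eq: "U i = U j"
    then have "i \<in> to_nat_on \<D> ` \<D>" "j \<in> to_nat_on \<D> ` \<D>" using that by (auto simp: U_def split: if_splits)
    then show False using eq that(1) D(1) by (auto simp: U_def)
  qed
  have dis: "disjoint_family (\<lambda>i. interior (U i))"
    unfolding disjoint_family_on_def
  proof (intro ballI impI)
    fix i j :: nat assume "i \<noteq> j"
    then show "interior (U i) \<inter> interior (U j) = {}"
      using inj[of i j] UD[of i] UD[of j] D(3) unfolding pairwise_def by (metis inf_bot_left inf_bot_right interior_empty)
  qed
  have dm: "ennreal (diameter (U i)) \<le> emeasure lebesgue (interior (U i))" for i
  proof (cases "U i = {}")
    case False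
    then obtain c d where cd: "U i = cbox c d" "c \<le> d" using UD[of i] D(2)[of "U i"] by (auto simp: Let_def)
    have "diameter (U i) \<le> d - c"
      by (rule diameter_le) (use cd in \<open>auto simp: abs_le_iff\<close>)
    moreover have "emeasure lebesgue (interior (U i)) = ennreal (d - c)"
      using cd by (simp add: interior_cbox box_real)
    ultimately show ?thesis by (simp add: ennreal_leI)
  qed simp
  have "(\<Sum>i. ennreal (diameter (U i))) \<le> (\<Sum>i. emeasure lebesgue (interior (U i)))"
    by (intro suminf_le dm) auto
  also have "\<dots> = emeasure lebesgue (\<Union>i. interior (U i))"
    by (rule suminf_emeasure[OF _ dis]) (auto intro: lmeasurable_interior)
  also have "\<dots> \<le> emeasure lebesgue (\<Union>\<D>)"
    using D(5) interior_subset cov by (intro emeasure_mono) (blast, auto)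
  also have "\<dots> = ennreal (measure lebesgue (\<Union>\<D>))" using D(5) by (simp add: emeasure_eq_measure2)
  also have "\<dots> \<le> ennreal \<epsilon>" using D(6) m0 by (intro ennreal_leI) simp
  finally have "(\<Sum>i. ennreal (diameter (U i))) \<le> ennreal \<epsilon>" .
  moreover have "bounded (U i)" for i
  proof (rule bounded_subset[OF bounded_cbox])
    show "U i \<subseteq> cbox a b" using UD[of i] D(2)[of "U i"] by auto
  qed
  ultimately show "\<exists>U :: nat \<Rightarrow> real set. N \<subseteq> (\<Union>i. U i) \<and> (\<forall>i. bounded (U i)) \<and>
      (\<Sum>i. ennreal (diameter (U i))) \<le> ennreal \<epsilon>"
    using D(4) unfolding cov[symmetric] by blast
qed

lemma UN_atLeastAtMost_nat: "(\<Union>j::nat. {- real j..real j}) = UNIV"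
proof -
  have "x \<in> (\<Union>j::nat. {- real j..real j})" for x :: real
  proof -
    obtain j where "\<bar>x\<bar> \<le> real j" using real_arch_simple by blast
    then have "x \<in> {- real j..real j}" by (simp add: abs_le_iff)
    then show ?thesis by blast
  qed
  then show ?thesis by blast
qed

lemma length_null_null_set:
  fixes N :: "real set"
  assumes N: "N \<in> null_sets lborel"
  shows "length_null N"
proof -
  have eq: "(\<Union>j. N \<inter> {- real j..real j}) = N"
    using UN_atLeastAtMost_nat by blast
  have "length_null (N \<inter> {- real j..real j})" for j
  proof (rule length_null_bounded_null_set)
    show "N \<inter> {- real j..real j} \<in> null_sets lebesgue"
      using N by (intro null_set_Int2) (auto intro: null_sets_completionI)
  qed auto
  then have "length_null (\<Union>j. N \<inter> {- real j..real j})" by (rule length_null_UN)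
  then show ?thesis unfolding eq .
qed

text \<open>
  Projection does not increase distances: a set of diameter \<open>d\<close> projects into an interval of length \<open>2 d\<close>.
\<close>

lemma length_null_imp_null_fst_image:
  fixes N :: "(real \<times> real) set"
  assumes N: "length_null N" and B: "B \<in> sets borel" "B \<subseteq> fst ` N"
  shows "emeasure lborel B = 0"
proof -
  have "emeasure lborel B \<le> 2 * ennreal \<epsilon>" if e: "\<epsilon> > 0" for \<epsilon>
  proof -
    obtain U :: "nat \<Rightarrow> (real \<times> real) set" where U: "N \<subseteq> (\<Union>i. U i)" "\<And>i. bounded (U i)"
      "(\<Sum>i. ennreal (diameter (U i))) \<le> ennreal \<epsilon>"
      using N e unfolding length_null_def by blast
    \<comment> \<open>An interval centred at the projection of any point of the covering set.\<close>
    define V where "V = (\<lambda>i. if U i = {} then {} else cball (fst (SOME p. p \<in> U i)) (diameter (U i)))"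
    have "B \<subseteq> (\<Union>i. V i)"
    proof
      fix x assume "x \<in> B"
      then obtain p i where p: "p \<in> U i" "x = fst p" using B U(1) by blast
      then have "(SOME p. p \<in> U i) \<in> U i" by (metis someI)
      then have "dist (SOME p. p \<in> U i) p \<le> diameter (U i)" using p U(2) by (intro diameter_bounded_bound) auto
      then have "dist (fst (SOME p. p \<in> U i)) (fst p) \<le> diameter (U i)" using dist_fst_le order_trans by blast
      then have "x \<in> V i" using p by (auto simp: V_def)
      then show "x \<in> (\<Union>i. V i)" by blast
    qed
    have Vm: "V i \<in> sets lborel" for i unfolding V_def by auto
    have Vd: "emeasure lborel (V i) \<le> 2 * ennreal (diameter (U i))" for i
      using diameter_ge_0[OF U(2)[of i]] by (auto simp: V_def cball_eq_atLeastAtMost ennreal_mult' [symmetric] simp flip: ennreal_numeral)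
    have "emeasure lborel B \<le> emeasure lborel (\<Union>i. V i)"
      using \<open>B \<subseteq> (\<Union>i. V i)\<close> Vm by (intro emeasure_mono) auto
    also have "\<dots> \<le> (\<Sum>i. emeasure lborel (V i))" by (rule emeasure_subadditive_countably) (use Vm in auto)
    also have "\<dots> \<le> (\<Sum>i. 2 * ennreal (diameter (U i)))" by (intro suminf_le Vd) auto
    also have "\<dots> = 2 * (\<Sum>i. ennreal (diameter (U i)))" by (rule ennreal_suminf_cmult)
    also have "\<dots> \<le> 2 * ennreal \<epsilon>" using U(3) by (intro mult_left_mono) auto
    finally show ?thesis .
  qed
  note le = this
  have "emeasure lborel B \<le> 0"
  proof (rule ennreal_le_epsilon)
    fix e :: real assume e: "0 < e"
    have "2 * ennreal (e / 2) = ennreal e" using e by (simp flip: ennreal_numeral ennreal_mult')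
    then show "emeasure lborel B \<le> 0 + ennreal e" using le[of "e / 2"] e by simp
  qed
  then show ?thesis by simp
qed

section \<open>Measures on finitely many parallel lines\<close>

text \<open>
  Lebesgue measure on each of the lines \<open>\<real> \<times> {0}, \<dots>, \<real> \<times> {n - 1}\<close>: a form of arc length on their
  union in which integrals are sums of integrals over the real line.
\<close>

definition lines_measure :: "nat \<Rightarrow> (real \<times> real) measure" where
  "lines_measure n =
     distr (count_space {..<n} \<Otimes>\<^sub>M lborel) borel (\<lambda>(m, x). (x, real m))"

lemma measurable_lines [measurable]:
  "(\<lambda>(m, x). (x, real m)) \<in> count_space {..<n} \<Otimes>\<^sub>M lborel \<rightarrow>\<^sub>M (borel :: (real \<times> real) measure)"
  unfolding borel_prod[symmetric] split_def
proof (intro measurable_Pair)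
  show "(\<lambda>p. snd p) \<in> count_space {..<n} \<Otimes>\<^sub>M lborel \<rightarrow>\<^sub>M borel"
    by (rule measurable_compose[OF measurable_snd]) simp
  show "(\<lambda>p. real (fst p)) \<in> count_space {..<n} \<Otimes>\<^sub>M lborel \<rightarrow>\<^sub>M borel"
    by (rule measurable_compose[OF measurable_fst]) simp
qed

lemma sets_lines_measure [simp]: "sets (lines_measure n) = sets borel"
  by (simp add: lines_measure_def)

lemma space_lines_measure [simp]: "space (lines_measure n) = UNIV"
  by (simp add: lines_measure_def)

lemma measurable_on_line [measurable (raw)]:
  assumes "h \<in> borel_measurable borel"
  shows "(\<lambda>x::real. h (x, c :: real)) \<in> borel_measurable borel"
proof -
  have "(\<lambda>x. (x, c)) \<in> borel \<rightarrow>\<^sub>M (borel :: (real \<times> real) measure)"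
    unfolding borel_prod[symmetric] by measurable
  from measurable_compose[OF this assms] show ?thesis .
qed

lemma slice_borel: "A \<in> sets borel \<Longrightarrow> {x :: real. (x, c :: real) \<in> A} \<in> sets borel"
proof -
  assume A: "A \<in> sets borel"
  have "(\<lambda>x :: real. (x, c)) \<in> borel \<rightarrow>\<^sub>M (borel :: (real \<times> real) measure)"
    unfolding borel_prod[symmetric] by measurable
  from measurable_sets[OF this A] show ?thesis by (simp add: vimage_def)
qed

lemma nn_integral_lines_measure:
  assumes g: "g \<in> borel_measurable borel"
  shows "(\<integral>\<^sup>+p. g p \<partial>lines_measure n) = (\<Sum>m<n. \<integral>\<^sup>+x. g (x, real m) \<partial>lborel)"
proof -
  have gm: "(\<lambda>p. g ((\<lambda>(m, x). (x, real m)) p)) \<in> borel_measurable (count_space {..<n} \<Otimes>\<^sub>M lborel)"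
    using measurable_compose[OF measurable_lines g] by simp
  have "(\<integral>\<^sup>+p. g p \<partial>lines_measure n) = (\<integral>\<^sup>+p. g ((\<lambda>(m, x). (x, real m)) p) \<partial>(count_space {..<n} \<Otimes>\<^sub>M lborel))"
    unfolding lines_measure_def using g by (intro nn_integral_distr) auto
  also have "\<dots> = (\<integral>\<^sup>+m. \<integral>\<^sup>+x. g (x, real m) \<partial>lborel \<partial>count_space {..<n})"
    using lborel.nn_integral_fst[OF gm] by simp
  also have "\<dots> = (\<Sum>m<n. \<integral>\<^sup>+x. g (x, real m) \<partial>lborel)"
    by (rule nn_integral_count_space_finite) simp
  finally show ?thesis .
qed

lemma emeasure_lines_measure:
  assumes A: "A \<in> sets borel"
  shows "emeasure (lines_measure n) A = (\<Sum>m<n. emeasure lborel {x. (x, real m) \<in> A})"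
proof -
  have "emeasure (lines_measure n) A = (\<integral>\<^sup>+p. indicator A p \<partial>lines_measure n)"
    using A by simp
  also have "\<dots> = (\<Sum>m<n. \<integral>\<^sup>+x. indicator A (x, real m) \<partial>lborel)"
    using A by (intro nn_integral_lines_measure) auto
  also have "\<dots> = (\<Sum>m<n. \<integral>\<^sup>+x. indicator {x. (x, real m) \<in> A} x \<partial>lborel)"
    by (simp add: indicator_def)
  also have "\<dots> = (\<Sum>m<n. emeasure lborel {x. (x, real m) \<in> A})"
    using slice_borel[OF A] by simp
  finally show ?thesis .
qed

lemma integrable_lines_measure_iff:
  fixes h :: "real \<times> real \<Rightarrow> complex"
  assumes h: "h \<in> borel_measurable borel"
  shows "integrable (lines_measure n) h \<longleftrightarrow> (\<forall>m<n. integrable lborel (\<lambda>x. h (x, real m)))"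
proof -
  have "h \<in> borel_measurable (lines_measure n)" using h by (simp add: lines_measure_def)
  moreover have "(\<lambda>x. h (x, real m)) \<in> borel_measurable lborel" for m using measurable_on_line[OF h] by simp
  moreover have "(\<integral>\<^sup>+p. ennreal (norm (h p)) \<partial>lines_measure n) = (\<Sum>m<n. \<integral>\<^sup>+x. ennreal (norm (h (x, real m))) \<partial>lborel)"
    using h by (intro nn_integral_lines_measure) auto
  ultimately show ?thesis unfolding integrable_iff_bounded by auto
qed

lemma integral_lines_measure:
  fixes h :: "real \<times> real \<Rightarrow> complex"
  assumes h: "integrable (lines_measure n) h"
  shows "(LINT p|lines_measure n. h p) = (\<Sum>m<n. LINT x|lborel. h (x, real m))"
proof -
  have hm: "h \<in> borel_measurable borel" using h by (auto dest: borel_measurable_integrable simp: lines_measure_def)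
  interpret C: sigma_finite_measure "count_space {..<n}" by (rule sigma_finite_measure_count_space_finite) simp
  interpret P: pair_sigma_finite "count_space {..<n}" lborel ..
  have hi: "integrable (count_space {..<n} \<Otimes>\<^sub>M lborel) (\<lambda>p. h ((\<lambda>(m, x). (x, real m)) p))"
    using h hm unfolding lines_measure_def by (subst (asm) integrable_distr_eq) auto
  have "(LINT p|lines_measure n. h p) = (LINT p|(count_space {..<n} \<Otimes>\<^sub>M lborel). h ((\<lambda>(m, x). (x, real m)) p))"
    unfolding lines_measure_def using hm by (intro integral_distr) auto
  also have "\<dots> = (LINT m|count_space {..<n}. LINT x|lborel. h (x, real m))"
    using P.integral_fst'[OF hi] by simp
  also have "\<dots> = (\<Sum>m<n. LINT x|lborel. h (x, real m))"
    by (rule lebesgue_integral_count_space_finite) simp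
  finally show ?thesis .
qed

lemma sigma_finite_lines_measure: "sigma_finite_measure (lines_measure n)"
proof
  define S where "S = (\<lambda>k::nat. {- real k..real k} \<times> (UNIV :: real set))"
  have Sb: "S k \<in> sets borel" for k
    unfolding S_def by (intro borel_closed closed_Times) auto
  have fin: "emeasure (lines_measure n) (S k) \<noteq> \<infinity>" for k
  proof -
    have "{x. (x, real m) \<in> S k} = {- real k..real k}" for m by (auto simp: S_def)
    then show ?thesis unfolding emeasure_lines_measure[OF Sb] by (simp add: ennreal_mult_eq_top_iff)
  qed
  have "p \<in> \<Union> (range S)" for p
  proof -
    obtain j :: nat where "fst p \<in> {- real j..real j}" using UN_atLeastAtMost_nat by blast
    then have "p \<in> S j" unfolding S_def by (auto simp: mem_Times_iff)
    then show ?thesis by blast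
  qed
  then have cov: "\<Union> (range S) = UNIV" by blast
  show "\<exists>A. countable A \<and> A \<subseteq> sets (lines_measure n) \<and> \<Union> A = space (lines_measure n) \<and>
      (\<forall>a\<in>A. emeasure (lines_measure n) a \<noteq> \<infinity>)"
  proof (intro exI[of _ "range S"] conjI ballI)
    show "range S \<subseteq> sets (lines_measure n)" using Sb by auto
    show "\<Union> (range S) = space (lines_measure n)" unfolding cov by simp
    show "emeasure (lines_measure n) a \<noteq> \<infinity>" if "a \<in> range S" for a using that fin by blast
  qed simp
qed

lemma lines_measure_null_iff_arc_length_null:
  assumes A: "A \<in> sets borel"
  shows "emeasure (lines_measure n) A = 0 \<longleftrightarrow> arc_length_on (UNIV \<times> real ` {..<n}) A = 0"
proof -
  define S where "S = (\<lambda>m. {x. (x, real m) \<in> A})"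
  have Sb: "S m \<in> sets borel" for m unfolding S_def by (rule slice_borel[OF A])
  have eq: "emeasure (lines_measure n) A = 0 \<longleftrightarrow> (\<forall>m<n. emeasure lborel (S m) = 0)"
    unfolding emeasure_lines_measure[OF A] by (auto simp: S_def)
  have "(\<forall>m<n. emeasure lborel (S m) = 0) \<longleftrightarrow> length_null (A \<inter> UNIV \<times> real ` {..<n})"
  proof
    assume z: "\<forall>m<n. emeasure lborel (S m) = 0"
    have "length_null (if m < n then (\<lambda>x. (x, real m)) ` S m else {})" for m
    proof (cases "m < n")
      case True
      have "length_null (S m)" using z True Sb by (intro length_null_null_set) (auto simp: null_sets_def)
      then show ?thesis using True by (auto intro!: length_null_isometric_image simp: dist_Pair_Pair)
    next
      case False
      show ?thesis using False by (auto simp: length_null_def intro!: exI[of _ "\<lambda>_. {}"])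
    qed
    then have "length_null (\<Union>m. if m < n then (\<lambda>x. (x, real m)) ` S m else {})" by (rule length_null_UN)
    then show "length_null (A \<inter> UNIV \<times> real ` {..<n})"
      by (rule length_null_subset) (auto simp: S_def)
  next
    assume t: "length_null (A \<inter> UNIV \<times> real ` {..<n})"
    show "\<forall>m<n. emeasure lborel (S m) = 0"
    proof (intro allI impI)
      fix m assume "m < n"
      then have "S m \<subseteq> fst ` (A \<inter> UNIV \<times> real ` {..<n})" by (force simp: S_def)
      then show "emeasure lborel (S m) = 0" using t Sb by (intro length_null_imp_null_fst_image)
    qed
  qed
  then show ?thesis unfolding eq arc_length_on_def hausdorff_measure_1_eq_0_iff_length_null .
qed

section \<open>Polynomials vanishing on fibres\<close>

lemma coeffs_zero_of_many_roots:
  fixes a :: "nat \<Rightarrow> complex"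
  assumes Z: "infinite Z \<or> n \<le> card Z" and roots: "\<And>z. z \<in> Z \<Longrightarrow> (\<Sum>m<n. a m * z ^ m) = 0" and m: "m < n"
  shows "a m = 0"
proof (rule ccontr)
  assume nz: "a m \<noteq> 0"
  define p where "p = (\<Sum>m<n. monom (a m) m)"
  have cp: "coeff p j = (if j < n then a j else 0)" for j
    by (simp add: p_def coeff_sum coeff_monom)
  have p0: "p \<noteq> 0" using nz m cp[of m] by auto
  have "Z \<subseteq> {z. poly p z = 0}" using roots by (auto simp: p_def poly_sum poly_monom)
  moreover have fin: "finite {z. poly p z = 0}" by (rule poly_roots_finite[OF p0])
  ultimately have "finite Z" "card Z \<le> card {z. poly p z = 0}"
    by (auto intro: finite_subset card_mono)
  moreover have "card {z. poly p z = 0} \<le> degree p" by (rule card_poly_roots_bound[OF p0])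
  moreover have "degree p < n" by (rule degree_lessI) (use m cp in auto)
  ultimately show False using Z by simp
qed

text \<open>
  The difference of the two sides has degree less than \<open>card Z\<close> and vanishes on \<open>Z\<close>.
\<close>

lemma monic_eq_prod_roots:
  fixes a :: "nat \<Rightarrow> complex"
  assumes Z: "finite Z" and roots: "\<And>w. w \<in> Z \<Longrightarrow> w ^ card Z = (\<Sum>j<card Z. a j * w ^ j)"
  shows "z ^ card Z - (\<Sum>j<card Z. a j * z ^ j) = (\<Prod>w\<in>Z. z - w)"
proof -
  define k where "k = card Z"
  define q where "q = (\<Prod>w\<in>Z. [:- w, 1:])"
  have dq: "degree q = k" unfolding q_def k_def by (subst degree_prod_sum_eq) auto
  have "lead_coeff q = 1" unfolding q_def by (simp add: lead_coeff_prod)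
  then have cq: "coeff q k = 1" using dq by simp
  have pq: "poly q z = z ^ k + (\<Sum>j<k. coeff q j * z ^ j)" for z
    unfolding poly_altdef dq using cq by (simp add: lessThan_Suc_atMost[symmetric])
  have q0: "poly q w = 0" if "w \<in> Z" for w
    unfolding q_def poly_prod using that Z by (intro prod_zero) auto
  have "coeff q j + a j = 0" if "j < k" for j
  proof (rule coeffs_zero_of_many_roots[where Z=Z])
    show "(\<Sum>j<k. (coeff q j + a j) * w ^ j) = 0" if "w \<in> Z" for w
      using q0[OF that] pq[of w] roots[OF that] by (simp add: k_def distrib_right sum.distrib add.commute)
  qed (use that in \<open>auto simp: k_def\<close>)
  then have "coeff q j = - a j" if "j < k" for j using that by (simp add: eq_neg_iff_add_eq_0)
  then have "poly q z = z ^ k - (\<Sum>j<k. a j * z ^ j)" unfolding pq by (simp add: sum_negf)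
  moreover have "poly q z = (\<Prod>w\<in>Z. z - w)" by (simp add: q_def poly_prod)
  ultimately show ?thesis by (simp add: k_def)
qed

text \<open>
  The value at \<open>z\<close> is the product of the differences between \<open>z\<close> and the roots.
\<close>

lemma root_near_of_small_value:
  fixes a :: "nat \<Rightarrow> complex"
  assumes Z: "finite Z" and roots: "\<And>w. w \<in> Z \<Longrightarrow> w ^ card Z = (\<Sum>j<card Z. a j * w ^ j)"
    and r: "0 \<le> r" and small: "norm (z ^ card Z - (\<Sum>j<card Z. a j * z ^ j)) < r ^ card Z"
  obtains w where "w \<in> Z" "dist z w < r"
proof (rule ccontr)
  assume no: "\<not> thesis"
  have "r ^ card Z = (\<Prod>w\<in>Z. r)" by simp
  also have "\<dots> \<le> (\<Prod>w\<in>Z. norm (z - w))"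
    using no that r by (intro prod_mono) (force simp: dist_norm not_less)
  also have "\<dots> = norm (\<Prod>w\<in>Z. z - w)" by (simp add: prod_norm)
  finally show False using small monic_eq_prod_roots[OF Z roots, of z] by simp
qed

text \<open>
  Here \<open>S \<xi>\<close> stands for the phases above \<open>\<xi>\<close>. The \<open>k\<close> points of \<open>S \<xi>\<^sub>0\<close> have mutual distance more than \<open>2 r\<close>. For \<open>\<xi>\<close> near \<open>\<xi>\<^sub>0\<close> in the
  dense stratum, the polynomial is small at these points, so each of them has a point of \<open>S \<xi>\<close>
  within \<open>r\<close>. By compactness and closedness, over any \<open>\<xi>\<close> near \<open>\<xi>\<^sub>0\<close> each of them has
  a point within \<open>r\<close> that lies in \<open>S \<xi>\<close> and is a root. These \<open>k\<close> points are distinct, hence exhaust \<open>S \<xi>\<close>.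
\<close>

lemma vanishing_on_fibres_extends:
  fixes S :: "real \<Rightarrow> complex set" and a :: "nat \<Rightarrow> real \<Rightarrow> complex"
  assumes closed: "\<And>x w \<xi> z. (\<And>j::nat. w j \<in> S (x j)) \<Longrightarrow> x \<longlonglongrightarrow> \<xi> \<Longrightarrow> w \<longlonglongrightarrow> z \<Longrightarrow> z \<in> S \<xi>"
    and J: "open J" "\<xi>\<^sub>0 \<in> J"
    and cont: "\<And>j \<xi>. j < k \<Longrightarrow> isCont (a j) \<xi>"
    and fin: "\<And>\<xi>. \<xi> \<in> J \<Longrightarrow> finite (S \<xi>)" and le: "\<And>\<xi>. \<xi> \<in> J \<Longrightarrow> card (S \<xi>) \<le> k"
    and dense: "J \<subseteq> closure {\<xi>. card (S \<xi>) = k}" and k0: "card (S \<xi>\<^sub>0) = k"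
    and van: "\<And>\<xi> z. \<xi> \<in> J \<Longrightarrow> card (S \<xi>) = k \<Longrightarrow> z \<in> S \<xi> \<Longrightarrow> z ^ k = (\<Sum>j<k. a j \<xi> * z ^ j)"
  obtains \<delta> where "\<delta> > 0"
    "\<And>\<xi> z. \<bar>\<xi> - \<xi>\<^sub>0\<bar> < \<delta> \<Longrightarrow> z \<in> S \<xi> \<Longrightarrow> z ^ k = (\<Sum>j<k. a j \<xi> * z ^ j)"
proof -
  define Z where "Z = S \<xi>\<^sub>0"
  have Zf: "finite Z" using fin J by (simp add: Z_def)
  define p where "p = (\<lambda>\<xi> z. z ^ k - (\<Sum>j<k. a j \<xi> * z ^ j))"
  define D where "D = insert 1 ((\<lambda>(z, w). dist z w) ` {(z, w) \<in> Z \<times> Z. z \<noteq> w})"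
  have Df: "finite D" unfolding D_def using Zf by (intro finite.insertI finite_imageI) (auto intro: finite_subset[of _ "Z \<times> Z"])
  have Dpos: "d > 0" if "d \<in> D" for d using that by (auto simp: D_def)
  define r where "r = Min D / 3"
  have r: "r > 0" unfolding r_def using Df Dpos Min_in[of D] by (auto simp: D_def)
  have sep: "2 * r < dist z w" if "z \<in> Z" "w \<in> Z" "z \<noteq> w" for z w
  proof -
    have "dist z w \<in> D" using that by (force simp: D_def)
    then have "Min D \<le> dist z w" using Df by simp
    then show ?thesis using r by (simp add: r_def)
  qed
  have pcont: "isCont (\<lambda>\<xi>. p \<xi> z) \<xi>" for z \<xi>
    unfolding p_def using cont by (intro continuous_intros) auto
  have ev: "\<forall>\<^sub>F \<xi> in nhds \<xi>\<^sub>0. norm (p \<xi> z) < r ^ k" if "z \<in> Z" for z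
  proof -
    have p0: "p \<xi>\<^sub>0 z = 0" using van[of \<xi>\<^sub>0 z] that J k0 by (simp add: p_def Z_def)
    have "((\<lambda>\<xi>. norm (p \<xi> z)) \<longlongrightarrow> norm (p \<xi>\<^sub>0 z)) (nhds \<xi>\<^sub>0)"
      using pcont[where z=z and \<xi>="\<xi>\<^sub>0"] unfolding isCont_def
      by (intro tendsto_norm tendsto_at_iff_tendsto_nhds[where g="\<lambda>\<xi>. p \<xi> z", THEN iffD1])
    then show ?thesis using p0 r by (auto dest: order_tendstoD(2)[of _ _ _ "r ^ k"])
  qed
  have "\<forall>\<^sub>F \<xi> in nhds \<xi>\<^sub>0. \<xi> \<in> J \<and> (\<forall>z \<in> Z. norm (p \<xi> z) < r ^ k)"
    using eventually_nhds_in_open[OF J] ev Zf by (auto simp: eventually_conj_iff eventually_ball_finite_distrib)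
  then obtain U where U: "open U" "\<xi>\<^sub>0 \<in> U" "\<And>\<xi>. \<xi> \<in> U \<Longrightarrow> \<xi> \<in> J"
    "\<And>\<xi> z. \<xi> \<in> U \<Longrightarrow> z \<in> Z \<Longrightarrow> norm (p \<xi> z) < r ^ k"
    unfolding eventually_nhds by blast
  have near: "\<exists>w. w \<in> S \<xi> \<and> dist z w < r" if "\<xi> \<in> U" "card (S \<xi>) = k" "z \<in> Z" for \<xi> z
  proof -
    have "finite (S \<xi>)" using fin U(3) that by blast
    moreover have "w ^ card (S \<xi>) = (\<Sum>j<card (S \<xi>). a j \<xi> * w ^ j)" if "w \<in> S \<xi>" for w
      using van U(3) \<open>\<xi> \<in> U\<close> \<open>card (S \<xi>) = k\<close> that by simp
    moreover have "norm (z ^ card (S \<xi>) - (\<Sum>j<card (S \<xi>). a j \<xi> * z ^ j)) < r ^ card (S \<xi>)"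
      using U(4)[OF that(1,3)] that(2) by (simp add: p_def)
    ultimately show ?thesis using r root_near_of_small_value[of "S \<xi>" "\<lambda>j. a j \<xi>" r z] by (metis less_imp_le)
  qed
  have all: "z ^ k = (\<Sum>j<k. a j \<xi> * z ^ j)" if \<xi>: "\<xi> \<in> U" and z: "z \<in> S \<xi>" for \<xi> z
  proof -
    have "\<exists>w. w \<in> S \<xi> \<and> dist z w \<le> r \<and> p \<xi> w = 0" if zZ: "z \<in> Z" for z
    proof -
      have "\<xi> \<in> U \<inter> closure {\<xi>. card (S \<xi>) = k}" using \<xi> U(3) dense by blast
      then have "\<xi> \<in> closure (U \<inter> {\<xi>. card (S \<xi>) = k})" using open_Int_closure_subset[OF U(1)] by blast
      then obtain x where x: "\<And>j::nat. x j \<in> U \<inter> {\<xi>. card (S \<xi>) = k}" "x \<longlonglongrightarrow> \<xi>"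
        unfolding closure_sequential by blast
      have "\<exists>w. w \<in> S (x j) \<and> dist z w < r" for j using near[of "x j" z] x(1)[of j] zZ by blast
      then obtain w where w: "\<And>j. w j \<in> S (x j)" "\<And>j. dist z (w j) < r" by metis
      have "\<forall>j. w j \<in> cball z r" using w(2) by (simp add: less_imp_le)
      then obtain l s where l: "l \<in> cball z r" "strict_mono s" "(w \<circ> s) \<longlonglongrightarrow> l"
        using compact_cball[of z r] unfolding compact_def by metis
      have xs: "(x \<circ> s) \<longlonglongrightarrow> \<xi>" by (rule LIMSEQ_subseq_LIMSEQ[OF x(2) l(2)])
      have "l \<in> S \<xi>" by (rule closed[OF _ xs l(3)]) (simp add: w(1))
      moreover have "p \<xi> l = 0"
      proof -
        have "p ((x \<circ> s) j) ((w \<circ> s) j) = 0" for j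
          using van[of "x (s j)" "w (s j)"] x(1)[of "s j"] U(3) w(1) by (simp add: p_def)
        moreover have "(\<lambda>j. p ((x \<circ> s) j) ((w \<circ> s) j)) \<longlonglongrightarrow> p \<xi> l"
          unfolding p_def
          by (intro tendsto_intros l(3) isCont_tendsto_compose[OF cont xs]) auto
        ultimately show ?thesis by (simp add: LIMSEQ_const_iff)
      qed
      ultimately show ?thesis using l(1) by auto
    qed
    then obtain W where W: "\<And>z. z \<in> Z \<Longrightarrow> W z \<in> S \<xi>" "\<And>z. z \<in> Z \<Longrightarrow> dist z (W z) \<le> r"
      "\<And>z. z \<in> Z \<Longrightarrow> p \<xi> (W z) = 0" by metis
    have "inj_on W Z"
    proof (rule inj_onI, rule ccontr)
      fix z w assume zw: "z \<in> Z" "w \<in> Z" "W z = W w" "z \<noteq> w"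
      have "dist z w \<le> dist z (W z) + dist w (W z)" by (rule dist_triangle2)
      also have "\<dots> \<le> r + r" using W(2)[OF zw(1)] W(2)[OF zw(2)] zw(3) by (intro add_mono) auto
      finally show False using sep[OF zw(1,2,4)] by simp
    qed
    then have "card (W ` Z) = k" using k0 by (simp add: card_image Z_def)
    then have "W ` Z = S \<xi>"
      using W(1) fin le U(3) \<xi> by (intro card_seteq) auto
    then obtain z' where "z' \<in> Z" "z = W z'" using z by blast
    then show ?thesis using W(3) by (simp add: p_def)
  qed
  obtain \<delta> where "\<delta> > 0" "ball \<xi>\<^sub>0 \<delta> \<subseteq> U" using U(1,2) openE by blast
  then show ?thesis using that[of \<delta>] all by (auto simp: dist_real_def abs_minus_commute subset_iff)
qed

text \<open>
  Descend from the bound \<open>m\<close>: if the points with value \<open>m\<close> are not dense, some smaller open set avoids them and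
  has a smaller bound.
\<close>

lemma exists_dense_stratum:
  fixes c :: "'a::topological_space \<Rightarrow> nat"
  assumes "open J" "J \<noteq> {}" "\<And>x. x \<in> J \<Longrightarrow> c x \<le> m"
  obtains J' k where "open J'" "J' \<noteq> {}" "J' \<subseteq> J" "\<And>x. x \<in> J' \<Longrightarrow> c x \<le> k" "J' \<subseteq> closure {x. c x = k}"
  using assms
proof (induction m arbitrary: J thesis)
  case 0
  have "J \<subseteq> closure {x. c x = 0}" using 0(4) closure_subset by fastforce
  then show ?case using 0(1)[of J 0] 0(2-4) by blast
next
  case (Suc m)
  show ?case
  proof (cases "J \<subseteq> closure {x. c x = Suc m}")
    case True
    then show ?thesis using Suc.prems(1)[of J "Suc m"] Suc.prems(2-4) by blast
  next
    case False
    define J1 where "J1 = J - closure {x. c x = Suc m}"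
    have "open J1" "J1 \<noteq> {}" using False Suc.prems(2) by (auto simp: J1_def)
    moreover have "c x \<le> m" if "x \<in> J1" for x
    proof -
      have "c x \<noteq> Suc m" using that closure_subset[of "{x. c x = Suc m}"] by (auto simp: J1_def)
      then show ?thesis using Suc.prems(4)[of x] that by (auto simp: J1_def)
    qed
    ultimately obtain J' k where "open J'" "J' \<noteq> {}" "J' \<subseteq> J1" "\<And>x. x \<in> J' \<Longrightarrow> c x \<le> k" "J' \<subseteq> closure {x. c x = k}"
      using Suc.IH[of J1] by metis
    then show ?thesis using Suc.prems(1)[of J' k] by (auto simp: J1_def)
  qed
qed

section \<open>Phases above a point\<close>

text \<open>
  By periodicity these numbers correspond to the points of \<open>Img \<Lambda> \<xi>\<close>. For closed \<open>\<Lambda>\<close> their graph is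
  closed, whereas limits of points of \<open>Img \<Lambda> \<xi>\<close> may reach the excluded end of \<open>[0, 2)\<close>.
\<close>

definition phases :: "(real \<times> real) set \<Rightarrow> real \<Rightarrow> complex set" where
  "phases \<Lambda> \<xi> = {cis (pi * \<eta>) | \<eta>. (\<xi>, \<eta>) \<in> \<Lambda>}"

lemma norm_phases: "z \<in> phases \<Lambda> \<xi> \<Longrightarrow> norm z = 1"
  by (auto simp: phases_def)

lemma inj_on_cis_pi: "inj_on (\<lambda>\<eta>. cis (pi * \<eta>)) {0..<2}"
proof (rule inj_onI)
  fix x y :: real assume xy: "x \<in> {0..<2}" "y \<in> {0..<2}" "cis (pi * x) = cis (pi * y)"
  then have "sin (pi * x) = sin (pi * y) \<and> cos (pi * x) = cos (pi * y)" by (simp add: complex_eq_iff)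
  then obtain m :: int where "pi * x = pi * y + 2 * pi * m" unfolding sin_cos_eq_iff by blast
  then have "pi * (x - y) = pi * (2 * m)" by (simp add: algebra_simps)
  then have m: "x - y = 2 * m" by (simp only: mult_cancel_left) simp
  then have "\<bar>2 * real_of_int m\<bar> < 2" using xy by auto
  then have "m = 0" by auto
  then show "x = y" using m by simp
qed

context
  fixes \<Lambda> :: "(real \<times> real) set"
  assumes periodic: "\<And>\<xi> \<eta>. (\<xi>, \<eta>) \<in> \<Lambda> \<longleftrightarrow> (\<xi>, \<eta> + 2) \<in> \<Lambda>"
begin

lemma periodic_int: "(\<xi>, \<eta> + 2 * real_of_int m) \<in> \<Lambda> \<longleftrightarrow> (\<xi>, \<eta>) \<in> \<Lambda>"
proof -
  have nat: "(\<xi>, \<eta> + 2 * real j) \<in> \<Lambda> \<longleftrightarrow> (\<xi>, \<eta>) \<in> \<Lambda>" for \<eta> j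
  proof (induction j)
    case (Suc j)
    have "\<eta> + 2 * real (Suc j) = (\<eta> + 2 * real j) + 2" by simp
    then show ?case using periodic[of \<xi> "\<eta> + 2 * real j"] Suc by metis
  qed simp
  show ?thesis
  proof (cases "m \<ge> 0")
    case True
    then show ?thesis using nat[of \<eta> "nat m"] by simp
  next
    case False
    then have "\<eta> + 2 * real_of_int m + 2 * real (nat (- m)) = \<eta>" by simp
    then show ?thesis using nat[of "\<eta> + 2 * real_of_int m" "nat (- m)"] by simp
  qed
qed

lemma exists_representative:
  assumes "(\<xi>, \<eta>) \<in> \<Lambda>"
  obtains \<eta>' where "\<eta>' \<in> Img \<Lambda> \<xi>" "cis (pi * \<eta>') = cis (pi * \<eta>)"
proof -
  define m where "m = \<lfloor>\<eta> / 2\<rfloor>"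
  define \<eta>' where "\<eta>' = \<eta> + 2 * real_of_int (- m)"
  have "of_int m \<le> \<eta> / 2" "\<eta> / 2 < of_int m + 1" unfolding m_def by linarith+
  then have "0 \<le> \<eta>'" "\<eta>' < 2" by (auto simp: \<eta>'_def)
  moreover have "(\<xi>, \<eta>') \<in> \<Lambda>" unfolding \<eta>'_def periodic_int by (rule assms)
  moreover have "cis (pi * \<eta>') = cis (pi * \<eta>)"
  proof -
    have "pi * \<eta>' = pi * \<eta> + 2 * pi * real_of_int (- m)" by (simp add: \<eta>'_def algebra_simps)
    then have "sin (pi * \<eta>') = sin (pi * \<eta>) \<and> cos (pi * \<eta>') = cos (pi * \<eta>)"
      unfolding sin_cos_eq_iff by blast
    then show ?thesis by (simp add: complex_eq_iff)
  qed
  ultimately show ?thesis using that by (simp add: Img_def)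
qed

lemma phases_eq_image: "phases \<Lambda> \<xi> = (\<lambda>\<eta>. cis (pi * \<eta>)) ` Img \<Lambda> \<xi>"
proof
  show "phases \<Lambda> \<xi> \<subseteq> (\<lambda>\<eta>. cis (pi * \<eta>)) ` Img \<Lambda> \<xi>"
  proof
    fix z assume "z \<in> phases \<Lambda> \<xi>"
    then obtain \<eta> where \<eta>: "(\<xi>, \<eta>) \<in> \<Lambda>" "z = cis (pi * \<eta>)" by (auto simp: phases_def)
    from exists_representative[OF \<eta>(1)] obtain \<eta>' where "\<eta>' \<in> Img \<Lambda> \<xi>" "cis (pi * \<eta>') = cis (pi * \<eta>)" .
    then show "z \<in> (\<lambda>\<eta>. cis (pi * \<eta>)) ` Img \<Lambda> \<xi>" using \<eta>(2) by (intro image_eqI[of _ _ \<eta>']) simp_all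
  qed
qed (auto simp: phases_def Img_def)

lemma bij_betw_phases: "bij_betw (\<lambda>\<eta>. cis (pi * \<eta>)) (Img \<Lambda> \<xi>) (phases \<Lambda> \<xi>)"
  unfolding bij_betw_def phases_eq_image
proof
  show "inj_on (\<lambda>\<eta>. cis (pi * \<eta>)) (Img \<Lambda> \<xi>)"
    by (rule inj_on_subset[OF inj_on_cis_pi]) (auto simp: Img_def)
qed (rule refl)

lemma finite_phases: "finite (phases \<Lambda> \<xi>) \<longleftrightarrow> finite (Img \<Lambda> \<xi>)"
  using bij_betw_finite[OF bij_betw_phases] by blast

lemma card_phases: "card (phases \<Lambda> \<xi>) = card (Img \<Lambda> \<xi>)"
  using bij_betw_same_card[OF bij_betw_phases] by metis

lemma Pi_proj_iff: "\<xi> \<in> Pi_proj \<Lambda> \<longleftrightarrow> phases \<Lambda> \<xi> \<noteq> {}"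
  by (auto simp: Pi_proj_def phases_def)

lemma Pi_exactly_iff:
  "k \<ge> 1 \<Longrightarrow> \<xi> \<in> Pi_exactly \<Lambda> k \<longleftrightarrow> card (phases \<Lambda> \<xi>) = k"
  unfolding Pi_exactly_def mem_Collect_eq Pi_proj_iff finite_phases[symmetric] card_phases[symmetric]
  using card_ge_0_finite[of "phases \<Lambda> \<xi>"] by (auto simp: card_eq_0_iff)

lemma Pi_at_least_iff:
  "n \<ge> 1 \<Longrightarrow> \<xi> \<in> Pi_at_least \<Lambda> n \<longleftrightarrow> infinite (phases \<Lambda> \<xi>) \<or> n \<le> card (phases \<Lambda> \<xi>)"
  unfolding Pi_at_least_def mem_Collect_eq Pi_proj_iff finite_phases[symmetric] card_phases[symmetric]
  by auto

lemma closed_phases: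
  assumes cl: "closed \<Lambda>" and w: "\<And>j::nat. w j \<in> phases \<Lambda> (x j)" and x: "x \<longlonglongrightarrow> \<xi>" and z: "w \<longlonglongrightarrow> z"
  shows "z \<in> phases \<Lambda> \<xi>"
proof -
  have "\<exists>\<eta>. \<eta> \<in> Img \<Lambda> (x j) \<and> w j = cis (pi * \<eta>)" for j
    using w[of j] unfolding phases_eq_image by blast
  then obtain e where e: "\<And>j. e j \<in> Img \<Lambda> (x j)" "\<And>j. w j = cis (pi * e j)" by metis
  have "\<forall>j. e j \<in> {0..2}" using e(1) by (auto simp: Img_def less_imp_le)
  then obtain \<eta> s where s: "\<eta> \<in> {0..2}" "strict_mono s" "(e \<circ> s) \<longlonglongrightarrow> \<eta>"
    using compact_Icc[of 0 "2::real"] unfolding compact_def by metis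
  have xs: "(x \<circ> s) \<longlonglongrightarrow> \<xi>" by (rule LIMSEQ_subseq_LIMSEQ[OF x s(2)])
  have ws: "(w \<circ> s) \<longlonglongrightarrow> z" by (rule LIMSEQ_subseq_LIMSEQ[OF z s(2)])
  have lim: "(\<lambda>j. ((x \<circ> s) j, (e \<circ> s) j)) \<longlonglongrightarrow> (\<xi>, \<eta>)" by (intro tendsto_Pair xs s(3))
  have mem: "((x \<circ> s) j, (e \<circ> s) j) \<in> \<Lambda>" for j using e(1)[of "s j"] by (simp add: Img_def)
  have "(\<xi>, \<eta>) \<in> \<Lambda>" by (rule closed_sequentially[OF cl mem lim])
  moreover have "(\<lambda>j. cis (pi * (e \<circ> s) j)) \<longlonglongrightarrow> cis (pi * \<eta>)"
    by (intro tendsto_intros s(3))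
  then have "(w \<circ> s) \<longlonglongrightarrow> cis (pi * \<eta>)" by (simp add: comp_def e(2))
  then have "z = cis (pi * \<eta>)" using ws LIMSEQ_unique by blast
  ultimately show ?thesis by (auto simp: phases_def)
qed

text \<open>
  The starred sets in terms of phases: near \<open>\<xi>\<^sub>0\<close> all phases over points with \<open>k\<close> phases are roots
  of one monic polynomial of degree \<open>d\<close>. The coefficients change sign and are indexed from \<open>0\<close>.
\<close>

lemma Pi_star_deg_iff:
  assumes k: "k \<ge> 1"
  shows "\<xi>\<^sub>0 \<in> Pi_star_deg \<Lambda> k d \<longleftrightarrow> card (phases \<Lambda> \<xi>\<^sub>0) = k \<and>
    (\<exists>\<delta> \<phi>. \<delta> > 0 \<and> (\<forall>j<d. integrable lborel (\<phi> j)) \<and>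
      (\<forall>\<xi> z. \<bar>\<xi> - \<xi>\<^sub>0\<bar> < \<delta> \<longrightarrow> card (phases \<Lambda> \<xi>) = k \<longrightarrow> z \<in> phases \<Lambda> \<xi> \<longrightarrow>
        z ^ d = (\<Sum>j<d. fourier (\<phi> j) \<xi> * z ^ j)))" (is "_ \<longleftrightarrow> ?R")
proof
  assume "\<xi>\<^sub>0 \<in> Pi_star_deg \<Lambda> k d"
  then obtain I \<phi> where m: "\<xi>\<^sub>0 \<in> Pi_exactly \<Lambda> k" and I: "interval_around \<xi>\<^sub>0 I"
    and \<phi>: "\<And>i. i \<in> {1..d} \<Longrightarrow> integrable lborel (\<phi> i)"
    and eq: "\<And>\<xi> \<eta>. \<xi> \<in> I \<inter> Pi_exactly \<Lambda> k \<Longrightarrow> \<eta> \<in> Img \<Lambda> \<xi> \<Longrightarrow>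
             (\<Sum>i=1..d. cis (real (i - 1) * pi * \<eta>) * fourier (\<phi> i) \<xi>) = - cis (real d * pi * \<eta>)"
    unfolding Pi_star_deg_def by blast
  obtain \<delta> where \<delta>: "\<delta> > 0" "ball \<xi>\<^sub>0 \<delta> \<subseteq> I" using I openE unfolding interval_around_def by blast
  define \<psi> where "\<psi> = (\<lambda>j x. (-1) * \<phi> (Suc j) x)"
  have "integrable lborel (\<psi> j)" if "j < d" for j unfolding \<psi>_def using \<phi>[of "Suc j"] that by auto
  moreover have "z ^ d = (\<Sum>j<d. fourier (\<psi> j) \<xi> * z ^ j)"
    if \<xi>: "\<bar>\<xi> - \<xi>\<^sub>0\<bar> < \<delta>" and c: "card (phases \<Lambda> \<xi>) = k" and z: "z \<in> phases \<Lambda> \<xi>" for \<xi> z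
  proof -
    obtain \<eta> where \<eta>: "\<eta> \<in> Img \<Lambda> \<xi>" "z = cis (pi * \<eta>)" using z unfolding phases_eq_image by blast
    have "\<xi> \<in> I" using \<xi> \<delta> by (auto simp: dist_real_def abs_minus_commute subset_iff)
    then have "(\<Sum>i=1..d. cis (real (i - 1) * pi * \<eta>) * fourier (\<phi> i) \<xi>) = - cis (real d * pi * \<eta>)"
      using eq[of \<xi> \<eta>] \<eta> c Pi_exactly_iff[OF k] by blast
    moreover have "(\<Sum>i=1..d. cis (real (i - 1) * pi * \<eta>) * fourier (\<phi> i) \<xi>) = (\<Sum>j<d. z ^ j * fourier (\<phi> (Suc j)) \<xi>)"
      by (rule sum.reindex_bij_witness[of _ Suc "\<lambda>i. i - 1"]) (auto simp: \<eta> Complex.DeMoivre mult.assoc)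
    moreover have "cis (real d * pi * \<eta>) = z ^ d" by (simp add: \<eta> Complex.DeMoivre mult.assoc)
    ultimately show ?thesis
      unfolding \<psi>_def by (simp only: fourier_cmult) (simp add: sum_negf mult.commute eq_neg_iff_add_eq_0 add.commute)
  qed
  ultimately show ?R using \<delta>(1) m Pi_exactly_iff[OF k] by blast
next
  assume ?R
  then obtain \<delta> \<phi> where c0: "card (phases \<Lambda> \<xi>\<^sub>0) = k" and \<delta>: "\<delta> > 0"
    and \<phi>: "\<And>j. j < d \<Longrightarrow> integrable lborel (\<phi> j)"
    and eq: "\<And>\<xi> z. \<bar>\<xi> - \<xi>\<^sub>0\<bar> < \<delta> \<Longrightarrow> card (phases \<Lambda> \<xi>) = k \<Longrightarrow> z \<in> phases \<Lambda> \<xi> \<Longrightarrow>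
        z ^ d = (\<Sum>j<d. fourier (\<phi> j) \<xi> * z ^ j)" by blast
  define \<psi> where "\<psi> = (\<lambda>i x. (-1) * \<phi> (i - 1) x)"
  have "interval_around \<xi>\<^sub>0 (ball \<xi>\<^sub>0 \<delta>)" using \<delta> by (simp add: interval_around_def is_interval_ball_real)
  moreover have "\<forall>i\<in>{1..d}. integrable lborel (\<psi> i)" unfolding \<psi>_def using \<phi> by auto
  moreover have "(\<Sum>i=1..d. cis (real (i - 1) * pi * \<eta>) * fourier (\<psi> i) \<xi>) = - cis (real d * pi * \<eta>)"
    if \<xi>: "\<xi> \<in> ball \<xi>\<^sub>0 \<delta> \<inter> Pi_exactly \<Lambda> k" and \<eta>: "\<eta> \<in> Img \<Lambda> \<xi>" for \<xi> \<eta>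
  proof -
    define z where "z = cis (pi * \<eta>)"
    have "z \<in> phases \<Lambda> \<xi>" using \<eta> by (simp add: phases_eq_image z_def)
    then have "z ^ d = (\<Sum>j<d. fourier (\<phi> j) \<xi> * z ^ j)"
      using eq[of \<xi> z] \<xi> Pi_exactly_iff[OF k] by (auto simp: dist_real_def abs_minus_commute)
    moreover have "(\<Sum>i=1..d. cis (real (i - 1) * pi * \<eta>) * fourier (\<psi> i) \<xi>) = (\<Sum>j<d. z ^ j * fourier (\<psi> (Suc j)) \<xi>)"
      by (rule sum.reindex_bij_witness[of _ Suc "\<lambda>i. i - 1"]) (auto simp: z_def Complex.DeMoivre mult.assoc)
    moreover have "cis (real d * pi * \<eta>) = z ^ d" by (simp add: z_def Complex.DeMoivre mult.assoc)
    ultimately show ?thesis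
      unfolding \<psi>_def by (simp only: fourier_cmult) (simp add: sum_negf mult.commute)
  qed
  ultimately show "\<xi>\<^sub>0 \<in> Pi_star_deg \<Lambda> k d"
    unfolding Pi_star_deg_def using c0 Pi_exactly_iff[OF k] by blast
qed

lemma Pi_one_star_eq:
  assumes "n \<ge> 2"
  shows "Pi_one_star n \<Lambda> = Pi_star_deg \<Lambda> 1 (n - 1)"
proof -
  have img: "Img \<Lambda> \<xi> = {THE \<eta>. \<eta> \<in> Img \<Lambda> \<xi>}" if "\<xi> \<in> Pi_exactly \<Lambda> 1" for \<xi>
  proof -
    have "card (Img \<Lambda> \<xi>) = 1" using that by (simp add: Pi_exactly_def)
    then obtain \<eta> where "Img \<Lambda> \<xi> = {\<eta>}" by (rule card_1_singletonE)
    then show ?thesis by simp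
  qed
  have pw: "chi \<Lambda> \<xi> ^ j = cis (real j * pi * (THE \<eta>. \<eta> \<in> Img \<Lambda> \<xi>))" for \<xi> j
    by (simp add: chi_def Complex.DeMoivre mult.assoc)
  have "(\<Sum>i=1..n-1. fourier (\<phi> i) \<xi> * chi \<Lambda> \<xi> ^ (i - 1)) + chi \<Lambda> \<xi> ^ (n - 1) = 0 \<longleftrightarrow>
      (\<forall>\<eta> \<in> Img \<Lambda> \<xi>. (\<Sum>i=1..n-1. cis (real (i - 1) * pi * \<eta>) * fourier (\<phi> i) \<xi>) = - cis (real (n - 1) * pi * \<eta>))"
    if "\<xi> \<in> Pi_exactly \<Lambda> 1" for \<xi> \<phi>
    by (subst img[OF that]) (simp add: pw mult.commute eq_neg_iff_add_eq_0)
  then show ?thesis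
    unfolding Pi_one_star_def Pi_star_deg_def P_class_def by (auto 4 4) 
qed

end

section \<open>Heisenberg uniqueness pairs\<close>

text \<open>
  On the line of height \<open>m\<close> the exponential factors into \<open>e\<^bsup>\<pi>ix\<xi>\<^esup>\<close> and the \<open>m\<close>-th power of \<open>e\<^bsup>\<pi>i\<eta>\<^esup>\<close>.
\<close>

lemma fourier_measure_lines:
  assumes h: "integrable (lines_measure n) h"
    and \<mu>: "\<And>A. A \<in> sets borel \<Longrightarrow> \<mu> A = set_lebesgue_integral (lines_measure n) A h"
  shows "fourier_measure \<mu> (\<xi>, \<eta>) = (\<Sum>m<n. fourier (\<lambda>x. h (x, real m)) \<xi> * cis (pi * \<eta>) ^ m)"
proof -
  define g where "g = (\<lambda>(x, y). cis (pi * (x * \<xi> + y * \<eta>)))"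
  have "continuous_on UNIV g" unfolding g_def split_def by (intro continuous_intros)
  then have gm: "g \<in> borel_measurable borel" by (rule borel_measurable_continuous_onI)
  have gn: "norm (g p) \<le> 1" for p by (simp add: g_def split_def)
  have hg: "integrable (lines_measure n) (\<lambda>p. h p * g p)"
  proof (rule Bochner_Integration.integrable_bound[OF h])
    show "(\<lambda>p. h p * g p) \<in> borel_measurable (lines_measure n)"
      using borel_measurable_integrable[OF h] gm by (intro borel_measurable_times) (auto simp: lines_measure_def)
    show "AE p in lines_measure n. norm (h p * g p) \<le> norm (h p)"
      using gn by (intro AE_I2) (simp add: norm_mult mult_left_le)
  qed
  have "fourier_measure \<mu> (\<xi>, \<eta>) = complex_integral \<mu> g" by (simp add: fourier_measure_def g_def)
  also have "\<dots> = (LINT p|lines_measure n. h p * g p)"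
    by (rule complex_integral_density[OF sets_lines_measure h \<mu> gm gn])
  also have "\<dots> = (\<Sum>m<n. LINT x|lborel. h (x, real m) * g (x, real m))"
    by (rule integral_lines_measure[OF hg])
  also have "\<dots> = (\<Sum>m<n. fourier (\<lambda>x. h (x, real m)) \<xi> * cis (pi * \<eta>) ^ m)"
  proof (rule sum.cong[OF refl])
    fix m
    have "h (x, real m) * g (x, real m) = cis (pi * (x * \<xi>)) * h (x, real m) * cis (pi * \<eta>) ^ m" for x
      by (simp add: g_def Complex.DeMoivre distrib_left cis_mult[symmetric] mult_ac)
    then have "(LINT x|lborel. h (x, real m) * g (x, real m)) =
        (LINT x|lborel. cis (pi * (x * \<xi>)) * h (x, real m) * cis (pi * \<eta>) ^ m)"
      by (rule Bochner_Integration.integral_cong[OF refl])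
    also have "\<dots> = fourier (\<lambda>x. h (x, real m)) \<xi> * cis (pi * \<eta>) ^ m"
      unfolding fourier_def by (rule integral_mult_left_zero)
    finally show "(LINT x|lborel. h (x, real m) * g (x, real m)) = fourier (\<lambda>x. h (x, real m)) \<xi> * cis (pi * \<eta>) ^ m" .
  qed
  finally show ?thesis .
qed

text \<open>
  The measures in question are those with a density with respect to arc length on the lines, by the
  Radon-Nikodym theorem; the restrictions of the density to the lines form the tuple \<open>f\<close>. The
  measure vanishes iff the transforms of all \<open>f m\<close> do, by injectivity of the Fourier transform.
\<close>

lemma heisenberg_uniqueness_pair_lines_iff:
  "heisenberg_uniqueness_pair (UNIV \<times> real ` {..<n}) \<Lambda> \<longleftrightarrow>
     (\<forall>f. (\<forall>m<n. integrable lborel (f m)) \<longrightarrow>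
          (\<forall>\<xi>. \<forall>z \<in> phases \<Lambda> \<xi>. (\<Sum>m<n. fourier (f m) \<xi> * z ^ m) = 0) \<longrightarrow>
          (\<forall>m<n. \<forall>\<xi>. fourier (f m) \<xi> = 0))" (is "?L \<longleftrightarrow> ?R")
proof
  assume L: ?L
  show ?R
  proof (rule allI, intro impI)
    fix f assume f: "\<forall>m<n. integrable lborel (f m)"
      and van: "\<forall>\<xi>. \<forall>z \<in> phases \<Lambda> \<xi>. (\<Sum>m<n. fourier (f m) \<xi> * z ^ m) = 0"
    \<comment> \<open>The density that restricts to \<open>f m\<close> on the line of height \<open>m\<close>.\<close>
    define h where "h = (\<lambda>p. \<Sum>m<n. if snd p = real m then f m (fst p) else 0)"
    have hm: "h (x, real m) = f m x" if "m < n" for m x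
      using that by (simp add: h_def)
    have fm: "f m \<in> borel_measurable borel" if "m < n" for m
      using borel_measurable_integrable[of lborel "f m"] f that by simp
    have "h \<in> borel_measurable (borel \<Otimes>\<^sub>M borel)"
      unfolding h_def
    proof (intro borel_measurable_sum measurable_If)
      fix m assume "m \<in> {..<n}"
      then have "f m \<in> borel_measurable borel" using fm by simp
      then show "(\<lambda>p. f m (fst p)) \<in> borel_measurable (borel \<Otimes>\<^sub>M (borel :: real measure))"
        by (rule measurable_compose[OF measurable_fst])
    qed (auto intro: measurable_sets_Collect)
    then have hb: "h \<in> borel_measurable borel" by (simp add: borel_prod)
    have hi: "integrable (lines_measure n) h"
      using f by (simp add: integrable_lines_measure_iff[OF hb] hm)
    define \<mu> where "\<mu> = (\<lambda>A. set_lebesgue_integral (lines_measure n) A h)"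
    have fmu: "fourier_measure \<mu> (\<xi>, \<eta>) = (\<Sum>m<n. fourier (f m) \<xi> * cis (pi * \<eta>) ^ m)" for \<xi> \<eta>
    proof -
      have "fourier (\<lambda>x. h (x, real m)) \<xi> = fourier (f m) \<xi>" if "m < n" for m using hm[OF that] by simp
      then show ?thesis using fourier_measure_lines[OF hi, of \<mu> \<xi> \<eta>] by (simp add: \<mu>_def)
    qed
    have null: "\<mu> A = 0" if A: "A \<in> sets borel" "arc_length_on (UNIV \<times> real ` {..<n}) A = 0" for A
    proof -
      have "emeasure (lines_measure n) A = 0" using lines_measure_null_iff_arc_length_null[OF A(1)] A(2) by simp
      then have "A \<in> null_sets (lines_measure n)" using A(1) by (simp add: null_sets_def)
      then have "AE p in lines_measure n. indicat_real A p *\<^sub>R h p = 0"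
        by (rule AE_I'[where N=A]) (auto simp: indicator_def)
      then show ?thesis unfolding \<mu>_def set_lebesgue_integral_def by (rule integral_eq_zero_AE)
    qed
    have "complex_measure \<mu>" unfolding \<mu>_def by (rule complex_measure_density[OF sets_lines_measure hi])
    moreover have "abs_continuous_arc_length \<mu> (UNIV \<times> real ` {..<n})"
      unfolding abs_continuous_arc_length_def using null by blast
    moreover have "supported_on \<mu> (UNIV \<times> real ` {..<n})"
      unfolding supported_on_def
    proof (intro ballI impI)
      fix A :: "(real \<times> real) set" assume A: "A \<in> sets borel" "A \<inter> UNIV \<times> real ` {..<n} = {}"
      have "{x. (x, real m) \<in> A} = {}" if "m < n" for m using A(2) that by blast
      then have "emeasure (lines_measure n) A = 0"
        unfolding emeasure_lines_measure[OF A(1)] by simp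
      then show "\<mu> A = 0" using null A(1) lines_measure_null_iff_arc_length_null[OF A(1)] by simp
    qed
    moreover have "\<forall>p \<in> \<Lambda>. fourier_measure \<mu> p = 0"
    proof
      fix p assume p: "p \<in> \<Lambda>"
      obtain \<xi> \<eta> where "p = (\<xi>, \<eta>)" by (cases p)
      moreover from this p have "cis (pi * \<eta>) \<in> phases \<Lambda> \<xi>" unfolding phases_def by blast
      ultimately show "fourier_measure \<mu> p = 0" using van by (simp add: fmu)
    qed
    ultimately have z: "\<mu> A = 0" if "A \<in> sets borel" for A
      using L that unfolding heisenberg_uniqueness_pair_def by blast
    \<comment> \<open>The zero measure has density \<open>0\<close>, so the transform vanishes on the whole plane, and not only on \<open>\<Lambda>\<close>.\<close>
    have "fourier_measure \<mu> (\<xi>, \<eta>) = 0" for \<xi> \<eta>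
      using fourier_measure_lines[of n "\<lambda>_. 0" \<mu> \<xi> \<eta>] z by (simp add: fourier_def set_lebesgue_integral_def)
    then have sz: "(\<Sum>m<n. fourier (f m) \<xi> * cis (pi * \<eta>) ^ m) = 0" for \<xi> \<eta> by (simp add: fmu)
    show "\<forall>m<n. \<forall>\<xi>. fourier (f m) \<xi> = 0"
    proof (intro allI impI)
      fix m \<xi> assume m: "m < n"
      have "infinite ((\<lambda>\<eta>. cis (pi * \<eta>)) ` {0..<2})"
        using finite_imageD[OF _ inj_on_cis_pi] infinite_Ico[of 0 "2::real"] by auto
      then have Z: "infinite ((\<lambda>\<eta>. cis (pi * \<eta>)) ` {0..<2}) \<or> n \<le> card ((\<lambda>\<eta>. cis (pi * \<eta>)) ` {0..<2})" ..
      show "fourier (f m) \<xi> = 0"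
        by (rule coeffs_zero_of_many_roots[where a="\<lambda>m. fourier (f m) \<xi>", OF Z _ m]) (auto simp only: sz)
    qed
  qed
next
  assume R: ?R
  show ?L
    unfolding heisenberg_uniqueness_pair_def
  proof (intro allI impI ballI)
    fix \<mu> A
    assume \<mu>: "complex_measure \<mu>" and ac: "abs_continuous_arc_length \<mu> (UNIV \<times> real ` {..<n})"
      and van: "\<forall>p \<in> \<Lambda>. fourier_measure \<mu> p = 0" and A: "A \<in> sets (borel :: (real \<times> real) measure)"
    have "\<mu> B = 0" if "B \<in> sets borel" "emeasure (lines_measure n) B = 0" for B
      using ac that lines_measure_null_iff_arc_length_null[OF that(1)]
      unfolding abs_continuous_arc_length_def by blast
    then obtain h where h: "integrable (lines_measure n) h"
      "\<And>B. B \<in> sets borel \<Longrightarrow> \<mu> B = set_lebesgue_integral (lines_measure n) B h"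
      using complex_measure_Radon_Nikodym[OF sets_lines_measure sigma_finite_lines_measure \<mu>] by blast
    have hb: "h \<in> borel_measurable borel"
      using borel_measurable_integrable[OF h(1)] by (simp add: lines_measure_def)
    define f where "f = (\<lambda>m x. h (x, real m))"
    have f: "integrable lborel (f m)" if "m < n" for m
      using h(1) that unfolding integrable_lines_measure_iff[OF hb] f_def by blast
    have "(\<Sum>m<n. fourier (f m) \<xi> * z ^ m) = 0" if z: "z \<in> phases \<Lambda> \<xi>" for \<xi> z
    proof -
      obtain \<eta> where "(\<xi>, \<eta>) \<in> \<Lambda>" "z = cis (pi * \<eta>)" using z by (auto simp: phases_def)
      then show ?thesis using van fourier_measure_lines[OF h, of \<xi> \<eta>] by (simp add: f_def)
    qed
    then have "fourier (f m) \<xi> = 0" if "m < n" for m \<xi> using R f that by blast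
    then have f0: "AE x in lborel. f m x = 0" if "m < n" for m
      using fourier_zero_imp_AE_zero[OF f] that by blast
    have "integrable (lines_measure n) (\<lambda>p. indicator A p *\<^sub>R h p)"
      using A h(1) by (intro integrable_mult_indicator) auto
    then have "\<mu> A = (\<Sum>m<n. LINT x|lborel. indicator A (x, real m) *\<^sub>R h (x, real m))"
      unfolding h(2)[OF A] set_lebesgue_integral_def by (rule integral_lines_measure)
    also have "\<dots> = 0"
    proof (intro sum.neutral ballI)
      fix m assume "m \<in> {..<n}"
      then have "AE x in lborel. f m x = 0" using f0 by simp
      then have "AE x in lborel. indicat_real A (x, real m) *\<^sub>R h (x, real m) = 0"
        by eventually_elim (simp add: f_def)
      then show "(LINT x|lborel. indicat_real A (x, real m) *\<^sub>R h (x, real m)) = 0"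
        by (rule integral_eq_zero_AE)
    qed
    finally show "\<mu> A = 0" .
  qed
qed

text \<open>
  If the set is not dense, one monic polynomial of degree less than \<open>n\<close> vanishes on the phases over a
  whole interval. The number \<open>k\<close> of phases on a dense stratum decides which starred set provides it.
\<close>

lemma exists_local_monic_relation_on_interval:
  assumes n: "n \<ge> 2" and cl: "closed \<Lambda>"
    and per: "\<And>\<xi> \<eta>. (\<xi>, \<eta>) \<in> \<Lambda> \<longleftrightarrow> (\<xi>, \<eta> + 2) \<in> \<Lambda>"
    and nd: "closure (Pi_tilde_ne n \<Lambda>) \<noteq> UNIV"
  shows "\<exists>\<delta> d \<phi> \<xi>\<^sub>1. \<delta> > 0 \<and> d < n \<and> (\<forall>j<d. integrable lborel (\<phi> j)) \<and>
    (\<forall>\<xi> z. \<bar>\<xi> - \<xi>\<^sub>1\<bar> < \<delta> \<longrightarrow> z \<in> phases \<Lambda> \<xi> \<longrightarrow> z ^ d = (\<Sum>j<d. fourier (\<phi> j) \<xi> * z ^ j))"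
proof -
  have witness: ?thesis
    if "\<delta> > 0" "d < n" "\<And>j. j < d \<Longrightarrow> integrable lborel (\<phi> j)"
      "\<And>\<xi> z. \<bar>\<xi> - \<xi>\<^sub>1\<bar> < \<delta> \<Longrightarrow> z \<in> phases \<Lambda> \<xi> \<Longrightarrow> z ^ d = (\<Sum>j<d. fourier (\<phi> j) \<xi> * z ^ j)"
    for \<delta> d \<phi> \<xi>\<^sub>1
    using that by blast
  define T where "T = Pi_tilde_ne n \<Lambda>"
  define J where "J = - closure T"
  have J: "open J" "J \<noteq> {}" using nd by (auto simp: J_def T_def)
  have JT: "\<xi> \<notin> T" if "\<xi> \<in> J" for \<xi> using that closure_subset by (auto simp: J_def)
  have small: "finite (phases \<Lambda> \<xi>) \<and> card (phases \<Lambda> \<xi>) < n" if "\<xi> \<in> J" for \<xi>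
  proof (rule ccontr)
    assume "\<not> ?thesis"
    then have "\<xi> \<in> Pi_at_least \<Lambda> n" using n by (subst Pi_at_least_iff[OF per]) auto
    then show False using JT[OF that] unfolding T_def Pi_tilde_ne_def by blast
  qed
  obtain J' k where J': "open J'" "J' \<noteq> {}" "J' \<subseteq> J" "\<And>\<xi>. \<xi> \<in> J' \<Longrightarrow> card (phases \<Lambda> \<xi>) \<le> k"
    "J' \<subseteq> closure {\<xi>. card (phases \<Lambda> \<xi>) = k}"
    using exists_dense_stratum[OF J, of "\<lambda>\<xi>. card (phases \<Lambda> \<xi>)" n] small less_imp_le by blast
  have "J' \<inter> {\<xi>. card (phases \<Lambda> \<xi>) = k} \<noteq> {}"
    using open_Int_closure_eq_empty[OF J'(1), of "{\<xi>. card (phases \<Lambda> \<xi>) = k}"] J'(2,5) by blast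
  then obtain \<xi>\<^sub>0 where \<xi>0: "\<xi>\<^sub>0 \<in> J'" "card (phases \<Lambda> \<xi>\<^sub>0) = k" by blast
  have kn: "k < n" using small[of \<xi>\<^sub>0] \<xi>0 J'(3) by auto
  consider "k = 0" | "k = 1" | "k \<ge> 2" by linarith
  then show ?thesis
  proof cases
    case 1
    obtain \<delta> where \<delta>: "\<delta> > 0" "ball \<xi>\<^sub>0 \<delta> \<subseteq> J'" using J'(1) \<xi>0 openE by blast
    have "phases \<Lambda> \<xi> = {}" if "\<bar>\<xi> - \<xi>\<^sub>0\<bar> < \<delta>" for \<xi>
    proof -
      have "\<xi> \<in> J'" using that \<delta>(2) by (auto simp: dist_real_def abs_minus_commute subset_iff)
      then show ?thesis using J'(3,4) 1 small by fastforce
    qed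
    \<comment> \<open>Without phases nearby, even the relation \<open>1 = 0\<close> of degree \<open>0\<close> holds vacuously.\<close>
    then show ?thesis using witness[where \<delta>=\<delta> and d=0 and \<phi>="\<lambda>_ _. 0" and \<xi>\<^sub>1="\<xi>\<^sub>0"] \<delta>(1) n by simp
  next
    case 2
    have "\<xi>\<^sub>0 \<in> Pi_exactly \<Lambda> 1" using Pi_exactly_iff[OF per, of 1] \<xi>0 2 by simp
    then have "\<xi>\<^sub>0 \<in> Pi_star_deg \<Lambda> 1 (n - 1)"
      using JT[of \<xi>\<^sub>0] \<xi>0 J'(3) Pi_one_star_eq[OF per n] unfolding T_def Pi_tilde_ne_def by blast
    then obtain \<delta> \<phi> where \<phi>: "\<delta> > 0" "\<And>j. j < n - 1 \<Longrightarrow> integrable lborel (\<phi> j)"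
      "\<And>\<xi> z. \<bar>\<xi> - \<xi>\<^sub>0\<bar> < \<delta> \<Longrightarrow> card (phases \<Lambda> \<xi>) = 1 \<Longrightarrow> z \<in> phases \<Lambda> \<xi> \<Longrightarrow>
        z ^ (n - 1) = (\<Sum>j<n-1. fourier (\<phi> j) \<xi> * z ^ j)"
      unfolding Pi_star_deg_iff[OF per order_refl] by blast
    obtain \<delta>' where \<delta>': "\<delta>' > 0" "ball \<xi>\<^sub>0 \<delta>' \<subseteq> J'" using J'(1) \<xi>0 openE by blast
    have "z ^ (n - 1) = (\<Sum>j<n-1. fourier (\<phi> j) \<xi> * z ^ j)"
      if \<xi>: "\<bar>\<xi> - \<xi>\<^sub>0\<bar> < min \<delta> \<delta>'" and z: "z \<in> phases \<Lambda> \<xi>" for \<xi> z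
    proof -
      have "\<xi> \<in> J'" using \<xi> \<delta>'(2) by (auto simp: dist_real_def abs_minus_commute subset_iff)
      then have "card (phases \<Lambda> \<xi>) \<le> 1" "finite (phases \<Lambda> \<xi>)" using J'(3,4) 2 small by auto
      \<comment> \<open>A point outside the stratum has no phase, so the relation extends for free.\<close>
      moreover from this z have "card (phases \<Lambda> \<xi>) \<noteq> 0" by auto
      ultimately have "card (phases \<Lambda> \<xi>) = 1" by linarith
      then show ?thesis using \<phi>(3) \<xi> z by simp
    qed
    then show ?thesis using witness[of "min \<delta> \<delta>'" "n - 1" \<phi> \<xi>\<^sub>0] \<phi>(1,2) \<delta>'(1) n by simp
  next
    case 3
    have k1: "k \<ge> 1" using 3 by simp
    have "\<xi>\<^sub>0 \<in> Pi_exactly \<Lambda> k" using Pi_exactly_iff[OF per k1] \<xi>0 by simp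
    moreover have "k = n - 1 \<or> k \<in> {2..n-2}" using 3 kn by auto
    ultimately have "\<xi>\<^sub>0 \<in> Pi_star_deg \<Lambda> k k"
      using JT[of \<xi>\<^sub>0] \<xi>0 J'(3) unfolding T_def Pi_tilde_ne_def Pi_star_ne_def Pi_pred_star_def by blast
    then obtain \<delta> \<phi> where \<phi>: "\<delta> > 0" "\<And>j. j < k \<Longrightarrow> integrable lborel (\<phi> j)"
      "\<And>\<xi> z. \<bar>\<xi> - \<xi>\<^sub>0\<bar> < \<delta> \<Longrightarrow> card (phases \<Lambda> \<xi>) = k \<Longrightarrow> z \<in> phases \<Lambda> \<xi> \<Longrightarrow>
        z ^ k = (\<Sum>j<k. fourier (\<phi> j) \<xi> * z ^ j)"
      unfolding Pi_star_deg_iff[OF per k1] by blast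
    define K where "K = J' \<inter> ball \<xi>\<^sub>0 \<delta>"
    obtain \<delta>' where "\<delta>' > 0"
      "\<And>\<xi> z. \<bar>\<xi> - \<xi>\<^sub>0\<bar> < \<delta>' \<Longrightarrow> z \<in> phases \<Lambda> \<xi> \<Longrightarrow> z ^ k = (\<Sum>j<k. fourier (\<phi> j) \<xi> * z ^ j)"
    proof (rule vanishing_on_fibres_extends[of "phases \<Lambda>" K \<xi>\<^sub>0 k "\<lambda>j. fourier (\<phi> j)"])
      show "z \<in> phases \<Lambda> \<xi>" if "\<And>j::nat. w j \<in> phases \<Lambda> (x j)" "x \<longlonglongrightarrow> \<xi>" "w \<longlonglongrightarrow> z" for x w \<xi> z
        by (rule closed_phases[OF per cl that])
      show "open K" "\<xi>\<^sub>0 \<in> K" using J'(1) \<xi>0 \<phi>(1) by (auto simp: K_def)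
      show "isCont (fourier (\<phi> j)) \<xi>" if "j < k" for j \<xi> by (rule isCont_fourier[OF \<phi>(2)[OF that]])
      show "finite (phases \<Lambda> \<xi>)" "card (phases \<Lambda> \<xi>) \<le> k" if "\<xi> \<in> K" for \<xi>
        using that J'(3,4) small by (auto simp: K_def)
      show "K \<subseteq> closure {\<xi>. card (phases \<Lambda> \<xi>) = k}" using J'(5) by (auto simp: K_def)
      show "card (phases \<Lambda> \<xi>\<^sub>0) = k" by (rule \<xi>0(2))
      show "z ^ k = (\<Sum>j<k. fourier (\<phi> j) \<xi> * z ^ j)"
        if "\<xi> \<in> K" "card (phases \<Lambda> \<xi>) = k" "z \<in> phases \<Lambda> \<xi>" for \<xi> z
        using \<phi>(3)[OF _ that(2,3)] that(1) by (auto simp: K_def dist_real_def abs_minus_commute)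
    qed (use that in blast)
    then show ?thesis using witness[of \<delta>' k \<phi> \<xi>\<^sub>0] kn \<phi>(2) by blast
  qed
qed

text \<open>
  Otherwise multiply the monic polynomial over an interval by a bump function supported there. The
  product vanishes on all phases, and its coefficients, including the leading one, are Fourier transforms
  of integrable functions.
\<close>

lemma dense_of_heisenberg_uniqueness_pair:
  assumes n: "n \<ge> 2" and cl: "closed \<Lambda>"
    and per: "\<And>\<xi> \<eta>. (\<xi>, \<eta>) \<in> \<Lambda> \<longleftrightarrow> (\<xi>, \<eta> + 2) \<in> \<Lambda>"
    and hup: "heisenberg_uniqueness_pair (UNIV \<times> real ` {..<n}) \<Lambda>"
  shows "closure (Pi_tilde_ne n \<Lambda>) = UNIV"
proof (rule ccontr)
  assume nd: "closure (Pi_tilde_ne n \<Lambda>) \<noteq> UNIV"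
  obtain \<xi>\<^sub>1 \<delta> d \<phi> where \<delta>: "\<delta> > 0" and d: "d < n" and \<phi>: "\<And>j. j < d \<Longrightarrow> integrable lborel (\<phi> j)"
    and rel: "\<And>\<xi> z. \<bar>\<xi> - \<xi>\<^sub>1\<bar> < \<delta> \<Longrightarrow> z \<in> phases \<Lambda> \<xi> \<Longrightarrow> z ^ d = (\<Sum>j<d. fourier (\<phi> j) \<xi> * z ^ j)"
    using exists_local_monic_relation_on_interval[OF n cl per nd] by blast
  obtain g where g: "integrable lborel g" "\<And>\<xi>. \<bar>\<xi> - \<xi>\<^sub>1\<bar> \<le> \<delta> / 3 \<Longrightarrow> fourier g \<xi> = 1"
    "\<And>\<xi>. \<bar>\<xi> - \<xi>\<^sub>1\<bar> \<ge> \<delta> \<Longrightarrow> fourier g \<xi> = 0"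
    using exists_plateau[OF \<delta>, of \<xi>\<^sub>1] by blast
  have "\<exists>u. integrable lborel u \<and> fourier u = (\<lambda>\<xi>. fourier (\<phi> j) \<xi> * fourier g \<xi>)" if "j < d" for j
    using convolution_L1[OF \<phi>[OF that] g(1)] by blast
  then obtain u where u: "\<And>j. j < d \<Longrightarrow> integrable lborel (u j)"
    "\<And>j. j < d \<Longrightarrow> fourier (u j) = (\<lambda>\<xi>. fourier (\<phi> j) \<xi> * fourier g \<xi>)" by metis
  define f where "f = (\<lambda>m x. if m < d then (-1) * u m x else if m = d then g x else 0)"
  have f: "integrable lborel (f m)" for m
    unfolding f_def using u(1)[of m] g(1) by (cases "m < d"; cases "m = d") auto
  have ff: "fourier (f m) \<xi> = (if m < d then - fourier (\<phi> m) \<xi> * fourier g \<xi> else if m = d then fourier g \<xi> else 0)" for m \<xi>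
  proof (cases "m < d")
    case True
    then show ?thesis using fourier_cmult[of "-1" "u m" \<xi>] u(2)[of m] by (simp add: f_def)
  next
    case False
    then show ?thesis by (auto simp: f_def fourier_def)
  qed
  have "(\<Sum>m<n. fourier (f m) \<xi> * z ^ m) = 0" if z: "z \<in> phases \<Lambda> \<xi>" for \<xi> z
  proof -
    have "(\<Sum>m<n. fourier (f m) \<xi> * z ^ m) = (\<Sum>m<Suc d. fourier (f m) \<xi> * z ^ m)"
      using d by (intro sum.mono_neutral_right) (auto simp: ff)
    also have "\<dots> = fourier g \<xi> * (z ^ d - (\<Sum>m<d. fourier (\<phi> m) \<xi> * z ^ m))"
      by (simp add: ff sum_distrib_left sum_negf right_diff_distrib mult_ac)
    also have "\<dots> = 0" using rel[OF _ z] g(3)[of \<xi>] by (cases "\<bar>\<xi> - \<xi>\<^sub>1\<bar> < \<delta>") auto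
    finally show ?thesis .
  qed
  then have "fourier (f d) \<xi>\<^sub>1 = 0"
    using hup f d unfolding heisenberg_uniqueness_pair_lines_iff by blast
  then show False using g(2)[of \<xi>\<^sub>1] \<delta> by (simp add: ff)
qed

text \<open>
  A polynomial that vanishes on all phases but is nonzero at a point of the dense set becomes
  monic of degree \<open>n - 1\<close> near that point, whatever the number of its phases. So the point lies in every
  starred set to which it could belong, and the only part of the dense set left for it is the
  one with at least \<open>n\<close> phases, where the polynomial has too many roots.
\<close>

lemma heisenberg_uniqueness_pair_of_dense:
  assumes n: "n \<ge> 2"
    and per: "\<And>\<xi> \<eta>. (\<xi>, \<eta>) \<in> \<Lambda> \<longleftrightarrow> (\<xi>, \<eta> + 2) \<in> \<Lambda>"
    and dense: "closure (Pi_tilde_su n \<Lambda>) = UNIV"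
  shows "heisenberg_uniqueness_pair (UNIV \<times> real ` {..<n}) \<Lambda>"
  unfolding heisenberg_uniqueness_pair_lines_iff
proof (rule allI, intro impI)
  fix f assume f: "\<forall>m<n. integrable lborel (f m)"
    and van: "\<forall>\<xi>. \<forall>z \<in> phases \<Lambda> \<xi>. (\<Sum>m<n. fourier (f m) \<xi> * z ^ m) = 0"
  show "\<forall>m<n. \<forall>\<xi>. fourier (f m) \<xi> = 0"
  proof (rule ccontr)
    assume "\<not> (\<forall>m<n. \<forall>\<xi>. fourier (f m) \<xi> = 0)"
    then obtain m \<xi> where m: "m < n" "fourier (f m) \<xi> \<noteq> 0" by blast
    define O' where "O' = {x. fourier (f m) x \<noteq> 0}"
    have "continuous_on UNIV (fourier (f m))"
      using isCont_fourier f m(1) by (intro continuous_at_imp_continuous_on) auto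
    then have "open O'" unfolding O'_def
      by (intro open_Collect_neq continuous_on_const)
    moreover have "O' \<noteq> {}" using m(2) by (auto simp: O'_def)
    ultimately have "O' \<inter> Pi_tilde_su n \<Lambda> \<noteq> {}"
      using open_Int_closure_eq_empty[of O' "Pi_tilde_su n \<Lambda>"] dense by simp
    then obtain \<xi>\<^sub>0 where \<xi>0: "\<xi>\<^sub>0 \<in> Pi_tilde_su n \<Lambda>" "fourier (f m) \<xi>\<^sub>0 \<noteq> 0"
      unfolding O'_def by blast
    have nl: "{..n - 1} = {..<n}" using n by auto
    obtain \<phi> \<delta> where \<phi>: "\<And>j. j < n - 1 \<Longrightarrow> integrable lborel (\<phi> j)" "\<delta> > 0"
      "\<And>\<xi> z. \<bar>\<xi> - \<xi>\<^sub>0\<bar> < \<delta> \<Longrightarrow> norm z = 1 \<Longrightarrow> (\<Sum>m\<le>n - 1. fourier (f m) \<xi> * z ^ m) = 0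
       \<Longrightarrow> z ^ (n - 1) = (\<Sum>j<n - 1. fourier (\<phi> j) \<xi> * z ^ j)"
    proof (rule local_monic_relation[of "n - 1" f m \<xi>\<^sub>0])
      show "integrable lborel (f j)" if "j \<le> n - 1" for j using f that n by auto
      show "m \<le> n - 1" using m by simp
    qed (use \<xi>0 in auto)
    have rel: "z ^ (n - 1) = (\<Sum>j<n - 1. fourier (\<phi> j) \<xi> * z ^ j)"
      if "\<bar>\<xi> - \<xi>\<^sub>0\<bar> < \<delta>" "z \<in> phases \<Lambda> \<xi>" for \<xi> z
      using \<phi>(3)[OF that(1) norm_phases[OF that(2)]] van that(2) unfolding nl by blast
    have star: "\<xi>\<^sub>0 \<in> Pi_star_deg \<Lambda> k (n - 1)" if k: "k \<ge> 1" "\<xi>\<^sub>0 \<in> Pi_exactly \<Lambda> k" for k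
      unfolding Pi_star_deg_iff[OF per k(1)] using k Pi_exactly_iff[OF per k(1)] \<phi>(1,2) rel by blast
    have "\<xi>\<^sub>0 \<in> Pi_at_least \<Lambda> n"
      using \<xi>0(1) star[of 1] star[of "n - 1"] star n Pi_one_star_eq[OF per n]
      unfolding Pi_tilde_su_def Pi_star_su_def Pi_pred_star_def by auto
    then have "infinite (phases \<Lambda> \<xi>\<^sub>0) \<or> n \<le> card (phases \<Lambda> \<xi>\<^sub>0)"
      using Pi_at_least_iff[OF per, of n] n by simp
    then have "fourier (f m) \<xi>\<^sub>0 = 0"
      by (rule coeffs_zero_of_many_roots[OF _ _ m(1)]) (use van in blast)
    then show False using \<xi>0(2) by simp
  qed
qed

theorem theorem2p2:
  fixes n :: nat and \<Gamma> \<Lambda> :: "(real \<times> real) set"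
  assumes "n \<ge> 2"
    and "\<Gamma> = UNIV \<times> real ` {0..n - 1}"
    and "closed \<Lambda>"
    and "\<And>\<xi> \<eta>. (\<xi>, \<eta>) \<in> \<Lambda> \<longleftrightarrow> (\<xi>, \<eta> + 2) \<in> \<Lambda>"
  shows "(heisenberg_uniqueness_pair \<Gamma> \<Lambda> \<longrightarrow> closure (Pi_tilde_ne n \<Lambda>) = UNIV) \<and>
         (closure (Pi_tilde_su n \<Lambda>) = UNIV \<longrightarrow> heisenberg_uniqueness_pair \<Gamma> \<Lambda>)"
proof -
  have "{0..n - 1} = {..<n}" using assms(1) by auto
  then have \<Gamma>: "\<Gamma> = UNIV \<times> real ` {..<n}" using assms(2) by simp
  show ?thesis
    unfolding \<Gamma> using dense_of_heisenberg_uniqueness_pair[OF assms(1,3,4)] heisenberg_uniqueness_pair_of_dense[OF assms(1,4)] by blast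
qed

end
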